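(* Let $q$ be a power of an odd prime, $d\ge4$ even, $j\in\mathbb F_q^*$, $S_j=\{x\in\mathbb F_q^d: x_1^2+\cdots+x_d^2=j\}$, $A\subset S_j$ and $B\subset\mathbb F_q^d$. If $|A||B|\ge16q^d$ and either $|A|\le q^{(d-1)/2}$ or $|A|\ge q^{d/2}$, then $|\Delta(A,B)|\ge q/144$.
   Context: $\|x-y\|=\sum_{i}(x_i-y_i)^2$ and $\Delta(A,B)=\{\|a-b\|:a\in A,b\in B\}$. *)

theory Defs
  imports Complex_Main "HOL-Analysis.Finite_Cartesian_Product" "HOL-Computational_Algebra.Primes"
begin

definition sqdist :: "'k::comm_ring_1 ^ 'n::finite \<Rightarrow> 'k ^ 'n \<Rightarrow> 'k" where
  "sqdist x y = (\<Sum>i\<in>UNIV. (x $ i - y $ i)^2)"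

definition sphere_j :: "'k::comm_ring_1 \<Rightarrow> ('k ^ 'n::finite) set" where
  "sphere_j j = {x. (\<Sum>i\<in>UNIV. (x $ i)^2) = j}"

definition dist_set :: "('k::comm_ring_1 ^ 'n::finite) set \<Rightarrow> ('k ^ 'n) set \<Rightarrow> 'k set" where
  "dist_set A B = {sqdist a b | a b. a \<in> A \<and> b \<in> B}"

end

theory Submission
  imports "HOL-Algebra.Algebraic_Closure_Type" Defs "HOL-Analysis.Convex"
begin

text \<open>
  Since \<open>A\<close> lies on the sphere \<open>S\<^sub>j\<close>, the distance \<open>\<parallel>a - b\<parallel>\<close> equals \<open>j + \<parallel>b\<parallel> - 2 a \<cdot> b\<close>. By Cauchy-Schwarz it
  suffices to bound the number of pairs of pairs with equal distance, which amounts to the estimate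
  \<open>M = (\<Sum>s \<noteq> 0. |\<Sum>a b. \<psi> (s (\<parallel>b\<parallel> - 2 a \<cdot> b))|\<^sup>2) \<le> 3 |A|\<^sup>2 |B|\<^sup>2\<close> for a nontrivial additive character \<open>\<psi>\<close>.

  If \<open>|A| \<ge> q\<^bsup>d/2\<^esup>\<close>, apply Cauchy-Schwarz to the sum over \<open>a\<close>, extend it to all of \<open>S\<^sub>j\<close> and use the Fourier
  transform of the sphere, which for even \<open>d\<close> is free of quadratic characters.

  If \<open>|A| \<le> q\<^bsup>(d-1)/2\<^esup>\<close>, view \<open>M\<close> through the Gram matrix of the functions
  \<open>b \<mapsto> \<Sum>a. \<psi> (s (\<parallel>b\<parallel> - 2 a \<cdot> b))\<close>, indexed by \<open>s \<noteq> 0\<close>. In the variable \<open>1 / s\<close> and up to a diagonal unitary its off-diagonal part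
  is a convolution, so its norm is bounded by its Fourier transform, a sum of Kloosterman sums
  over the pairs in \<open>A \<times> A\<close>. The zero frequency is treated by the Fourier transform of \<open>S\<^sub>j\<close> again, all others by
  Weil's bound \<open>2 \<surd>q\<close>.

  Weil's bound is proved in the algebraic closure. The Stepanov-Bombieri method bounds the number of
  \<open>x\<close> in the extension of degree \<open>n = 2 k\<close> with \<open>Tr (a x + b / x) = c\<close> by \<open>q\<^bsup>n-1\<^esup> + 3 q\<^bsup>n/2\<^esup>\<close>, hence the
  Kloosterman sum over that extension is \<open>O(q\<^bsup>n/2\<^esup>)\<close>; on the other hand the L-function, a polynomial of
  degree 2, shows that it equals \<open>- (u\<^sup>n + v\<^sup>n)\<close> with \<open>u v = q\<close>.
\<close>

section \<open>Stepanov's method for a function with two poles\<close>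

text \<open>The threshold \<open>q^((d-1)/2)\<close> is where \<open>|A|^2\<close> pairs, each
  costing Weil's \<open>2 sqrt q\<close>, stay below \<open>2 |A| q^(d/2)\<close>. At frequency zero
  Weil's bound says nothing: a pair with \<open>qf (a - a') = 0\<close> contributes
  \<open>q - 1\<close> without cancellation, and such pairs may be numerous, so the position of
  \<open>A\<close> on the sphere has to be used again. The variable \<open>1 / s\<close> is dictated
  by completing the square: \<open>(j (s - s')^2 + s s' t) / (s - s')\<close> equals
  \<open>j (s - s') + t / (1/s' - 1/s)\<close>, which separates \<open>s\<close> and
  \<open>s'\<close> up to the difference of their reciprocals. Stepanov's method is run in even
  degree \<open>2 k\<close> because that field has \<open>R^2\<close> elements with
  \<open>R = q^k\<close>, so that raising to the power \<open>R\<close> twice is the identity. Even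
  degrees suffice for Weil's bound: \<open>u v = q\<close> lets one growth estimate control both
  \<open>|u|\<close> and \<open>|v|\<close>, and upper bounds for the trace fibres are enough
  because their sizes have a known sum. In both cases the energy is at most 3 times the square of
  the number of pairs, which gives at least \<open>q / (1 + 3)\<close> distances.\<close>

lemma smult_sum_right: "smult c (\<Sum>i\<in>S. f i) = (\<Sum>i\<in>S. smult c (f i))"
  by (induction S rule: infinite_finite_induct) (auto simp: smult_add_right)

text \<open>Elimination, by induction on the equations: an unknown \<open>u0\<close> with nonzero
  coefficient in \<open>e\<close> is solved for and substituted into the others, at the price of one
  equation and one unknown.\<close>

lemma homogeneous_system_nontrivial:
  fixes M :: "'e \<Rightarrow> 'u \<Rightarrow> 'f::field"
  assumes "finite E" "finite U" "card E < card U"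
  shows "\<exists>d. (\<exists>u\<in>U. d u \<noteq> 0) \<and> (\<forall>e\<in>E. (\<Sum>u\<in>U. M e u * d u) = 0)"
  using assms
proof (induction E arbitrary: U M rule: finite_induct)
  case empty
  then have "U \<noteq> {}" by auto
  then show ?case by (intro exI[of _ "\<lambda>_. 1"]) auto
next
  case (insert e E)
  show ?case
  proof (cases "\<forall>u\<in>U. M e u = 0")
    case True
    then show ?thesis using insert.IH[of U M] insert.prems insert.hyps by auto
  next
    case False
    then obtain u0 where u0: "u0 \<in> U" "M e u0 \<noteq> 0" by auto
    define V where "V = U - {u0}"
    have V: "finite V" "card E < card V" "U = insert u0 V" "u0 \<notin> V"
      using insert u0 by (auto simp: V_def)
    obtain d where d: "\<exists>u\<in>V. d u \<noteq> 0"
      "\<And>e'. e' \<in> E \<Longrightarrow> (\<Sum>u\<in>V. (M e' u - M e' u0 * M e u / M e u0) * d u) = 0"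
      using insert.IH[OF V(1,2), of "\<lambda>e' u. M e' u - M e' u0 * M e u / M e u0"] by blast
    define d' where "d' = d(u0 := - (\<Sum>u\<in>V. M e u * d u) / M e u0)"
    have sumV: "(\<Sum>u\<in>V. N u * d' u) = (\<Sum>u\<in>V. N u * d u)" for N
      by (rule sum.cong) (use V in \<open>auto simp: d'_def\<close>)
    have "(\<Sum>u\<in>U. M e' u * d' u) = M e' u0 * d' u0 + (\<Sum>u\<in>V. M e' u * d u)" for e'
      using V sumV by simp
    moreover have "(\<Sum>u\<in>V. M e' u * d u) = M e' u0 / M e u0 * (\<Sum>u\<in>V. M e u * d u)" if "e' \<in> E" for e'
      using d(2)[OF that]
      by (simp add: algebra_simps sum_subtractf sum_distrib_left)
    ultimately have "\<forall>e'\<in>insert e E. (\<Sum>u\<in>U. M e' u * d' u) = 0"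
      using u0 by (auto simp: d'_def)
    moreover have "\<exists>u\<in>U. d' u \<noteq> 0" using d(1) V by (auto simp: d'_def)
    ultimately show ?thesis by blast
  qed
qed

text \<open>
  The coefficient of \<open>y\<^sup>r\<close> in \<open>x \<cdot> y\<^sup>e\<close> after reduction by \<open>x \<cdot> y\<^sup>q = x \<cdot> y + F\<close>; a single reduction
  suffices for \<open>e < 2 q - 1\<close>.
\<close>
definition red_coeff :: "nat \<Rightarrow> 'a::field poly \<Rightarrow> nat \<Rightarrow> nat \<Rightarrow> 'a poly" where
  "red_coeff q F e r =
     (if e < q then (if r = e then [:0, 1:] else 0)
      else (if r = e - q + 1 then [:0, 1:] else 0) + (if r = e - q then F else 0))"

text \<open>
  The coefficient of \<open>y\<^sup>r\<close> in \<open>x\<^sup>i y\<^sup>l (x\<^sup>j y\<^sup>m)\<^bsup>\<rho> q\<^esup>\<close>, where \<open>y\<^bsup>\<rho> q\<^esup> = y + U / x\<^bsup>\<rho>\<^esup>\<close>, multiplied by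
  \<open>x\<^bsup>\<rho> (q - 1) + 1\<^esup>\<close> to clear denominators.
\<close>
definition stepanov_monomial ::
  "nat \<Rightarrow> nat \<Rightarrow> 'a::field poly \<Rightarrow> 'a poly \<Rightarrow> nat \<times> nat \<times> nat \<times> nat \<Rightarrow> nat \<Rightarrow> 'a poly" where
  "stepanov_monomial q \<rho> U F = (\<lambda>(i, l, j, m) r.
     \<Sum>s\<le>m. smult (of_nat (m choose s))
       (monom 1 (i + \<rho> * q * j + \<rho> * (q - 1 - (m - s))) * U ^ (m - s) * red_coeff q F (l + s) r))"

lemma poly_red_coeff_sum:
  assumes "x * y ^ q = x * y + poly F x" "e + 1 < 2 * q"
  shows "(\<Sum>r<q. poly (red_coeff q F e r) x * y ^ r) = x * y ^ e"
proof (cases "e < q")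
  case True
  have "(\<Sum>r<q. poly (red_coeff q F e r) x * y ^ r) = (\<Sum>r<q. if r = e then x * y ^ r else 0)"
    using True by (intro sum.cong) (auto simp: red_coeff_def)
  then show ?thesis using True by simp
next
  case False
  have "(\<Sum>r<q. poly (red_coeff q F e r) x * y ^ r)
      = (\<Sum>r<q. (if r = e - q + 1 then x * y ^ r else 0) + (if r = e - q then poly F x * y ^ r else 0))"
    using False by (intro sum.cong) (auto simp: red_coeff_def)
  also have "\<dots> = x * y ^ (e - q + 1) + poly F x * y ^ (e - q)"
    using assms(2) False by (simp add: sum.distrib)
  also have "\<dots> = (x * y ^ q) * y ^ (e - q)" by (simp add: assms(1) algebra_simps)
  also have "\<dots> = x * y ^ e" using False by (simp add: mult.assoc flip: power_add)
  finally show ?thesis .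
qed

text \<open>The power \<open>y ^ (\<rho> * q * m)\<close> is \<open>(y + u) ^ m\<close>, expanded
  binomially. The term with \<open>u ^ (m - s)\<close> has denominator
  \<open>x ^ (\<rho> * (m - s))\<close>, and \<open>m < q\<close> makes
  \<open>x ^ (\<rho> * (q - 1))\<close> a common denominator; the remaining factor \<open>x\<close>
  pays for the single reduction in \<open>red_coeff\<close>.\<close>

lemma poly_stepanov_monomial_sum:
  assumes y: "x * y ^ q = x * y + poly F x" and u: "y ^ (\<rho> * q) = y + u" "poly U x = x ^ \<rho> * u"
    and lm: "l < q" "m < q"
  shows "(\<Sum>r<q. poly (stepanov_monomial q \<rho> U F (i, l, j, m) r) x * y ^ r)
       = x ^ (\<rho> * (q - 1) + 1) * (x ^ i * y ^ l * (x ^ j * y ^ m) ^ (\<rho> * q))"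
proof -
  have "(\<Sum>r<q. poly (stepanov_monomial q \<rho> U F (i, l, j, m) r) x * y ^ r)
     = (\<Sum>s\<le>m. of_nat (m choose s) * (x ^ (i + \<rho> * q * j + \<rho> * (q - 1 - (m - s))) * (x ^ \<rho> * u) ^ (m - s))
         * (\<Sum>r<q. poly (red_coeff q F (l + s) r) x * y ^ r))"
    unfolding stepanov_monomial_def
    by (simp add: poly_sum poly_monom u(2) sum_distrib_left sum_distrib_right mult.assoc sum.swap[of _ "{..m}"])
  also have "\<dots> = (\<Sum>s\<le>m. x ^ (i + \<rho> * q * j + \<rho> * (q - 1) + 1) * y ^ l * (of_nat (m choose s) * y ^ s * u ^ (m - s)))"
  proof (rule sum.cong, goal_cases)
    case (2 s)
    then have s: "s \<le> m" by simp
    have "\<rho> * (q - 1 - (m - s)) + \<rho> * (m - s) = \<rho> * (q - 1)"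
      using lm(2) by (simp flip: add_mult_distrib2)
    then have *: "x ^ (\<rho> * (q - 1 - (m - s))) * x ^ (\<rho> * (m - s)) = x ^ (\<rho> * (q - 1))"
      by (simp flip: power_add)
    have "(x ^ (i + \<rho> * q * j + \<rho> * (q - 1 - (m - s))) * (x ^ \<rho> * u) ^ (m - s))
        = x ^ (i + \<rho> * q * j) * (x ^ (\<rho> * (q - 1 - (m - s))) * x ^ (\<rho> * (m - s))) * u ^ (m - s)"
      by (simp add: power_add power_mult_distrib power_mult mult_ac)
    also have "\<dots> = x ^ (i + \<rho> * q * j + \<rho> * (q - 1)) * u ^ (m - s)"
      by (simp only: * power_add)
    finally have eq: "x ^ (i + \<rho> * q * j + \<rho> * (q - 1 - (m - s))) * (x ^ \<rho> * u) ^ (m - s)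
      = x ^ (i + \<rho> * q * j + \<rho> * (q - 1)) * u ^ (m - s)" .
    have "l + s + 1 < 2 * q" using lm s by linarith
    note red = poly_red_coeff_sum[OF y this]
    show ?case unfolding eq red by (simp only: power_add power_one_right mult_ac)
  qed simp
  also have "\<dots> = x ^ (i + \<rho> * q * j + \<rho> * (q - 1) + 1) * y ^ l * (y + u) ^ m"
    by (simp add: binomial_ring sum_distrib_left)
  also have "\<dots> = x ^ (\<rho> * (q - 1) + 1) * (x ^ i * y ^ l * (x ^ j * y ^ m) ^ (\<rho> * q))"
  proof -
    have "(y ^ m) ^ (\<rho> * q) = (y + u) ^ m"
      by (metis u(1) power_mult mult.commute)
    moreover have "(x ^ j) ^ (\<rho> * q) = x ^ (\<rho> * q * j)" by (metis power_mult mult.commute)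
    ultimately show ?thesis by (simp only: power_mult_distrib power_add mult_ac)
  qed
  finally show ?thesis .
qed

lemma degree_red_coeff_le: "degree F \<le> 2 \<Longrightarrow> degree (red_coeff q F e r) \<le> 2"
  unfolding red_coeff_def by (auto intro!: degree_add_le)

text \<open>Raising \<open>s\<close> by one trades a factor \<open>U\<close>, of degree
  \<open>2 * \<rho>\<close>, for \<open>x ^ \<rho>\<close> and so lowers the degree by
  \<open>\<rho>\<close>. The bound keeps this \<open>- s\<close> because the independence proof
  needs the terms with \<open>s > 0\<close> to be strictly below the leading one.\<close>

lemma degree_stepanov_monomial_summand_le:
  assumes "degree F \<le> 2" "degree U = 2 * \<rho>" "m < q" "s \<le> m"
  shows "degree (smult z (monom 1 (i + \<rho> * q * j + \<rho> * (q - 1 - (m - s))) * U ^ (m - s) * red_coeff q F e r))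
      \<le> i + \<rho> * (q - 1) + \<rho> * (q * j + m - s) + 2" (is "degree ?p \<le> _")
proof -
  have "degree ?p \<le> (i + \<rho> * q * j + \<rho> * (q - 1 - (m - s))) + 2 * \<rho> * (m - s) + 2"
    by (intro order.trans[OF degree_smult_le] order.trans[OF degree_mult_le] add_mono
        degree_red_coeff_le assms order.trans[OF degree_power_le] order.trans[OF degree_monom_le])
      (simp_all add: assms)
  also have "\<rho> * (q - 1 - (m - s)) + 2 * \<rho> * (m - s) = \<rho> * (q - 1) + \<rho> * (m - s)"
  proof -
    have "(q - 1 - (m - s)) + 2 * (m - s) = (q - 1) + (m - s)" using assms(3) by linarith
    then have "\<rho> * ((q - 1 - (m - s)) + 2 * (m - s)) = \<rho> * ((q - 1) + (m - s))" by simp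
    then show ?thesis by (simp only: add_mult_distrib2 mult_ac)
  qed
  then have "(i + \<rho> * q * j + \<rho> * (q - 1 - (m - s))) + 2 * \<rho> * (m - s) + 2
      = i + \<rho> * (q - 1) + (\<rho> * (q * j) + \<rho> * (m - s)) + 2" by (simp add: mult.assoc)
  also have "\<rho> * (q * j) + \<rho> * (m - s) = \<rho> * (q * j + m - s)"
    using assms(4) by (simp flip: add_mult_distrib2)
  finally show ?thesis .
qed


lemma degree_stepanov_monomial_le:
  assumes "degree F \<le> 2" "degree U = 2 * \<rho>" "m < q"
  shows "degree (stepanov_monomial q \<rho> U F (i, l, j, m) r) \<le> i + \<rho> * (q - 1) + \<rho> * (q * j + m) + 2"
  unfolding stepanov_monomial_def prod.case
proof (rule degree_sum_le)
  fix s assume "s \<in> {..m}"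
  then have "s \<le> m" by simp
  show "degree (smult (of_nat (m choose s)) (monom 1 (i + \<rho> * q * j + \<rho> * (q - 1 - (m - s)))
      * U ^ (m - s) * red_coeff q F (l + s) r)) \<le> i + \<rho> * (q - 1) + \<rho> * (q * j + m) + 2"
    by (rule order.trans[OF degree_stepanov_monomial_summand_le[OF assms \<open>s \<le> m\<close>]]) simp
qed simp

text \<open>
  On the curve \<open>x \<cdot> y\<^sup>q = x \<cdot> y + F\<close> the function \<open>x\<^sup>i y\<^sup>l (x\<^sup>j y\<^sup>m)\<^bsup>\<rho> q\<^esup>\<close> has a pole at infinity whose
  order \<open>q i + l + \<rho> q (q j + m)\<close> determines \<open>(i, l, j, m)\<close>, provided that \<open>i < \<rho>\<close>;
  the following is the elementary form of this remark.
\<close>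
lemma stepanov_monomial_independent:
  fixes F U :: "'a::field poly"
  assumes deg: "degree F \<le> 2" "degree U = 2 * \<rho>" and U: "U \<noteq> 0"
    and I: "I < \<rho>" and fin: "finite B" and B: "B \<subseteq> {..<I} \<times> {..<q} \<times> {..<J} \<times> {..<q}"
    and c: "\<exists>t\<in>B. c t \<noteq> 0"
  shows "\<exists>r<q. (\<Sum>t\<in>B. smult (c t) (stepanov_monomial q \<rho> U F t r)) \<noteq> 0"
proof -
  define wt where "wt = (\<lambda>(i::nat, l::nat, j, m). q * j + m)"
  define N where "N = {t \<in> B. c t \<noteq> 0}"
  have N: "finite N" "N \<noteq> {}" using fin c by (auto simp: N_def)
  have "Max (wt ` N) \<in> wt ` N" using N by (intro Max_in) auto
  then obtain i0 l0 j0 m0 where t0: "(i0, l0, j0, m0) \<in> N" "Max (wt ` N) = q * j0 + m0"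
    by (auto simp: wt_def)
  have wt_le: "q * j + m \<le> q * j0 + m0" if "(i, l, j, m) \<in> N" for i l j m
  proof -
    have "wt (i, l, j, m) \<le> Max (wt ` N)" using that N by (intro Max_ge) auto
    then show ?thesis using t0(2) by (simp add: wt_def)
  qed
  have b0: "i0 < I" "l0 < q" "m0 < q" using t0 B by (auto simp: N_def)
  \<comment> \<open>\<open>K\<close> is the summand \<open>s = 0\<close> of the coefficient of
    \<open>y ^ l0\<close> in a monomial \<open>(i, l0, j0, m0)\<close> of maximal weight, stripped
    of \<open>x ^ i\<close>; \<open>D\<close> is its degree. Everything outside \<open>main\<close>
    will have degree below \<open>D\<close>.\<close>
  define D where "D = \<rho> * (q - 1) + 1 + \<rho> * (q * j0 + m0)"
  define K where "K = monom 1 (\<rho> * q * j0 + \<rho> * (q - 1 - m0)) * U ^ m0 * [:0, 1:]"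
  define main where "main = (\<lambda>(i, l, j, m). if l = l0 \<and> j = j0 \<and> m = m0 \<and> c (i, l, j, m) \<noteq> 0 then monom (c (i, l, j, m)) i * K else 0)"
  have K: "degree K = D" "K \<noteq> 0"
  proof -
    show "K \<noteq> 0" using U by (auto simp: K_def)
    have "\<rho> * (q - 1 - m0) + 2 * \<rho> * m0 = \<rho> * (q - 1) + \<rho> * m0"
    proof -
      have "(q - 1 - m0) + 2 * m0 = (q - 1) + m0" using b0(3) by linarith
      then have "\<rho> * ((q - 1 - m0) + 2 * m0) = \<rho> * ((q - 1) + m0)" by simp
      then show ?thesis by (simp only: add_mult_distrib2 mult_ac)
    qed
    then show "degree K = D" using U
      by (simp add: K_def degree_mult_eq degree_monom_eq degree_power_eq deg D_def add_mult_distrib2 mult_ac)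
  qed
  have rest: "degree (smult (c t) (stepanov_monomial q \<rho> U F t l0) - main t) < D" if "t \<in> B" for t
  proof (cases "c t = 0")
    case True
    then show ?thesis by (cases t) (auto simp: main_def D_def)
  next
    case False
    obtain i l j m where t: "t = (i, l, j, m)" by (cases t)
    have tN: "(i, l, j, m) \<in> N" using that False t by (auto simp: N_def)
    have b: "i < I" "l < q" "m < q" using that B t by auto
    show ?thesis
    proof (cases "q * j + m = q * j0 + m0")
      case False
      then have "q * j + m < q * j0 + m0" using wt_le[OF tN] by simp
      moreover have nd: "\<not> (j = j0 \<and> m = m0)" using False by auto
      ultimately have "\<rho> * (q * j + m + 1) \<le> \<rho> * (q * j0 + m0)" by (intro mult_le_mono2) simp
      \<comment> \<open>A smaller weight costs \<open>\<rho>\<close> in degree, while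
        \<open>i + 2 \<le> \<rho>\<close>: this is where \<open>I < \<rho>\<close> enters.\<close>
      then have "i + \<rho> * (q - 1) + \<rho> * (q * j + m) + 2 < D"
        using b(1) I by (simp add: D_def add_mult_distrib2)
      moreover have "degree (smult (c t) (stepanov_monomial q \<rho> U F t l0)) \<le> i + \<rho> * (q - 1) + \<rho> * (q * j + m) + 2"
        unfolding t by (intro order.trans[OF degree_smult_le] degree_stepanov_monomial_le deg b)
      ultimately show ?thesis using nd by (auto simp: main_def t)
    next
      case True
      then have jm: "j = j0" "m = m0"
        using b(3) b0(3)
        by (metis div_mult_self4 add.commute div_less add_cancel_right_left not_less0 gr_implies_not0 mult.commute,
            metis mod_mult_self4 mult.commute mod_less)
      define S where "S = (\<lambda>s. smult (of_nat (m choose s)) (monom 1 (i + \<rho> * q * j + \<rho> * (q - 1 - (m - s)))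
         * U ^ (m - s) * red_coeff q F (l + s) l0))"
      have "{..m} = insert 0 {1..m}" by auto
      then have "stepanov_monomial q \<rho> U F t l0 = S 0 + (\<Sum>s\<in>{1..m}. S s)"
        unfolding stepanov_monomial_def t prod.case S_def by simp
      moreover have "smult (c t) (S 0) = main t"
      proof -
        have aux: "smult z (monom 1 n * P) = monom z n * P" for z :: 'a and n P
          by (simp add: smult_monom flip: mult_smult_left)
        show ?thesis using b False jm unfolding main_def t S_def K_def
          by (auto simp: red_coeff_def mult_monom aux add.assoc simp flip: mult.assoc)
      qed
      ultimately have "smult (c t) (stepanov_monomial q \<rho> U F t l0) - main t = (\<Sum>s\<in>{1..m}. smult (c t) (S s))"
        by (simp add: smult_add_right smult_sum_right)
      also have "degree \<dots> \<le> D - 1"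
      proof (rule degree_sum_le)
        fix s assume s: "s \<in> {1..m}"
        have "degree (smult (c t) (S s)) \<le> degree (S s)" by (rule degree_smult_le)
        also have "\<dots> \<le> i + \<rho> * (q - 1) + \<rho> * (q * j + m - s) + 2"
          unfolding S_def using s by (intro degree_stepanov_monomial_summand_le deg b) auto
        also have "\<dots> \<le> D - 1"
        proof -
          have "\<rho> * (q * j + m - s + 1) \<le> \<rho> * (q * j0 + m0)"
            using s jm by (intro mult_le_mono2) auto
          then show ?thesis using b(1) I by (simp add: D_def add_mult_distrib2)
        qed
        finally show "degree (smult (c t) (S s)) \<le> D - 1" .
      qed simp
      finally show ?thesis by (simp add: D_def)
    qed
  qed
  \<comment> \<open>The factor \<open>h\<close> collects the powers \<open>x ^ i\<close> belonging
    to \<open>(l0, j0, m0)\<close>; its coefficient at \<open>i0\<close> is a nonzero value of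
    \<open>c\<close>, so the leading terms do not cancel.\<close>
  have "(\<Sum>t\<in>B. main t) \<noteq> 0 \<and> degree (\<Sum>t\<in>B. main t) \<ge> D"
  proof -
    define h where "h = (\<Sum>t\<in>B. case t of (i, l, j, m) \<Rightarrow> if l = l0 \<and> j = j0 \<and> m = m0 \<and> c (i, l, j, m) \<noteq> 0 then monom (c (i, l, j, m)) i else 0)"
    have "(\<Sum>t\<in>B. main t) = h * K"
      unfolding h_def sum_distrib_right main_def by (intro sum.cong) auto
    moreover have hc: "coeff h i0 = c (i0, l0, j0, m0)"
    proof -
      have "coeff h i0 = (\<Sum>t\<in>B. if t = (i0, l0, j0, m0) then c t else 0)"
        unfolding h_def coeff_sum by (intro sum.cong) (auto split: if_splits)
      then show ?thesis using fin t0(1) by (simp add: N_def)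
    qed
    moreover have "h \<noteq> 0" using hc t0(1) by (auto simp: N_def)
    ultimately show ?thesis using K by (simp add: degree_mult_eq)
  qed
  moreover have "degree (\<Sum>t\<in>B. smult (c t) (stepanov_monomial q \<rho> U F t l0) - main t) < D"
    by (rule degree_sum_less) (use rest in \<open>auto simp: D_def\<close>)
  ultimately have "(\<Sum>t\<in>B. smult (c t) (stepanov_monomial q \<rho> U F t l0)) \<noteq> 0"
    by (auto simp: sum_subtractf)
  then show ?thesis using b0 by blast
qed

text \<open>
  The coefficients \<open>c\<close> are chosen such that \<open>\<Sum>c\<^sup>R (x\<^sup>i y\<^sup>l)\<^sup>R x\<^sup>j y\<^sup>m\<close> vanishes identically. At a point of the
  field with \<open>R\<^sup>2\<close> elements this is the \<open>R\<close>-th power of \<open>\<Sum>c x\<^sup>i y\<^sup>l (x\<^sup>j y\<^sup>m)\<^sup>R\<close>, which is not identically zero.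
  Since all \<open>q\<close> values of \<open>y\<close> above \<open>x\<close> are available, its coefficients as a polynomial in \<open>y\<close> vanish at \<open>x\<close>.
\<close>
lemma stepanov_two_poles_bound:
  fixes F U :: "'a::alg_closed_field poly" and V :: "'a set"
  assumes q: "q \<ge> 3" and \<rho>: "\<rho> \<ge> q" and R: "R = \<rho> * q"
    and frob: "\<And>x y::'a. (x + y) ^ R = x ^ R + y ^ R"
    and deg: "degree F \<le> 2" "degree U = 2 * \<rho>"
    and V: "\<And>x. x \<in> V \<Longrightarrow> x \<noteq> 0 \<and> x ^ (R * R) = x"
    and Y: "\<And>x. x \<in> V \<Longrightarrow> card {y. x * y ^ q = x * y + poly F x
             \<and> x ^ \<rho> * y ^ R = x ^ \<rho> * y + poly U x \<and> y ^ (R * R) = y} \<ge> q"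
  shows "finite V \<and> card V \<le> R * \<rho> + 3 * R"
proof -
  \<comment> \<open>\<open>I\<close> is the largest value below \<open>\<rho>\<close>.
    \<open>D\<close> exceeds the degree of every monomial after \<open>sw\<close> has exchanged the
    roles of \<open>(i, l)\<close> and \<open>(j, m)\<close>, so \<open>E\<close> lists the
    coefficients that must vanish. With \<open>J = \<rho> + 2\<close> the unknowns outnumber them,
    and \<open>R * J\<close> yields the leading term \<open>R * \<rho>\<close> of the final
    bound.\<close>
  define I where "I = \<rho> - 1"
  define J where "J = \<rho> + 2"
  define B where "B = {..<I} \<times> {..<q} \<times> {..<J} \<times> {..<q}"
  define sw where "sw = (\<lambda>(i, l, j, m). (j, m, i, l) :: nat \<times> nat \<times> nat \<times> nat)"
  define D where "D = J + R * (I - 1) + 2 * \<rho> * (q - 1) + 2"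
  define E where "E = {..<q} \<times> {..<D}"
  have fin: "finite B" "finite E" by (auto simp: B_def E_def)
  have "\<rho> * 3 \<le> \<rho> * q" using q by simp
  then have R3: "R \<ge> 3 * \<rho>" by (simp add: R)
  have U0: "U \<noteq> 0" using deg(2) \<rho> q by auto
  have R0: "R > 0" using R3 \<rho> q by linarith

  have "card E < card B"
  proof -
    have e: "2 * \<rho> * (q - 1) = 2 * R - 2 * \<rho>" by (simp add: R algebra_simps diff_mult_distrib2)
    have "2 \<le> \<rho>" using \<rho> q by linarith
    then obtain \<rho>' where \<rho>': "\<rho> = \<rho>' + 2" by (metis add.commute le_Suc_ex)
    have e2: "R * (I - 1) + 2 * R = R * \<rho>"
      by (simp add: I_def \<rho>' algebra_simps)
    have "D = \<rho> + 4 + (R * (I - 1) + 2 * R) - 2 * \<rho>"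
      unfolding D_def J_def e using R3 by linarith
    moreover have "R * \<rho> \<ge> \<rho>" using R0 by simp
    ultimately have D: "D + \<rho> = 4 + R * \<rho>" unfolding e2 by linarith
    have "q \<le> R" using \<rho> q by (simp add: R)
    then obtain R' where R': "R = R' + q" by (metis add.commute le_Suc_ex)
    have "q * I = R'" using R R' by (simp add: I_def diff_mult_distrib2 mult.commute)
    then have "q * I * J + 2 * q = R * \<rho> + R"
    proof -
      have "R * \<rho> = R' * \<rho> + q * \<rho>" by (simp add: R' add_mult_distrib)
      then have "R * \<rho> = R' * \<rho> + R" by (simp add: R mult.commute)
      with \<open>q * I = R'\<close> show ?thesis by (simp add: J_def R' add_mult_distrib2)
    qed
    moreover have "R + \<rho> > 2 * q + 4" using R3 \<rho> q by linarith
    ultimately have "D < q * I * J" using D by linarith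
    then have "q * D < q * (q * I * J)" using q by simp
    then show ?thesis by (simp add: E_def B_def algebra_simps)
  qed
  then obtain d where d: "\<exists>t\<in>B. d t \<noteq> 0"
     "\<And>r k. r < q \<Longrightarrow> k < D \<Longrightarrow> (\<Sum>t\<in>B. coeff (stepanov_monomial q \<rho> U F (sw t) r) k * d t) = 0"
    using homogeneous_system_nontrivial[OF fin(2,1), of "\<lambda>(r, k) t. coeff (stepanov_monomial q \<rho> U F (sw t) r) k"]
    by (auto simp: E_def)
  have e0: "(\<Sum>t\<in>B. smult (d t) (stepanov_monomial q \<rho> U F (sw t) r)) = 0" if r: "r < q" for r
  proof (rule poly_eqI)
    fix k
    show "coeff (\<Sum>t\<in>B. smult (d t) (stepanov_monomial q \<rho> U F (sw t) r)) k = coeff 0 k"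
    proof (cases "k < D")
      case True
      then show ?thesis using d(2)[OF r] by (simp add: coeff_sum mult.commute)
    next
      case False
      have "coeff (stepanov_monomial q \<rho> U F (sw t) r) k = 0" if "t \<in> B" for t
      proof -
        obtain i l j m where t: "t = (i, l, j, m)" by (cases t)
        have b: "i < I" "l < q" "j < J" "m < q" using that t by (auto simp: B_def)
        have "degree (stepanov_monomial q \<rho> U F (sw t) r) \<le> j + \<rho> * (q - 1) + \<rho> * (q * i + l) + 2"
          unfolding t sw_def prod.case by (intro degree_stepanov_monomial_le deg b)
        also have "\<dots> < D"
        proof -
          have "\<rho> * l \<le> \<rho> * (q - 1)" using b by (intro mult_le_mono2) simp
          moreover have "R * i \<le> R * (I - 1)" using b by (intro mult_le_mono2) simp
          ultimately show ?thesis using b(3) by (simp add: D_def R algebra_simps)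
        qed
        finally show ?thesis using False by (intro coeff_eq_0) simp
      qed
      then show ?thesis by (simp add: coeff_sum)
    qed
  qed
  \<comment> \<open>The linear system is solved for the \<open>R\<close>-th powers of the
    coefficients; the coefficients themselves are then extracted as roots in the algebraically
    closed field.\<close>
  have "\<exists>z. z ^ R = d t" for t by (rule nth_root_exists[OF R0])
  then obtain c where c: "\<And>t. c t ^ R = d t" by metis
  have "\<exists>t\<in>B. c t \<noteq> 0" using d(1) c R0 by (metis power_0_left not_gr0)
  then obtain r where r: "r < q" "(\<Sum>t\<in>B. smult (c t) (stepanov_monomial q \<rho> U F t r)) \<noteq> 0"
    using stepanov_monomial_independent[OF deg U0, of I B q J c] fin q \<rho> by (auto simp: B_def I_def)
  define g where "g = (\<lambda>r. \<Sum>t\<in>B. smult (c t) (stepanov_monomial q \<rho> U F t r))"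
  have frob_sum: "(\<Sum>t\<in>T. f t) ^ R = (\<Sum>t\<in>T. f t ^ R)" for f :: "nat \<times> nat \<times> nat \<times> nat \<Rightarrow> 'a" and T
    using R0 by (induction T rule: infinite_finite_induct) (auto simp: frob)
  have root: "poly (g r) x = 0" if x: "x \<in> V" for x
  proof -
    have x0: "x \<noteq> 0" "x ^ (R * R) = x" using V[OF x] by auto
    define P where "P = (\<Sum>r<q. monom (poly (g r) x) r)"
    define Ys where "Ys = {y. x * y ^ q = x * y + poly F x
             \<and> x ^ \<rho> * y ^ R = x ^ \<rho> * y + poly U x \<and> y ^ (R * R) = y}"
    have "poly P y = 0" if y: "y \<in> Ys" for y
    proof -
      define u where "u = poly U x / x ^ \<rho>"
      have y': "x * y ^ q = x * y + poly F x" "y ^ (\<rho> * q) = y + u" "poly U x = x ^ \<rho> * u" "y ^ (R * R) = y"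
        using y x0 by (auto simp: Ys_def u_def R field_simps)
      have ev: "(\<Sum>r<q. poly (stepanov_monomial q \<rho> U F (i, l, j, m) r) x * y ^ r)
          = x ^ (\<rho> * (q - 1) + 1) * (x ^ i * y ^ l * (x ^ j * y ^ m) ^ R)" if "l < q" "m < q" for i l j m
        using poly_stepanov_monomial_sum[OF y'(1-3) that] by (simp add: R)
      define G where "G = (\<Sum>t\<in>B. case t of (i, l, j, m) \<Rightarrow> c t * (x ^ i * y ^ l * (x ^ j * y ^ m) ^ R))"
      have "G ^ R = (\<Sum>t\<in>B. case t of (i, l, j, m) \<Rightarrow> d t * (x ^ j * y ^ m * (x ^ i * y ^ l) ^ R))"
        unfolding G_def frob_sum
      proof (rule sum.cong, goal_cases)
        case (2 t)
        obtain i l j m where t: "t = (i, l, j, m)" by (cases t)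
        have "(x ^ j) ^ (R * R) = x ^ j" "(y ^ m) ^ (R * R) = y ^ m"
          using x0(2) y'(4) by (metis power_mult mult.commute)+
        then show ?case by (simp add: t power_mult_distrib c mult_ac flip: power_mult)
      qed simp
      then have "x ^ (\<rho> * (q - 1) + 1) * G ^ R = (\<Sum>t\<in>B. x ^ (\<rho> * (q - 1) + 1)
          * (case t of (i, l, j, m) \<Rightarrow> d t * (x ^ j * y ^ m * (x ^ i * y ^ l) ^ R)))"
        by (simp only: sum_distrib_left)
      also have "\<dots> = (\<Sum>t\<in>B. d t * (\<Sum>r<q. poly (stepanov_monomial q \<rho> U F (sw t) r) x * y ^ r))"
        by (rule sum.cong) (auto simp: B_def sw_def ev)
      also have "\<dots> = (\<Sum>r<q. poly (\<Sum>t\<in>B. smult (d t) (stepanov_monomial q \<rho> U F (sw t) r)) x * y ^ r)"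
        by (simp add: poly_sum sum_distrib_left sum_distrib_right mult.assoc sum.swap[of _ B])
      also have "\<dots> = 0" by (simp add: e0)
      finally have "G = 0" using x0 R0 by simp
      have "poly P y = (\<Sum>r<q. poly (g r) x * y ^ r)" by (simp add: P_def poly_sum poly_monom)
      also have "\<dots> = (\<Sum>t\<in>B. c t * (\<Sum>r<q. poly (stepanov_monomial q \<rho> U F t r) x * y ^ r))"
        by (simp add: g_def poly_sum sum_distrib_left sum_distrib_right mult.assoc sum.swap[of _ B])
      also have "\<dots> = x ^ (\<rho> * (q - 1) + 1) * G"
      proof -
        have "x ^ (\<rho> * (q - 1) + 1) * G = (\<Sum>t\<in>B. x ^ (\<rho> * (q - 1) + 1)
            * (case t of (i, l, j, m) \<Rightarrow> c t * (x ^ i * y ^ l * (x ^ j * y ^ m) ^ R)))"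
          unfolding G_def by (simp only: sum_distrib_left)
        also have "\<dots> = (\<Sum>t\<in>B. c t * (\<Sum>r<q. poly (stepanov_monomial q \<rho> U F t r) x * y ^ r))"
          by (rule sum.cong) (auto simp: B_def ev)
        finally show ?thesis ..
      qed
      finally show ?thesis using \<open>G = 0\<close> by simp
    qed
    then have "Ys \<subseteq> {y. poly P y = 0}" by auto
    moreover have "degree P < q" unfolding P_def
      by (rule degree_sum_less) (use q in \<open>auto intro: le_less_trans[OF degree_monom_le]\<close>)
    moreover have "card Ys \<ge> q" using Y[OF x] by (simp add: Ys_def)
    ultimately have "P = 0"
      using card_poly_roots_bound[of P] card_mono[OF poly_roots_finite[of P], of Ys] by fastforce
    moreover have "coeff P r = poly (g r) x"
      using r by (simp add: P_def coeff_sum)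
    ultimately show ?thesis by simp
  qed
  have gr: "g r \<noteq> 0" using r by (simp add: g_def)
  have sub: "V \<subseteq> {x. poly (g r) x = 0}" using root by auto
  then have "finite V" "card V \<le> degree (g r)"
    using poly_roots_finite[OF gr] card_poly_roots_bound[OF gr] card_mono[of "{x. poly (g r) x = 0}" V]
    by (auto dest: finite_subset)
  moreover have "degree (g r) \<le> R * \<rho> + 3 * R"
    unfolding g_def
  proof (rule degree_sum_le[OF fin(1)])
    fix t assume "t \<in> B"
    then obtain i l j m where t: "t = (i, l, j, m)" and b: "i < I" "l < q" "j < J" "m < q"
      by (auto simp: B_def)
    have "degree (smult (c t) (stepanov_monomial q \<rho> U F t r)) \<le> i + \<rho> * (q - 1) + \<rho> * (q * j + m) + 2"
      unfolding t by (intro order.trans[OF degree_smult_le] degree_stepanov_monomial_le deg b)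
    also have "\<dots> \<le> R * \<rho> + 3 * R"
    proof -
      have "\<rho> * m \<le> \<rho> * (q - 1)" using b by (intro mult_le_mono2) simp
      moreover have "\<rho> * (q - 1) + \<rho> = R" using q by (cases q) (simp_all add: R)
      moreover have "R * j \<le> R * (\<rho> + 1)" using b by (intro mult_le_mono2) (simp add: J_def)
      ultimately show ?thesis using b(1) by (simp add: I_def R algebra_simps)
    qed
    finally show "degree (smult (c t) (stepanov_monomial q \<rho> U F t r)) \<le> R * \<rho> + 3 * R" .
  qed
  ultimately show ?thesis by simp
qed

section \<open>Finite fields inside an algebraically closed field\<close>

lemma degree_monom_minus_linear:
  "N > 1 \<Longrightarrow> degree (monom 1 N - [:c, d:] :: 'a::field poly) = N"
  using degree_add_eq_left[of "- [:c, d:]" "monom 1 N"] by (auto simp: degree_monom_eq simp del: minus_pCons)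

locale frobenius_field =
  fixes q :: nat and ty :: "'a::alg_closed_field itself"
  assumes prime_char: "prime CHAR('a)" and q_char: "\<exists>e. q = CHAR('a) ^ e" and q3: "q \<ge> 3"
begin

lemma q_pos [simp]: "q > 0" "q \<noteq> 0" using q3 by simp_all

lemma frob_add: "(x + y :: 'a) ^ (q ^ n) = x ^ (q ^ n) + y ^ (q ^ n)"
proof -
  obtain e where "q = CHAR('a) ^ e" using q_char by blast
  then show ?thesis by (intro freshmans_dream'[OF prime_char, of _ "e * n"]) (simp add: power_mult)
qed

lemma frob_sum: "(\<Sum>i\<in>A. f i :: 'a) ^ (q ^ n) = (\<Sum>i\<in>A. f i ^ (q ^ n))"
proof -
  obtain e where "q = CHAR('a) ^ e" using q_char by blast
  then show ?thesis by (intro freshmans_dream_sum'[OF prime_char, of _ "e * n"]) (simp add: power_mult)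
qed

lemmas frob_sum1 = frob_sum[of _ _ 1, simplified]

lemma frob_diff: "(x - y :: 'a) ^ (q ^ n) = x ^ (q ^ n) - y ^ (q ^ n)"
  using frob_add[of "x - y" y n] by (simp add: algebra_simps)

lemma frob_minus: "(- y :: 'a) ^ (q ^ n) = - (y ^ (q ^ n))"
  using frob_diff[of 0 y n] by (simp add: power_0_left)

lemma frob_inj: "(x :: 'a) ^ (q ^ n) = y ^ (q ^ n) \<longleftrightarrow> x = y"
proof
  assume "x ^ (q ^ n) = y ^ (q ^ n)"
  then have "(x - y) ^ (q ^ n) = 0" by (simp add: frob_diff)
  then show "x = y" by simp
qed simp

text \<open>The subfield with \<open>q ^ n\<close> elements when \<open>n > 0\<close>; for
  \<open>n = 0\<close> the equation is trivial and \<open>Fix 0\<close> is the whole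
  closure.\<close>

definition Fix :: "nat \<Rightarrow> 'a set" where "Fix n = {x. x ^ (q ^ n) = x}"

lemma Fix_add: "x \<in> Fix n \<Longrightarrow> y \<in> Fix n \<Longrightarrow> x + y \<in> Fix n"
  and Fix_diff: "x \<in> Fix n \<Longrightarrow> y \<in> Fix n \<Longrightarrow> x - y \<in> Fix n"
  and Fix_minus: "x \<in> Fix n \<Longrightarrow> - x \<in> Fix n"
  and Fix_mult: "x \<in> Fix n \<Longrightarrow> y \<in> Fix n \<Longrightarrow> x * y \<in> Fix n"
  and Fix_divide: "x \<in> Fix n \<Longrightarrow> y \<in> Fix n \<Longrightarrow> x / y \<in> Fix n"
  and Fix_0 [simp]: "0 \<in> Fix n" and Fix_1 [simp]: "1 \<in> Fix n"
  by (simp_all add: Fix_def frob_add frob_diff frob_minus power_mult_distrib power_divide power_0_left)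

lemma Fix_one_pow: "x \<in> Fix 1 \<Longrightarrow> x ^ (q ^ i) = x"
  by (induction i) (auto simp: Fix_def power_mult)

lemma Fix_one_subset: "Fix 1 \<subseteq> Fix n"
  using Fix_one_pow by (auto simp: Fix_def)

text \<open>\<open>X ^ (q ^ n) - X\<close> has derivative \<open>- 1\<close>, because the
  characteristic divides \<open>q ^ n\<close>; hence its roots in the closed field are simple and as
  many as its degree.\<close>

lemma card_Fix:
  assumes "n > 0"
  shows "finite (Fix n)" "card (Fix n) = q ^ n"
proof -
  define p :: "'a poly" where "p = monom 1 (q ^ n) - [:0, 1:]"
  have qn: "q ^ n > 1" using q3 assms by (intro one_less_power) auto
  have deg: "degree p = q ^ n"
    unfolding p_def by (rule degree_monom_minus_linear[OF qn])
  then have p0: "p \<noteq> 0" using qn by (metis degree_0 not_less_zero)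
  have lc: "lead_coeff p = 1" unfolding deg using qn by (simp add: p_def coeff_eq_0)
  have Fix: "Fix n = {x. poly p x = 0}" by (auto simp: Fix_def p_def poly_monom)
  show "finite (Fix n)" unfolding Fix using p0 by (simp add: poly_roots_finite)
  obtain A where A: "size A = degree p" "p = smult (lead_coeff p) (\<Prod>x\<in>#A. [:-x, 1:])"
    using alg_closed_imp_factorization[OF p0] by blast
  have pA: "p = (\<Prod>x\<in>#A. [:-x, 1:])" using A(2) lc by simp
  obtain e where e: "q = CHAR('a) ^ e" using q_char by blast
  have "e > 0" using e q3 by (cases e) auto
  have "CHAR('a) dvd CHAR('a) ^ (e * n)" using \<open>e > 0\<close> assms by (intro dvd_power) simp
  then have "CHAR('a) dvd q ^ n" by (simp add: e power_mult)
  then have of0: "of_nat (q ^ n) = (0::'a)" using of_nat_eq_0_iff_char_dvd by blast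
  have pd: "pderiv p = -1"
    using of0 by (simp add: p_def pderiv_diff pderiv_monom pderiv_pCons one_pCons del: of_nat_power)
  have count: "count A x \<le> 1" for x
  proof (rule ccontr)
    assume "\<not> count A x \<le> 1"
    then have "{#x, x#} \<subseteq># A" by (auto simp: subseteq_mset_def)
    then obtain B where "A = {#x, x#} + B" by (metis mset_subset_eq_exists_conv)
    then have "p = [:-x, 1:] * ([:-x, 1:] * (\<Prod>x\<in>#B. [:-x, 1:]))" by (simp add: pA)
    then have "poly (pderiv p) x = 0" by (simp only: pderiv_mult poly_add poly_mult) simp
    then show False by (simp add: pd)
  qed
  have "set_mset A = Fix n"
    unfolding Fix pA by (auto simp: poly_prod_mset prod_mset_zero_iff)
  moreover have "card (set_mset A) = size A"
  proof -
    have "size A = (\<Sum>x\<in>set_mset A. count A x)" by (simp add: size_multiset_overloaded_eq)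
    also have "\<dots> = (\<Sum>x\<in>set_mset A. 1)"
      by (intro sum.cong) (auto intro!: antisym[OF count[unfolded One_nat_def]] simp: Suc_le_eq)
    finally show ?thesis by simp
  qed
  ultimately show "card (Fix n) = q ^ n" using A(1) deg by simp
qed

section \<open>Traces and Artin-Schreier equations\<close>

definition tr :: "nat \<Rightarrow> 'a \<Rightarrow> 'a" where "tr n x = (\<Sum>i<n. x ^ (q ^ i))"

lemma tr_Fix: "x \<in> Fix n \<Longrightarrow> tr n x \<in> Fix 1"
proof -
  assume "x \<in> Fix n"
  then have x: "x ^ (q ^ n) = x" by (simp add: Fix_def)
  have "(tr n x) ^ (q ^ 1) = (\<Sum>i<n. x ^ (q ^ Suc i))"
    unfolding tr_def frob_sum by (simp add: mult.commute flip: power_mult)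
  moreover have "x + \<dots> = tr n x + x"
    using sum.lessThan_Suc_shift[of "\<lambda>i. x ^ (q ^ i)" n] x by (simp add: tr_def)
  ultimately show "tr n x \<in> Fix 1" by (simp add: Fix_def)
qed

lemma tr_add: "tr n (x + y) = tr n x + tr n y"
  and tr_diff: "tr n (x - y) = tr n x - tr n y"
  by (simp_all add: tr_def frob_add frob_diff sum.distrib sum_subtractf)

text \<open>A telescoping sum. For a solution of \<open>y ^ q - y = w\<close> the case
  \<open>2 * k\<close> decides whether \<open>y\<close> lies in \<open>Fix (2 * k)\<close>, and the
  case \<open>k\<close> supplies the relation for \<open>y ^ R\<close> needed by Stepanov's
  method.\<close>

lemma tr_artin_schreier: "y ^ (q ^ n) - y = tr n (y ^ q - y)"
proof -
  have "tr n (y ^ q - y) = (\<Sum>i<n. y ^ (q ^ Suc i) - y ^ (q ^ i))"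
    by (simp add: tr_def frob_diff mult.commute flip: power_mult)
  also have "\<dots> = y ^ (q ^ n) - y"
    by (subst sum_lessThan_telescope) simp
  finally show ?thesis ..
qed

text \<open>Only a root of the trace polynomial in the closed field is wanted, so \<open>c\<close>
  is arbitrary and \<open>g\<close> need not lie in \<open>Fix n\<close>.\<close>

lemma tr_surj:
  assumes "n > 0"
  shows "\<exists>g. tr n g = c"
proof -
  define p where "p = (\<Sum>i<n. monom 1 (q ^ i)) - [:c:]"
  have qn: "q ^ (n - 1) > 0" by simp
  have "coeff p (q ^ (n - 1)) = (\<Sum>i<n. if i = n - 1 then 1 else 0)"
    unfolding p_def using q3 qn
    by (auto simp: coeff_sum coeff_pCons split: nat.split intro!: sum.cong)
  then have "coeff p (q ^ (n - 1)) \<noteq> 0" using assms by simp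
  then have "degree p > 0" using le_degree[of p "q ^ (n - 1)"] qn by linarith
  then obtain g where "poly p g = 0" using alg_closed_imp_poly_has_root by blast
  then have "tr n g = c" by (simp add: p_def tr_def poly_sum poly_monom)
  then show ?thesis by blast
qed

text \<open>Over a point \<open>x\<close> of trace \<open>c\<close> the right-hand side of
  \<open>y ^ q - y = a * x + b / x - g\<close> has trace zero, so all \<open>q\<close> solutions lie
  in \<open>Fix (2 * k)\<close>. The fibre is thereby covered by points of an Artin-Schreier curve
  to which \<open>stepanov_two_poles_bound\<close> applies.\<close>

lemma card_trace_fibre_le:
  assumes k: "k \<ge> 2" and a: "a \<in> Fix 1" "a \<noteq> 0" and b: "b \<in> Fix 1"
  shows "card {x \<in> Fix (2 * k) - {0}. tr (2 * k) (a * x + b / x) = c} \<le> q ^ (2 * k - 1) + 3 * q ^ k"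
proof -
  define V where "V = {x \<in> Fix (2 * k) - {0}. tr (2 * k) (a * x + b / x) = c}"
  obtain g where g: "tr (2 * k) g = c" using tr_surj[of "2 * k"] k by auto
  define \<rho> where "\<rho> = q ^ (k - 1)"
  define R where "R = q ^ k"
  have R: "R = \<rho> * q" using k by (simp add: R_def \<rho>_def flip: power_Suc2)
  have "q ^ 1 \<le> \<rho>" unfolding \<rho>_def using k q3 by (intro power_increasing) auto
  then have \<rho>: "\<rho> \<ge> q" by simp
  have RR: "R * R = q ^ (2 * k)" by (simp add: R_def mult_2 power_add)
  have R\<rho>: "R * \<rho> = q ^ (2 * k - 1)"
    using k by (simp add: R_def \<rho>_def mult_2 flip: power_add)
  \<comment> \<open>\<open>F\<close> is \<open>x * w\<close> for
    \<open>w = a * x + b / x - g\<close>, and \<open>U\<close> is \<open>x ^ \<rho>\<close> times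
    \<open>tr k w\<close>; here \<open>\<rho> = q ^ (k - 1)\<close> is the highest power of
    \<open>1 / x\<close> in that trace.\<close>
  define F where "F = [:b, - g, a:]"
  define U where "U = (\<Sum>i<k. monom a (\<rho> + q ^ i) + monom b (\<rho> - q ^ i)) - monom (tr k g) \<rho>"
  have qi: "q ^ i \<le> \<rho>" if "i < k" for i unfolding \<rho>_def using that q3 by (intro power_increasing) auto
  have degU: "degree U = 2 * \<rho>"
  proof (rule antisym)
    show "degree U \<le> 2 * \<rho>" unfolding U_def
    proof (intro degree_diff_le degree_sum_le degree_add_le)
      fix i assume "i \<in> {..<k}"
      then show "degree (monom a (\<rho> + q ^ i)) \<le> 2 * \<rho>" "degree (monom b (\<rho> - q ^ i)) \<le> 2 * \<rho>"
        using qi[of i] by (auto intro!: order.trans[OF degree_monom_le])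
    qed (auto intro!: order.trans[OF degree_monom_le])
    have "coeff U (2 * \<rho>) = (\<Sum>i<k. if i = k - 1 then a else 0)"
    proof -
      have "\<rho> > 0" "\<rho> - q ^ i \<noteq> 2 * \<rho>" for i using \<rho> q3 by auto
      moreover have "q ^ i = \<rho> \<longleftrightarrow> i = k - 1" for i
        unfolding \<rho>_def using q3 by (simp add: power_inject_exp)
      ultimately show ?thesis
        unfolding U_def coeff_diff coeff_sum coeff_add coeff_monom by (auto intro!: sum.cong)
    qed
    then have "coeff U (2 * \<rho>) \<noteq> 0" using a k by simp
    then show "2 * \<rho> \<le> degree U" by (rule le_degree)
  qed
  have polyU: "poly U x = x ^ \<rho> * (tr k (a * x + b / x - g))" if "x \<noteq> 0" for x
  proof -
    have "tr k (a * x + b / x) = (\<Sum>i<k. a * x ^ (q ^ i) + b / x ^ (q ^ i))"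
      unfolding tr_def using a(1) b
      by (auto simp: frob_add power_mult_distrib power_divide Fix_one_pow)
    moreover have "poly U x = (\<Sum>i<k. a * (x ^ \<rho> * x ^ (q ^ i)) + b * (x ^ \<rho> / x ^ (q ^ i))) - tr k g * x ^ \<rho>"
      unfolding U_def using that qi
      by (auto simp: poly_sum poly_monom power_add power_diff intro!: sum.cong)
    ultimately show ?thesis
      by (simp add: tr_diff sum_distrib_left sum_distrib_right algebra_simps)
  qed
  have "card V \<le> R * \<rho> + 3 * R"
  proof (rule conjunct2[OF stepanov_two_poles_bound[OF q3 \<rho> R _ _ degU, of F]])
    show "(x + y) ^ R = x ^ R + y ^ R" for x y :: 'a unfolding R_def by (rule frob_add)
    show "degree F \<le> 2" by (simp add: F_def)
    show "x \<noteq> 0 \<and> x ^ (R * R) = x" if "x \<in> V" for x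
      using that by (auto simp: V_def Fix_def RR)
    show "q \<le> card {y. x * y ^ q = x * y + poly F x \<and> x ^ \<rho> * y ^ R = x ^ \<rho> * y + poly U x \<and> y ^ (R * R) = y}"
      (is "q \<le> card ?Y") if x: "x \<in> V" for x
    proof -
      have x0: "x \<noteq> 0" using x by (simp add: V_def)
      define w where "w = a * x + b / x - g"
      have Fw: "poly F x = x * w" using x0 by (simp add: F_def w_def algebra_simps)
      define p where "p = monom 1 q - [:w, 1:]"
      have "degree p = q" unfolding p_def using q3 by (intro degree_monom_minus_linear) simp
      then obtain y0 where "poly p y0 = 0" using alg_closed_imp_poly_has_root[of p] q3 by auto
      then have y0: "y0 ^ q - y0 = w" by (simp add: p_def poly_monom algebra_simps)
      have "y \<in> ?Y" if "y ^ q - y = w" for y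
      proof -
        have "y ^ (q ^ (2 * k)) - y = tr (2 * k) w" using tr_artin_schreier that by simp
        also have "\<dots> = 0" using x g by (simp add: V_def w_def tr_diff)
        finally have 1: "y ^ (R * R) = y" by (simp add: RR)
        have "y ^ R - y = tr k w" using tr_artin_schreier[of y k] that by (simp add: R_def)
        then have 2: "x ^ \<rho> * y ^ R = x ^ \<rho> * y + poly U x"
          using polyU[OF x0] by (simp add: w_def algebra_simps)
        have 3: "x * y ^ q = x * y + poly F x" using that by (simp add: Fw algebra_simps)
        from 1 2 3 show ?thesis by blast
      qed
      moreover have "(y0 + t) ^ q - (y0 + t) = w" if "t \<in> Fix 1" for t
        using y0 that frob_add[of y0 t 1] by (simp add: Fix_def algebra_simps)
      ultimately have sub: "(\<lambda>t. y0 + t) ` Fix 1 \<subseteq> ?Y" by blast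
      have "?Y \<subseteq> Fix (2 * k)" by (auto simp: Fix_def RR)
      then have "finite ?Y" using card_Fix(1)[of "2 * k"] k by (auto intro: finite_subset)
      from card_mono[OF this sub] show ?thesis
        using card_Fix[of 1] by (simp add: card_image)
    qed
  qed
  then show ?thesis unfolding V_def[symmetric] R\<rho>[symmetric] R_def[symmetric] .
qed

end

section \<open>Root multiplicities and Frobenius orbits\<close>

lemma prod_linear_power_dvd:
  fixes P :: "'a::field poly"
  assumes "finite S" "P \<noteq> 0" "\<And>s. s \<in> S \<Longrightarrow> [:-s, 1:] ^ k dvd P"
  shows "(\<Prod>s\<in>S. [:-s, 1:] ^ k) dvd P"
  using assms
proof (induction S rule: finite_induct)
  case (insert t S)
  then obtain Q where Q: "P = (\<Prod>s\<in>S. [:-s, 1:] ^ k) * Q" by (meson dvdE insertCI)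
  have nz: "(\<Prod>s\<in>S. [:-s, 1:] ^ k) \<noteq> 0" "Q \<noteq> 0" using Q insert.prems by auto
  have "poly (\<Prod>s\<in>S. [:-s, 1:] ^ k) t \<noteq> 0"
    using insert.hyps by (auto simp: poly_prod)
  then have "order t (\<Prod>s\<in>S. [:-s, 1:] ^ k) = 0" by (rule order_0I)
  moreover have "k \<le> order t P" using insert.prems order_divides by (metis insertCI)
  ultimately have "k \<le> order t Q" using Q order_mult insert.prems(1) by (metis add_0)
  then have "[:-t, 1:] ^ k dvd Q" by (simp add: order_divides)
  then show ?case using insert.hyps Q by (simp add: mult.commute mult_dvd_mono)
qed simp

lemma sum_order_alg_closed:
  fixes P :: "'a::alg_closed_field poly"
  assumes "P \<noteq> 0"
  shows "(\<Sum>x | poly P x = 0. order x P) = degree P"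
proof -
  obtain A where A: "size A = degree P" "P = smult (lead_coeff P) (\<Prod>x\<in>#A. [:-x, 1:])"
    using alg_closed_imp_factorization[OF assms] by blast
  have "proots (\<Prod>x\<in>#A. [:-x, 1:]) = A"
  proof (induction A)
    case (add x A)
    have "(\<Prod>x\<in>#A. [:-x, 1:]) \<noteq> 0" by (auto simp: prod_mset_zero_iff)
    then have "proots ([:-x, 1:] * (\<Prod>x\<in>#A. [:-x, 1:])) = {#x#} + proots (\<Prod>x\<in>#A. [:-x, 1:])"
      by (subst proots_mult) auto
    then show ?case using add by simp
  qed simp
  then have "proots P = A" using A(2) assms by (metis leading_coeff_0_iff proots_smult)
  then have "degree P = size (proots P)" using A by simp
  also have "\<dots> = (\<Sum>x | poly P x = 0. order x P)"
    using assms by (simp add: size_multiset_overloaded_eq)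
  finally show ?thesis ..
qed

lemma coeff_0_prod: "coeff (\<Prod>i\<in>A. f i) 0 = (\<Prod>i\<in>A. coeff (f i :: 'a::comm_ring_1 poly) 0)"
  by (simp add: poly_prod flip: poly_0_coeff_0)

text \<open>For a monic \<open>P\<close> this is \<open>- (\<Sum>t. 1 / t)\<close> over the roots \<open>t\<close>, and for \<open>reflect_poly P\<close> it is \<open>- (\<Sum>t. t)\<close>.\<close>
definition log_deriv0 :: "'a::field poly \<Rightarrow> 'a" where
  "log_deriv0 P = coeff P 1 / coeff P 0"

lemma log_deriv0_mult:
  "coeff P 0 \<noteq> 0 \<Longrightarrow> coeff Q 0 \<noteq> 0 \<Longrightarrow> log_deriv0 (P * Q) = log_deriv0 P + log_deriv0 Q"
  by (simp add: log_deriv0_def coeff_mult field_simps)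

lemma log_deriv0_prod:
  "(\<And>i. i \<in> A \<Longrightarrow> coeff (f i) 0 \<noteq> 0) \<Longrightarrow> log_deriv0 (\<Prod>i\<in>A. f i) = (\<Sum>i\<in>A. log_deriv0 (f i))"
proof (induction A rule: infinite_finite_induct)
  case (insert x F)
  have "coeff (prod f F) 0 \<noteq> 0" using insert by (simp add: coeff_0_prod)
  then show ?case using insert by (simp add: log_deriv0_mult)
qed (simp_all add: log_deriv0_def)

lemma prod_lessThan_add:
  fixes g :: "nat \<Rightarrow> 'a::comm_monoid_mult"
  shows "(\<Prod>s<m + n. g s) = (\<Prod>s<m. g s) * (\<Prod>s<n. g (s + m))"
  by (induction n) (auto simp: ac_simps)

context frobenius_field
begin

definition frob_poly :: "'a poly \<Rightarrow> 'a poly" where "frob_poly P = map_poly (\<lambda>x. x ^ q) P"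

lemma coeff_frob_poly: "coeff (frob_poly P) i = coeff P i ^ q"
  by (simp add: frob_poly_def coeff_map_poly power_0_left)

lemma frob_poly_mult: "frob_poly (P * Q) = frob_poly P * frob_poly Q"
  by (rule poly_eqI) (simp add: coeff_frob_poly coeff_mult power_mult_distrib frob_sum1)

lemma frob_poly_1 [simp]: "frob_poly 1 = 1"
  by (rule poly_eqI) (simp add: coeff_frob_poly power_0_left)

lemma frob_poly_power: "frob_poly (P ^ n) = frob_poly P ^ n"
  by (induction n) (auto simp: frob_poly_mult)

lemma frob_poly_prod: "frob_poly (\<Prod>i\<in>A. f i) = (\<Prod>i\<in>A. frob_poly (f i))"
  by (induction A rule: infinite_finite_induct) (auto simp: frob_poly_mult)

lemma frob_poly_linear: "frob_poly [:-x, 1:] = [:-(x ^ q), 1:]"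
  using frob_minus[of x 1]
  by (intro poly_eqI) (auto simp: coeff_frob_poly coeff_pCons power_0_left split: nat.split)

text \<open>Invariance under \<open>frob_poly\<close> puts the coefficients into
  \<open>Fix 1\<close>. The nonzero constant coefficient excludes the prime \<open>X\<close>, at
  which \<open>b / x\<close> has its pole.\<close>

definition monics :: "nat \<Rightarrow> 'a poly set" where
  "monics n = {P. degree P = n \<and> lead_coeff P = 1 \<and> frob_poly P = P \<and> coeff P 0 \<noteq> 0}"

lemma monics_nonzero: "P \<in> monics n \<Longrightarrow> P \<noteq> 0" by (auto simp: monics_def)

lemma coeff_monics: "P \<in> monics n \<Longrightarrow> coeff P i \<in> Fix 1"
  by (metis (mono_tags, lifting) Fix_def coeff_frob_poly mem_Collect_eq monics_def power_one_right)

lemma finite_monics: "finite (monics n)"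
proof -
  have "inj_on coeffs (monics n)" by (metis coeffs_eq_iff inj_onI)
  moreover have "coeffs ` monics n \<subseteq> {xs. set xs \<subseteq> Fix 1 \<and> length xs = n + 1}"
  proof safe
    fix P x assume P: "P \<in> monics n"
    then show "length (coeffs P) = n + 1"
      using monics_nonzero by (auto simp: length_coeffs_degree monics_def)
    assume "x \<in> set (coeffs P)"
    then show "x \<in> Fix 1" using coeff_monics[OF P] by (auto simp: coeffs_def split: if_splits)
  qed
  moreover have "finite {xs. set xs \<subseteq> Fix 1 \<and> length xs = n + 1}"
    by (intro finite_lists_length_eq card_Fix) simp
  ultimately show ?thesis by (meson finite_imageD finite_subset)
qed

lemma monics_mult: "P \<in> monics m \<Longrightarrow> Q \<in> monics n \<Longrightarrow> P * Q \<in> monics (m + n)"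
  using monics_nonzero[of P m] monics_nonzero[of Q n]
  by (auto simp: monics_def degree_mult_eq frob_poly_mult coeff_mult_0 coeff_mult_degree_sum)

lemma monics_cofactor:
  assumes "P \<in> monics n" "Q \<in> monics m" "P = Q * T"
  shows "m \<le> n \<and> T \<in> monics (n - m)"
proof -
  have nz: "Q \<noteq> 0" "T \<noteq> 0" using assms monics_nonzero[OF assms(1)] monics_nonzero[OF assms(2)] by auto
  have "frob_poly Q * frob_poly T = Q * T" using assms by (metis (mono_tags, lifting) frob_poly_mult mem_Collect_eq monics_def)
  then have "frob_poly T = T" using assms(2) nz by (simp add: monics_def)
  moreover have "degree P = degree Q + degree T" using assms(3) nz by (simp add: degree_mult_eq)
  moreover have "lead_coeff P = lead_coeff Q * lead_coeff T" using assms(3) lead_coeff_mult by blast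
  moreover have "coeff P 0 = coeff Q 0 * coeff T 0" using assms(3) by (simp add: coeff_mult_0)
  ultimately show ?thesis using assms by (auto simp: monics_def)
qed

text \<open>For \<open>x\<close> in \<open>Fix i\<close> with \<open>i > 0\<close> this is the
  characteristic polynomial of \<open>x\<close> over \<open>Fix 1\<close>: the minimal polynomial
  raised to \<open>i\<close> divided by the degree of \<open>x\<close>.\<close>

definition orbit_poly :: "nat \<Rightarrow> 'a \<Rightarrow> 'a poly" where
  "orbit_poly i x = (\<Prod>s<i. [:- (x ^ (q ^ s)), 1:])"

lemma orbit_poly_monics:
  assumes "x \<in> Fix i" "x \<noteq> 0"
  shows "orbit_poly i x \<in> monics i"
proof -
  have x: "x ^ (q ^ i) = x" using assms by (simp add: Fix_def)
  have "frob_poly (orbit_poly i x) = (\<Prod>s<i. [:- (x ^ (q ^ Suc s)), 1:])"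
    unfolding orbit_poly_def frob_poly_prod frob_poly_linear by (simp add: mult.commute flip: power_mult)
  then have "[:-x, 1:] * frob_poly (orbit_poly i x) = orbit_poly i x * [:-x, 1:]"
    using prod.lessThan_Suc_shift[of "\<lambda>s. [:- (x ^ (q ^ s)), 1:]" i] x
    by (simp add: orbit_poly_def)
  then have "[:-x, 1:] * frob_poly (orbit_poly i x) = [:-x, 1:] * orbit_poly i x" by (simp only: mult.commute)
  then have "frob_poly (orbit_poly i x) = orbit_poly i x" by (subst (asm) mult_left_cancel) auto
  moreover have "degree (orbit_poly i x) = i"
    unfolding orbit_poly_def by (subst degree_prod_eq_sum_degree) auto
  moreover have "lead_coeff (orbit_poly i x) = 1"
    unfolding orbit_poly_def by (simp add: lead_coeff_prod)
  moreover have "coeff (orbit_poly i x) 0 \<noteq> 0"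
    using assms(2) by (simp add: orbit_poly_def coeff_0_prod)
  ultimately show ?thesis by (simp add: monics_def)
qed

lemma root_pow_root:
  assumes "P \<in> monics n" "[:-x, 1:] ^ k dvd P"
  shows "[:-(x ^ (q ^ s)), 1:] ^ k dvd P"
proof (induction s)
  case (Suc s)
  then obtain T where "P = [:-(x ^ (q ^ s)), 1:] ^ k * T" by (rule dvdE)
  then have "frob_poly P = [:-((x ^ (q ^ s)) ^ q), 1:] ^ k * frob_poly T"
    by (simp add: frob_poly_mult frob_poly_power frob_poly_linear)
  then have "[:-((x ^ (q ^ s)) ^ q), 1:] ^ k dvd frob_poly P" by simp
  then show ?case using assms(1) by (simp add: monics_def mult.commute flip: power_mult)
qed (use assms in simp)

text \<open>Let \<open>d\<close> be the degree of \<open>x\<close>. Only multiples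
  \<open>i = k * d\<close> occur, \<open>orbit_poly (k * d) x\<close> is the \<open>k\<close>-th
  power of the minimal polynomial, and it divides \<open>P\<close> exactly when \<open>k\<close> is
  at most the multiplicity of \<open>x\<close>, since Frobenius carries this multiplicity to all
  conjugates.\<close>

lemma card_orbit_poly_dvd:
  assumes P: "P \<in> monics n" and x: "poly P x = 0"
  shows "card {i. 0 < i \<and> x \<in> Fix i \<and> orbit_poly i x dvd P} = order x P"
proof -
  have P0: "P \<noteq> 0" using P monics_nonzero by blast
  have "poly P (x ^ (q ^ s)) = 0" for s
    using root_pow_root[OF P, of x 1 s] x by (simp add: poly_eq_0_iff_dvd)
  then have "range (\<lambda>s. x ^ (q ^ s)) \<subseteq> {y. poly P y = 0}" by auto
  then have "finite (range (\<lambda>s. x ^ (q ^ s)))" using poly_roots_finite[OF P0] finite_subset by blast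
  then have "\<not> inj (\<lambda>s. x ^ (q ^ s))" using finite_imageD infinite_UNIV_nat by blast
  then obtain s t where st: "s < t" "x ^ (q ^ s) = x ^ (q ^ t)"
    unfolding inj_def by (metis linorder_neqE_nat)
  have "(x ^ (q ^ (t - s))) ^ (q ^ s) = x ^ (q ^ s)"
    using st by (simp flip: power_mult power_add)
  then have "x \<in> Fix (t - s)" by (simp add: Fix_def frob_inj)
  then have ex: "\<exists>d. 0 < d \<and> x \<in> Fix d" using st by (metis zero_less_diff)
  define d where "d = (LEAST d. 0 < d \<and> x \<in> Fix d)"
  have d: "0 < d" "x \<in> Fix d" using LeastI_ex[OF ex] by (auto simp: d_def)
  have least: "d \<le> e" if "0 < e" "x \<in> Fix e" for e unfolding d_def using that by (intro Least_le) auto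
  have xd: "x ^ (q ^ d) = x" using d by (simp add: Fix_def)
  have shift: "x ^ (q ^ (s + d)) = x ^ (q ^ s)" for s
    using xd by (simp add: power_add mult.commute[of "q ^ s"] power_mult)
  have kd: "x ^ (q ^ (s + k * d)) = x ^ (q ^ s)" for s k
  proof (induction k)
    case (Suc k)
    then show ?case using shift[of "s + k * d"] by (simp add: ac_simps)
  qed simp
  have Fix_iff: "x \<in> Fix i \<longleftrightarrow> d dvd i" for i
  proof
    assume "x \<in> Fix i"
    then have "x ^ (q ^ (i mod d + (i div d) * d)) = x" by (simp add: Fix_def)
    then have "x \<in> Fix (i mod d)" unfolding kd by (simp add: Fix_def)
    then have "i mod d = 0" using least[of "i mod d"] d(1) by (metis mod_less_divisor not_le neq0_conv)
    then show "d dvd i" by auto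
  next
    assume "d dvd i"
    then obtain k where "i = k * d" by (metis dvd_div_mult_self)
    then show "x \<in> Fix i" using kd[of 0 k] by (simp add: Fix_def)
  qed
  have inj: "inj_on (\<lambda>s. x ^ (q ^ s)) {..<d}"
  proof (rule linorder_inj_onI)
    fix s t assume st: "s < t" "s \<in> {..<d}" "t \<in> {..<d}"
    show "x ^ (q ^ s) \<noteq> x ^ (q ^ t)"
    proof
      assume "x ^ (q ^ s) = x ^ (q ^ t)"
      then have "(x ^ (q ^ (t - s))) ^ (q ^ s) = x ^ (q ^ s)"
        using st by (simp flip: power_mult power_add)
      then have "x \<in> Fix (t - s)" by (simp add: Fix_def frob_inj)
      then show False using least[of "t - s"] st by auto
    qed
  qed auto
  have pow: "orbit_poly (k * d) x = orbit_poly d x ^ k" for k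
  proof (induction k)
    case (Suc k)
    have "orbit_poly (Suc k * d) x = (\<Prod>s<d. [:- (x ^ (q ^ (s + k * d))), 1:]) * orbit_poly (k * d) x"
      unfolding orbit_poly_def mult_Suc add.commute[of d] prod_lessThan_add by (rule mult.commute)
    then show ?case using Suc unfolding kd by (simp add: orbit_poly_def)
  qed (simp add: orbit_poly_def)
  have dvd_iff: "orbit_poly (k * d) x dvd P \<longleftrightarrow> k \<le> order x P" for k
  proof
    assume "orbit_poly (k * d) x dvd P"
    then have "orbit_poly d x ^ k dvd P" by (simp add: pow)
    moreover have "[:-x, 1:] dvd orbit_poly d x"
      using dvd_prodI[of "{..<d}" 0 "\<lambda>s. [:- (x ^ (q ^ s)), 1:]"] d by (simp add: orbit_poly_def)
    ultimately have "[:-x, 1:] ^ k dvd P" by (meson dvd_power_same dvd_trans)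
    then show "k \<le> order x P" using P0 by (simp add: order_divides)
  next
    assume "k \<le> order x P"
    then have "[:-x, 1:] ^ k dvd P" by (simp add: order_divides)
    then have "(\<Prod>y\<in>(\<lambda>s. x ^ (q ^ s)) ` {..<d}. [:-y, 1:] ^ k) dvd P"
      using root_pow_root[OF P] by (intro prod_linear_power_dvd P0) auto
    also have "(\<Prod>y\<in>(\<lambda>s. x ^ (q ^ s)) ` {..<d}. [:-y, 1:] ^ k) = orbit_poly (k * d) x"
      unfolding pow unfolding orbit_poly_def by (simp add: prod.reindex[OF inj] prod_power_distrib)
    finally show "orbit_poly (k * d) x dvd P" .
  qed
  have "{i. 0 < i \<and> x \<in> Fix i \<and> orbit_poly i x dvd P} = (\<lambda>k. k * d) ` {1..order x P}"
  proof (intro Set.set_eqI iffI)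
    fix i assume i: "i \<in> {i. 0 < i \<and> x \<in> Fix i \<and> orbit_poly i x dvd P}"
    then obtain k where k: "i = k * d" using Fix_iff by (auto elim!: dvdE simp: mult.commute)
    then show "i \<in> (\<lambda>k. k * d) ` {1..order x P}" using i dvd_iff[of k] by auto
  next
    fix i assume "i \<in> (\<lambda>k. k * d) ` {1..order x P}"
    then obtain k where "i = k * d" "k \<in> {1..order x P}" by blast
    then show "i \<in> {i. 0 < i \<and> x \<in> Fix i \<and> orbit_poly i x dvd P}"
      using d(1) dvd_iff[of k] by (simp add: Fix_iff)
  qed
  then show ?thesis using d(1) by (simp add: card_image inj_on_def)
qed

text \<open>Double counting of the pairs \<open>(i, x)\<close>: each root \<open>x\<close> admits as
  many \<open>i\<close> as its multiplicity, and the multiplicities add up to the degree. The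
  identity stands in for the logarithmic derivative of an Euler product.\<close>

lemma card_orbit_poly_dvd_total:
  assumes P: "P \<in> monics n"
  shows "(\<Sum>i\<in>{1..n}. card {x \<in> Fix i - {0}. orbit_poly i x dvd P}) = n"
proof -
  have P0: "P \<noteq> 0" using P monics_nonzero by blast
  define A where "A = (\<lambda>x. {i. 0 < i \<and> x \<in> Fix i \<and> orbit_poly i x dvd P})"
  have root: "poly P x = 0" if "i > 0" "orbit_poly i x dvd P" for x i
  proof -
    have "poly (orbit_poly i x) x = 0" unfolding orbit_poly_def poly_prod
      using that(1) by (intro prod_zero bexI[of _ 0]) auto
    then show ?thesis using that(2) by (auto elim!: dvdE)
  qed
  have x0: "x \<noteq> 0" if "poly P x = 0" for x
    using P that by (auto simp: monics_def poly_0_coeff_0)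
  have le: "i \<le> n" if "x \<in> Fix i" "x \<noteq> 0" "orbit_poly i x dvd P" for i x
    using monics_cofactor[OF P orbit_poly_monics[OF that(1,2)]] that(3) by (auto elim!: dvdE)
  have fin: "finite {x. poly P x = 0}" using P0 by (rule poly_roots_finite)
  have "(\<Sum>i\<in>{1..n}. card {x \<in> Fix i - {0}. orbit_poly i x dvd P})
     = card (SIGMA i:{1..n}. {x \<in> Fix i - {0}. orbit_poly i x dvd P})"
    by (subst card_SigmaI) (auto intro: finite_subset[OF _ card_Fix(1)])
  also have "(SIGMA i:{1..n}. {x \<in> Fix i - {0}. orbit_poly i x dvd P}) = prod.swap ` (SIGMA x:{x. poly P x = 0}. A x)"
  proof -
    have "i \<in> {1..n} \<and> x \<in> Fix i - {0} \<and> orbit_poly i x dvd P \<longleftrightarrow> poly P x = 0 \<and> i \<in> A x" for i x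
      unfolding A_def using root[of i x] x0[of x] le[of x i] by (auto simp: Suc_le_eq)
    then show ?thesis by (intro Set.set_eqI) (force simp: image_iff)
  qed
  also have "card \<dots> = card (SIGMA x:{x. poly P x = 0}. A x)" by (rule card_image) (auto simp: inj_on_def)
  also have "\<dots> = (\<Sum>x | poly P x = 0. card (A x))"
  proof (rule card_SigmaI[OF fin], rule ballI)
    fix x assume "x \<in> {x. poly P x = 0}"
    then have "A x \<subseteq> {..n}" using x0 le by (auto simp: A_def)
    then show "finite (A x)" by (rule finite_subset) simp
  qed
  also have "\<dots> = (\<Sum>x | poly P x = 0. order x P)"
    using card_orbit_poly_dvd[OF P] by (simp add: A_def)
  also have "\<dots> = n" using sum_order_alg_closed[OF P0] P by (simp add: monics_def)
  finally show ?thesis .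
qed

end

section \<open>The L-function of a Kloosterman sum\<close>

text \<open>Newton's identities for \<open>1 + K 1 T + Q T^2 = (1 - u T) (1 - v T)\<close>. Index 2
  is separate because there the identity contains the coefficient \<open>Q\<close> multiplied by its
  index.\<close>

lemma power_sum_recurrence:
  fixes K :: "nat \<Rightarrow> complex" and u v :: complex
  assumes uv: "u + v = - K 1" "u * v = Q"
    and K2: "K 2 + K 1 * K 1 = 2 * Q"
    and rec: "\<And>n. n \<ge> 3 \<Longrightarrow> K n + K (n - 1) * K 1 + K (n - 2) * Q = 0"
  shows "n \<ge> 1 \<Longrightarrow> K n = - (u ^ n + v ^ n)"
proof (induction n rule: less_induct)
  case (less n)
  have K1: "K 1 = - (u + v)" using uv by simp
  consider "n = 1" | "n = 2" | m where "n = Suc (Suc (Suc m))"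
    using less.prems by (metis One_nat_def Suc_1 le_zero_eq not0_implies_Suc nat.distinct(1))
  then show ?case
  proof cases
    case 2
    have "K 2 = 2 * Q - K 1 * K 1" using K2 by (simp add: eq_diff_eq)
    then have "K 2 = 2 * (u * v) - (u + v) * (u + v)" unfolding K1 uv(2)[symmetric] by (simp add: algebra_simps)
    then show ?thesis using 2 by (simp add: power2_eq_square algebra_simps)
  next
    case 3
    have h: "K (Suc (Suc m)) = - (u ^ Suc (Suc m) + v ^ Suc (Suc m))" "K (Suc m) = - (u ^ Suc m + v ^ Suc m)"
      using less.IH 3 by auto
    have "K n = - (K (Suc (Suc m)) * K 1 + K (Suc m) * Q)"
      using rec[of n] 3 by (simp add: algebra_simps eq_neg_iff_add_eq_0)
    also have "\<dots> = - (u ^ n + v ^ n)"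
      unfolding h K1 uv(2)[symmetric] by (simp add: 3 algebra_simps)
    finally show ?thesis .
  qed (use K1 in simp)
qed

text \<open>As \<open>u * v\<close> equals \<open>s\<close>, a \<open>u\<close> of norm above
  \<open>sqrt s\<close> forces \<open>v\<close> below it; then \<open>u ^ (2 * k)\<close> alone
  outgrows \<open>C * s ^ k\<close>. Any constant \<open>C\<close> will do because \<open>k\<close>
  is unbounded.\<close>

lemma power_sum_bound_imp:
  fixes u v :: complex and s C :: real
  assumes s: "s > 0" and uv: "u * v = of_real s"
    and bd: "\<And>k. k \<ge> 2 \<Longrightarrow> norm (u ^ (2 * k) + v ^ (2 * k)) \<le> C * s ^ k"
  shows "norm (u + v) \<le> 2 * sqrt s"
proof -
  have *: "norm u \<le> sqrt s"
    if uv: "u * v = of_real s" and bd: "\<And>k. k \<ge> 2 \<Longrightarrow> norm (u ^ (2 * k) + v ^ (2 * k)) \<le> C * s ^ k" for u v :: complex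
  proof (rule ccontr)
    assume "\<not> norm u \<le> sqrt s"
    then have u: "norm u > sqrt s" by simp
    then have u2: "(norm u)\<^sup>2 > s" using s by (metis real_sqrt_lt_0_iff real_sqrt_less_iff real_sqrt_abs abs_of_nonneg norm_ge_zero)
    have nuv: "norm u * norm v = s" using uv s by (metis norm_mult norm_of_real abs_of_pos)
    have "norm v \<le> sqrt s"
    proof (rule ccontr)
      assume "\<not> norm v \<le> sqrt s"
      then have "sqrt s * sqrt s < norm u * norm v" using u s by (intro mult_strict_mono) auto
      then show False using nuv s by simp
    qed
    then have "(norm v)\<^sup>2 \<le> s" using s by (metis norm_ge_zero power_mono real_sqrt_pow2 less_imp_le)
    have "((norm u)\<^sup>2 / s) ^ k \<le> C + 1" if k: "k \<ge> 2" for k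
    proof -
      have "(norm u)\<^sup>2 ^ k = norm (u ^ (2 * k))" by (simp add: norm_power power_mult)
      also have "\<dots> \<le> norm (u ^ (2 * k) + v ^ (2 * k)) + norm (v ^ (2 * k))"
        using norm_triangle_ineq4[of "u ^ (2 * k) + v ^ (2 * k)" "v ^ (2 * k)"] by simp
      also have "norm (v ^ (2 * k)) = (norm v)\<^sup>2 ^ k" by (simp add: norm_power power_mult)
      also have "\<dots> \<le> s ^ k" using \<open>(norm v)\<^sup>2 \<le> s\<close> by (intro power_mono) auto
      finally have "(norm u)\<^sup>2 ^ k \<le> (C + 1) * s ^ k" using bd[OF k] by (simp add: algebra_simps)
      then show ?thesis using s by (simp add: power_divide divide_le_eq)
    qed
    moreover obtain n where n: "C + 1 < ((norm u)\<^sup>2 / s) ^ n"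
      using real_arch_pow[of "(norm u)\<^sup>2 / s" "C + 1"] u2 s by (auto simp: field_simps)
    moreover have "((norm u)\<^sup>2 / s) ^ n \<le> ((norm u)\<^sup>2 / s) ^ (n + 2)"
      using u2 s by (intro power_increasing) auto
    ultimately show False using le_add2[of 2 n] by (meson not_le order.trans)
  qed
  have "norm u \<le> sqrt s" by (rule *[OF uv bd])
  moreover have "norm v \<le> sqrt s" using *[of v u] uv bd by (simp add: mult.commute add.commute)
  ultimately show ?thesis using norm_triangle_ineq[of u v] by simp
qed

locale kloosterman_closure = frobenius_field q ty for q and ty :: "'a::alg_closed_field itself" +
  fixes \<psi> :: "'a \<Rightarrow> complex" and a b :: 'a
  assumes psi_add: "x \<in> Fix 1 \<Longrightarrow> y \<in> Fix 1 \<Longrightarrow> \<psi> (x + y) = \<psi> x * \<psi> y"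
    and psi_norm: "x \<in> Fix 1 \<Longrightarrow> norm (\<psi> x) = 1"
    and psi_nontriv: "\<exists>x\<in>Fix 1. \<psi> x \<noteq> 1"
    and a: "a \<in> Fix 1" "a \<noteq> 0" and b: "b \<in> Fix 1" "b \<noteq> 0"
begin

lemma psi_0: "\<psi> 0 = 1"
  using psi_add[of 0 0] psi_norm[of 0] by auto

lemma psi_sum_zero: "(\<Sum>x\<in>Fix 1. \<psi> x) = 0"
proof -
  obtain t where t: "t \<in> Fix 1" "\<psi> t \<noteq> 1" using psi_nontriv by blast
  have "(\<Sum>x\<in>Fix 1. \<psi> x) = (\<Sum>x\<in>Fix 1. \<psi> (t + x))"
    by (rule sum.reindex_bij_witness[of _ "\<lambda>x. t + x" "\<lambda>x. x - t"]) (use t in \<open>auto intro: Fix_add Fix_diff\<close>)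
  also have "\<dots> = \<psi> t * (\<Sum>x\<in>Fix 1. \<psi> x)" using t by (simp add: psi_add sum_distrib_left)
  finally show ?thesis using t by simp
qed

lemma psi_lin_sum:
  assumes "c \<in> Fix 1"
  shows "(\<Sum>x\<in>Fix 1. \<psi> (c * x)) = (if c = 0 then of_nat q else 0)"
proof (cases "c = 0")
  case False
  have "(\<Sum>x\<in>Fix 1. \<psi> (c * x)) = (\<Sum>x\<in>Fix 1. \<psi> x)"
    by (rule sum.reindex_bij_witness[of _ "\<lambda>x. x / c" "\<lambda>x. c * x"])
      (use assms False in \<open>auto intro: Fix_mult Fix_divide\<close>)
  then show ?thesis using False psi_sum_zero by simp
qed (use card_Fix[of 1] in \<open>simp add: psi_0\<close>)

definition kl :: "nat \<Rightarrow> complex" where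
  "kl n = (\<Sum>x\<in>Fix n - {0}. \<psi> (tr n (a * x + b / x)))"

text \<open>For monic \<open>P\<close> the argument is \<open>a\<close> times the sum of the roots
  plus \<open>b\<close> times the sum of their inverses, so the weight is multiplicative in
  \<open>P\<close>; \<open>lsum n\<close> is the coefficient of \<open>T^n\<close> in the
  L-function.\<close>

definition l_weight :: "'a poly \<Rightarrow> complex" where
  "l_weight P = \<psi> (- a * log_deriv0 (reflect_poly P) - b * log_deriv0 P)"

definition lsum :: "nat \<Rightarrow> complex" where "lsum n = (\<Sum>P\<in>monics n. l_weight P)"

lemma arg_Fix: "x \<in> Fix n \<Longrightarrow> a * x + b / x \<in> Fix n"
  using a b Fix_one_subset by (intro Fix_add Fix_mult Fix_divide) auto

lemma log_deriv0_Fix: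
  assumes "P \<in> monics n"
  shows "log_deriv0 P \<in> Fix 1" "log_deriv0 (reflect_poly P) \<in> Fix 1"
  using coeff_monics[OF assms] unfolding log_deriv0_def
  by (auto intro!: Fix_divide simp: coeff_reflect_poly)

lemma l_weight_mult:
  assumes "P \<in> monics m" "Q \<in> monics n"
  shows "l_weight (P * Q) = l_weight P * l_weight Q"
proof -
  have nz: "coeff P 0 \<noteq> 0" "coeff Q 0 \<noteq> 0" "P \<noteq> 0" "Q \<noteq> 0"
    using assms monics_nonzero by (auto simp: monics_def)
  have *: "- a * log_deriv0 (reflect_poly T) - b * log_deriv0 T \<in> Fix 1" if "T \<in> monics i" for T i
    using log_deriv0_Fix[OF that] a b by (intro Fix_diff Fix_mult Fix_minus) auto
  have "- a * log_deriv0 (reflect_poly (P * Q)) - b * log_deriv0 (P * Q)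
     = (- a * log_deriv0 (reflect_poly P) - b * log_deriv0 P) + (- a * log_deriv0 (reflect_poly Q) - b * log_deriv0 Q)"
    using nz by (simp add: reflect_poly_mult log_deriv0_mult algebra_simps)
  then show ?thesis unfolding l_weight_def using *[OF assms(1)] *[OF assms(2)] by (simp add: psi_add)
qed

lemma l_weight_orbit_poly:
  assumes "x \<in> Fix i" "x \<noteq> 0"
  shows "l_weight (orbit_poly i x) = \<psi> (tr i (a * x + b / x))"
proof -
  have r: "reflect_poly [:- t, 1:] = [:1, - t:]" if "t \<noteq> 0" for t :: 'a
    using that by (simp add: reflect_poly_pCons)
  have "log_deriv0 (orbit_poly i x) = (\<Sum>s<i. - 1 / x ^ (q ^ s))"
    unfolding orbit_poly_def using assms(2)
    by (subst log_deriv0_prod) (auto simp: log_deriv0_def intro!: sum.cong)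
  moreover have "log_deriv0 (reflect_poly (orbit_poly i x)) = (\<Sum>s<i. - (x ^ (q ^ s)))"
    unfolding orbit_poly_def reflect_poly_prod using assms(2)
    by (subst log_deriv0_prod) (auto simp: r log_deriv0_def)
  moreover have "tr i (a * x + b / x) = (\<Sum>s<i. a * x ^ (q ^ s) + b / x ^ (q ^ s))"
    unfolding tr_def using a(1) b(1)
    by (auto simp: frob_add power_mult_distrib power_divide Fix_one_pow)
  ultimately show ?thesis
    unfolding l_weight_def by (simp add: sum_distrib_left sum.distrib sum_negf)
qed

text \<open>The coefficients of \<open>T L'(T) = L(T) S(T)\<close>, where \<open>S\<close> is the
  generating series of \<open>kl\<close>. The factor \<open>n\<close> is rewritten as the number of
  pairs \<open>(i, x)\<close> with \<open>orbit_poly i x\<close> dividing \<open>P\<close>, and this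
  divisor is split off by multiplicativity of the weight.\<close>

lemma lsum_newton: "of_nat n * lsum n = (\<Sum>i\<in>{1..n}. kl i * lsum (n - i))"
proof -
  have fin: "finite (Fix i - {0})" if "i \<in> {1..n}" for i using that card_Fix by auto
  have "of_nat n * lsum n = (\<Sum>P\<in>monics n. l_weight P * of_nat (\<Sum>i\<in>{1..n}. card {x \<in> Fix i - {0}. orbit_poly i x dvd P}))"
    unfolding lsum_def sum_distrib_left by (rule sum.cong) (use card_orbit_poly_dvd_total in auto)
  also have "\<dots> = (\<Sum>P\<in>monics n. \<Sum>i\<in>{1..n}. \<Sum>x\<in>Fix i - {0}. if orbit_poly i x dvd P then l_weight P else 0)"
    unfolding of_nat_sum sum_distrib_left
    using fin by (intro sum.cong refl) (simp add: sum.If_cases Int_def)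
  also have "\<dots> = (\<Sum>i\<in>{1..n}. \<Sum>x\<in>Fix i - {0}. \<Sum>P\<in>monics n. if orbit_poly i x dvd P then l_weight P else 0)"
    by (subst sum.swap) (intro sum.cong refl sum.swap)
  also have "\<dots> = (\<Sum>i\<in>{1..n}. \<Sum>x\<in>Fix i - {0}. \<psi> (tr i (a * x + b / x)) * lsum (n - i))"
  proof (intro sum.cong refl)
    fix i x assume i: "i \<in> {1..n}" and "x \<in> Fix i - {0}"
    then have x: "x \<in> Fix i" "x \<noteq> 0" by auto
    note O = orbit_poly_monics[OF x]
    have "(\<Sum>P\<in>monics n. if orbit_poly i x dvd P then l_weight P else 0) = (\<Sum>P\<in>{P \<in> monics n. orbit_poly i x dvd P}. l_weight P)"
      using finite_monics by (simp add: sum.If_cases Int_def)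
    also have "\<dots> = (\<Sum>Q\<in>monics (n - i). l_weight (orbit_poly i x * Q))"
    proof (rule sum.reindex_bij_witness[of _ "\<lambda>Q. orbit_poly i x * Q" "\<lambda>P. P div orbit_poly i x"])
      fix Q assume "Q \<in> monics (n - i)"
      then show "orbit_poly i x * Q \<in> {P \<in> monics n. orbit_poly i x dvd P}"
        using monics_mult[OF O, of Q "n - i"] i by auto
    qed (use monics_cofactor[OF _ O] monics_nonzero[OF O] in \<open>auto elim!: dvdE\<close>)
    also have "\<dots> = l_weight (orbit_poly i x) * lsum (n - i)"
      by (simp add: lsum_def sum_distrib_left l_weight_mult[OF O])
    finally show "(\<Sum>P\<in>monics n. if orbit_poly i x dvd P then l_weight P else 0) = \<psi> (tr i (a * x + b / x)) * lsum (n - i)"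
      by (simp add: l_weight_orbit_poly[OF x])
  qed
  also have "\<dots> = (\<Sum>i\<in>{1..n}. kl i * lsum (n - i))" by (simp add: kl_def sum_distrib_right)
  finally show ?thesis .
qed

lemma lsum_0: "lsum 0 = 1"
proof -
  have "monics 0 = {1}"
    using frob_poly_1[unfolded one_pCons] by (auto simp: monics_def one_pCons elim!: degree_eq_zeroE)
  then show ?thesis by (simp add: lsum_def l_weight_def log_deriv0_def psi_0)
qed

lemma lsum_1: "lsum 1 = kl 1"
  using lsum_newton[of 1] lsum_0 by simp

text \<open>Adding \<open>t\<close> to the coefficient of \<open>X^(n-1)\<close> permutes the monic
  polynomials and multiplies every weight by \<open>\<psi> c\<close>, which is not 1. For
  \<open>n \<ge> 3\<close> this coefficient differs from those of index 0 and 1, on which the part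
  of the weight with \<open>b\<close> depends.\<close>

lemma lsum_ge_3:
  assumes n: "n \<ge> 3"
  shows "lsum n = 0"
proof -
  obtain c where c: "c \<in> Fix 1" "\<psi> c \<noteq> 1" using psi_nontriv by blast
  define t where "t = - c / a"
  have t: "t \<in> Fix 1" "- a * t = c" using a c by (auto simp: t_def intro: Fix_divide Fix_minus)
  define sh where "sh = (\<lambda>t P. P + monom t (n - 1) :: 'a poly)"
  have sh_in: "sh s P \<in> monics n" if P: "P \<in> monics n" and s: "s \<in> Fix 1" for s P
  proof -
    have dP: "degree P = n" "lead_coeff P = 1" using P by (auto simp: monics_def)
    have "degree (monom s (n - 1)) < degree P"
      using dP n by (intro le_less_trans[OF degree_monom_le]) auto
    then have dsh: "degree (sh s P) = n" using dP by (simp add: sh_def degree_add_eq_left)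
    have "frob_poly (sh s P) = sh s P"
    proof (rule poly_eqI)
      fix i
      have "coeff (sh s P) i \<in> Fix 1"
        unfolding sh_def coeff_add using coeff_monics[OF P] s by (intro Fix_add) auto
      then show "coeff (frob_poly (sh s P)) i = coeff (sh s P) i"
        by (simp add: coeff_frob_poly Fix_def)
    qed
    moreover have "coeff (sh s P) n = 1" using dP n by (simp add: sh_def)
    moreover have "coeff (sh s P) 0 \<noteq> 0" using P n by (simp add: sh_def monics_def)
    ultimately show ?thesis using dsh by (simp add: monics_def)
  qed
  have l_weight_sh: "l_weight (sh t P) = \<psi> c * l_weight P" if P: "P \<in> monics n" for P
  proof -
    have dP: "degree P = n" "coeff P n = 1" using P by (auto simp: monics_def)
    have dS: "degree (sh t P) = n" "coeff (sh t P) n = 1" using sh_in[OF P t(1)] by (auto simp: monics_def)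
    have 1: "log_deriv0 (sh t P) = log_deriv0 P" using n by (simp add: log_deriv0_def sh_def)
    have "coeff (reflect_poly (sh t P)) 1 = coeff (reflect_poly P) 1 + t"
      using n dP dS by (simp add: coeff_reflect_poly sh_def)
    then have 2: "log_deriv0 (reflect_poly (sh t P)) = log_deriv0 (reflect_poly P) + t"
      using dP dS by (simp add: log_deriv0_def)
    have "- a * log_deriv0 (reflect_poly P) - b * log_deriv0 P \<in> Fix 1"
      using log_deriv0_Fix[OF P] a b by (intro Fix_diff Fix_mult Fix_minus) auto
    moreover have "- a * log_deriv0 (reflect_poly (sh t P)) - b * log_deriv0 (sh t P)
       = c + (- a * log_deriv0 (reflect_poly P) - b * log_deriv0 P)"
      unfolding 1 2 using t(2) by (simp add: algebra_simps)
    ultimately show ?thesis unfolding l_weight_def using c(1) by (simp add: psi_add)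
  qed
  have "lsum n = (\<Sum>P\<in>monics n. l_weight (sh t P))"
    unfolding lsum_def
    by (rule sum.reindex_bij_witness[of _ "sh t" "sh (- t)"])
      (use sh_in t in \<open>auto intro: Fix_minus\<close>, auto simp: sh_def add.assoc simp flip: minus_monom)
  also have "\<dots> = \<psi> c * lsum n" by (simp add: lsum_def sum_distrib_left l_weight_sh)
  finally show ?thesis using c by simp
qed

text \<open>Here \<open>c1\<close> enters both parts of the weight, which becomes
  \<open>\<psi> ((- a - b / c0) * c1)\<close>; summing over \<open>c1\<close> leaves only
  \<open>c0 = - b / a\<close>.\<close>

lemma lsum_2: "lsum 2 = of_nat q"
proof -
  have "lsum 2 = (\<Sum>(c0, c1)\<in>(Fix 1 - {0}) \<times> Fix 1. \<psi> ((- a - b / c0) * c1))"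
    unfolding lsum_def
  proof (rule sum.reindex_bij_witness[of _ "\<lambda>(c0, c1). [:c0, c1, 1:]" "\<lambda>P. (coeff P 0, coeff P 1)"])
    fix P assume P: "P \<in> monics 2"
    then have d: "degree P = 2" "coeff P 2 = 1" "coeff P 0 \<noteq> 0" by (auto simp: monics_def)
    show "(case (coeff P 0, coeff P 1) of (c0, c1) \<Rightarrow> [:c0, c1, 1:]) = P"
      using d by (auto intro!: poly_eqI simp: coeff_pCons coeff_eq_0 numeral_2_eq_2 split: nat.split)
    show "(coeff P 0, coeff P 1) \<in> (Fix 1 - {0}) \<times> Fix 1" using d coeff_monics[OF P] by auto
    have "coeff (reflect_poly P) 1 = coeff P 1" using d by (simp add: coeff_reflect_poly)
    then show "(case (coeff P 0, coeff P 1) of (c0, c1) \<Rightarrow> \<psi> ((- a - b / c0) * c1)) = l_weight P"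
      using d by (simp add: l_weight_def log_deriv0_def algebra_simps)
  next
    fix c assume "c \<in> (Fix 1 - {0}) \<times> Fix 1"
    then obtain c0 c1 where c: "c = (c0, c1)" "c0 \<in> Fix 1" "c0 \<noteq> 0" "c1 \<in> Fix 1" by auto
    have "frob_poly [:c0, c1, 1:] = [:c0, c1, 1:]"
      using c by (intro poly_eqI) (auto simp: coeff_frob_poly coeff_pCons Fix_def power_0_left split: nat.split)
    then show "(case c of (c0, c1) \<Rightarrow> [:c0, c1, 1:]) \<in> monics 2" using c by (simp add: monics_def)
    show "(coeff (case c of (c0, c1) \<Rightarrow> [:c0, c1, 1:]) 0, coeff (case c of (c0, c1) \<Rightarrow> [:c0, c1, 1:]) 1) = c"
      using c by simp
  qed
  also have "\<dots> = (\<Sum>c0\<in>Fix 1 - {0}. \<Sum>c1\<in>Fix 1. \<psi> ((- a - b / c0) * c1))"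
    by (simp add: sum.cartesian_product)
  also have "\<dots> = (\<Sum>c0\<in>Fix 1 - {0}. if c0 = - b / a then of_nat q else 0)"
  proof (rule sum.cong, goal_cases)
    case (2 c0)
    then have "- a - b / c0 \<in> Fix 1" using a b by (intro Fix_diff Fix_minus Fix_divide) auto
    moreover have "- a - b / c0 = 0 \<longleftrightarrow> c0 = - b / a" using a 2 by (auto simp: field_simps)
    ultimately show ?case using psi_lin_sum by simp
  qed simp
  also have "\<dots> = of_nat q"
    using a b card_Fix[of 1] by (subst sum.delta) (auto intro: Fix_divide Fix_minus)
  finally show ?thesis .
qed

lemma kl_2: "kl 2 + kl 1 * kl 1 = 2 * of_nat q"
proof -
  have "{1..2} = {1, 2::nat}" by auto
  then show ?thesis using lsum_newton[of 2] lsum_0 lsum_1 lsum_2 by (simp add: algebra_simps)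
qed

lemma kl_rec:
  assumes "n \<ge> 3"
  shows "kl n + kl (n - 1) * kl 1 + kl (n - 2) * of_nat q = 0"
proof -
  have "0 = (\<Sum>i\<in>{1..n}. kl i * lsum (n - i))" using lsum_newton[of n] lsum_ge_3[OF assms] by simp
  also have "\<dots> = (\<Sum>i\<in>{n - 2, n - 1, n}. kl i * lsum (n - i))"
    by (rule sum.mono_neutral_right) (use assms lsum_ge_3 in auto)
  also have "\<dots> = kl (n - 2) * lsum 2 + kl (n - 1) * lsum 1 + kl n * lsum 0"
  proof -
    have "n - (n - 2) = 2" "n - (n - 1) = 1" "n - 2 \<noteq> n - 1" "n - 2 \<noteq> n" "n - 1 \<noteq> n" using assms by auto
    then show ?thesis by (simp add: add.assoc)
  qed
  finally show ?thesis by (simp add: lsum_0 lsum_1[unfolded One_nat_def] lsum_2 algebra_simps)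
qed

text \<open>Since \<open>\<psi>\<close> sums to zero over \<open>Fix 1\<close>, \<open>N c\<close>
  may be replaced by \<open>N c - H\<close>, which is never positive, so the norms add up to
  \<open>q * H\<close> minus the total of the fibre sizes. The main terms \<open>q ^ (2 * k)\<close>
  cancel and leave \<open>3 * q * q ^ k + 1\<close>.\<close>

lemma norm_kl_even_le:
  assumes k: "k \<ge> 2"
  shows "norm (kl (2 * k)) \<le> (3 * real q + 1) * real q ^ k"
proof -
  define N where "N = (\<lambda>c. card {x \<in> Fix (2 * k) - {0}. tr (2 * k) (a * x + b / x) = c})"
  define H where "H = real q ^ (2 * k - 1) + 3 * real q ^ k"
  have k0: "2 * k > 0" using k by simp
  note F = card_Fix[OF k0] card_Fix[of 1, simplified]
  have im: "(\<lambda>x. tr (2 * k) (a * x + b / x)) ` (Fix (2 * k) - {0}) \<subseteq> Fix 1"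
    using arg_Fix tr_Fix by blast
  have N_le: "real (N c) \<le> H" for c
  proof -
    have "N c \<le> q ^ (2 * k - 1) + 3 * q ^ k" unfolding N_def by (rule card_trace_fibre_le[OF k a b(1)])
    then have "real (N c) \<le> real (q ^ (2 * k - 1) + 3 * q ^ k)" by (simp only: of_nat_le_iff)
    then show ?thesis by (simp add: H_def)
  qed
  have fin: "finite (Fix (2 * k) - {0})" "finite (Fix 1)" using F by auto
  have "(\<Sum>c\<in>Fix 1. N c) = card (Fix (2 * k) - {0})"
    using sum.group[OF fin im, of "\<lambda>_. 1::nat"] by (simp add: N_def)
  also have "\<dots> = q ^ (2 * k) - 1" using F by simp
  finally have sumN: "(\<Sum>c\<in>Fix 1. real (N c)) = real q ^ (2 * k) - 1"
    using q3 by (simp add: of_nat_diff Suc_leI flip: of_nat_sum)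
  have "kl (2 * k) = (\<Sum>c\<in>Fix 1. \<Sum>x\<in>{x \<in> Fix (2 * k) - {0}. tr (2 * k) (a * x + b / x) = c}. \<psi> (tr (2 * k) (a * x + b / x)))"
    unfolding kl_def by (rule sum.group[OF fin im, symmetric])
  also have "\<dots> = (\<Sum>c\<in>Fix 1. of_nat (N c) * \<psi> c)"
    unfolding N_def by (intro sum.cong refl) simp
  also have "\<dots> = (\<Sum>c\<in>Fix 1. (of_real (real (N c) - H)) * \<psi> c)"
    using psi_sum_zero by (simp add: algebra_simps sum_subtractf flip: sum_distrib_left sum_distrib_right)
  also have "norm \<dots> \<le> (\<Sum>c\<in>Fix 1. H - real (N c))"
    by (rule sum_norm_le) (use N_le in \<open>simp add: norm_mult psi_norm del: of_real_diff\<close>)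
  also have "\<dots> = real q * H - (real q ^ (2 * k) - 1)"
    using F sumN by (simp add: sum_subtractf)
  also have "real q * H = real q ^ (2 * k) + 3 * real q * real q ^ k"
  proof -
    have "real q * real q ^ (2 * k - 1) = real q ^ (2 * k)" using k by (simp flip: power_Suc)
    then show ?thesis by (simp add: H_def algebra_simps)
  qed
  also have "real q ^ (2 * k) + 3 * real q * real q ^ k - (real q ^ (2 * k) - 1) \<le> (3 * real q + 1) * real q ^ k"
    using q3 by (simp add: algebra_simps)
  finally show ?thesis .
qed

theorem weil_kloosterman_closure: "norm (kl 1) \<le> 2 * sqrt (real q)"
proof -
  \<comment> \<open>\<open>u\<close> and \<open>v\<close> are to be the roots of
    \<open>X^2 + kl 1 X + q\<close>, the reversed L-polynomial.\<close>
  define w where "w = csqrt (kl 1 * kl 1 - 4 * of_nat q)"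
  define u where "u = (- kl 1 + w) / 2"
  define v where "v = (- kl 1 - w) / 2"
  have ww: "w * w = kl 1 * kl 1 - 4 * of_nat q"
    using power2_csqrt[of "kl 1 * kl 1 - 4 * of_nat q"] by (simp add: w_def power2_eq_square)
  have uv: "u + v = - kl 1" by (simp add: u_def v_def field_simps)
  have "u * v = (kl 1 * kl 1 - w * w) / 4" by (simp add: u_def v_def field_simps)
  then have prod: "u * v = of_nat q" by (simp add: ww)
  have "kl n = - (u ^ n + v ^ n)" if "n \<ge> 1" for n
    using power_sum_recurrence[OF uv prod kl_2 kl_rec that] .
  then have "norm (u ^ (2 * k) + v ^ (2 * k)) \<le> (3 * real q + 1) * real q ^ k" if "k \<ge> 2" for k
    using norm_kl_even_le[OF that] that by (metis norm_minus_cancel One_nat_def Suc_leI le_trans mult_le_mono one_le_numeral mult_2 trans_le_add1)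
  then have "norm (u + v) \<le> 2 * sqrt (real q)"
    using prod by (intro power_sum_bound_imp[where C = "3 * real q + 1"]) auto
  then show ?thesis using uv by simp
qed

end

section \<open>Weil's bound over a finite field\<close>

lemma finite_field_card_facts:
  fixes p m :: nat
  assumes p: "prime p" and m: "CARD('k::{finite,field}) = p ^ m"
  shows "CHAR('k) = p" and "x ^ CARD('k) = (x :: 'k)"
proof -
  have "(\<Sum>x\<in>(UNIV :: 'k set). x) = (\<Sum>x\<in>UNIV. x + 1)"
    by (rule sum.reindex_bij_witness[of _ "\<lambda>x. x + 1" "\<lambda>x. x - 1"]) auto
  then have "of_nat CARD('k) = (0 :: 'k)" by (simp add: sum.distrib)
  then have "CHAR('k) dvd p ^ m" using m of_nat_eq_0_iff_char_dvd by metis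
  moreover have "prime CHAR('k)"
    by (intro prime_CHAR_semidom finite_imp_CHAR_pos finite)
  ultimately show "CHAR('k) = p" using p by (metis prime_dvd_power primes_dvd_imp_eq)
  show "x ^ CARD('k) = x"
  proof (cases "x = 0")
    case False
    have "\<Prod>(UNIV - {0 :: 'k}) = (\<Prod>y\<in>UNIV - {0}. x * y)"
      by (rule prod.reindex_bij_witness[of _ "\<lambda>y. x * y" "\<lambda>y. y / x"]) (use False in auto)
    also have "\<dots> = x ^ (CARD('k) - 1) * \<Prod>(UNIV - {0})" by (simp add: prod.distrib)
    finally have "x ^ (CARD('k) - 1) = 1" by simp
    moreover have "x ^ CARD('k) = x ^ (CARD('k) - 1) * x"
      using power_minus_mult[OF finite_UNIV_card_ge_0[where ?'a = 'k, OF finite], of x] by simp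
    ultimately show ?thesis by simp
  qed (use finite_UNIV_card_ge_0[where ?'a = 'k, OF finite] in simp)
qed

text \<open>Applied with \<open>Q\<close> the characteristic and \<open>n = m\<close>, to reach the
  prime field by a trace, and with \<open>Q\<close> the size of the field and \<open>n = 1\<close>,
  to make the base field itself \<open>Fix 1\<close>.\<close>

lemma range_to_ac_Fix:
  fixes p m :: nat
  assumes p: "prime p" "p \<ge> 3" "Q = p ^ e" "e \<ge> 1" and n: "n \<ge> 1" "CARD('k::{finite,field}) = Q ^ n"
  shows "frobenius_field TYPE('k alg_closure) Q"
    and "frobenius_field.Fix Q n = range (to_ac :: 'k \<Rightarrow> 'k alg_closure)"
proof -
  have c: "CARD('k) = p ^ (e * n)" using n p by (simp add: power_mult)
  note facts = finite_field_card_facts[OF p(1) c]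
  have "p ^ 1 \<le> p ^ e" using p by (intro power_increasing) auto
  then have Q3: "Q \<ge> 3" using p by simp
  show F: "frobenius_field TYPE('k alg_closure) Q"
    by standard (use facts p Q3 in \<open>auto\<close>)
  then interpret frobenius_field Q "TYPE('k alg_closure)" .
  have "to_ac x \<in> Fix n" for x :: 'k
    using facts(2)[of x] n by (simp add: Fix_def flip: to_ac_power)
  then have sub: "range (to_ac :: 'k \<Rightarrow> 'k alg_closure) \<subseteq> Fix n" by blast
  moreover have "card (range (to_ac :: 'k \<Rightarrow> 'k alg_closure)) = Q ^ n"
    using n by (simp add: card_image inj_to_ac)
  ultimately show "Fix n = range (to_ac :: 'k \<Rightarrow> 'k alg_closure)"
    using card_Fix[of n] n by (metis card_subset_eq less_eq_Suc_le One_nat_def)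
qed

text \<open>The trace to the prime field followed by powers of a \<open>p\<close>-th root of unity.
  It is nontrivial because the trace is a polynomial of degree at most \<open>p ^ (m - 1)\<close>,
  too small to vanish on all \<open>p ^ m\<close> elements.\<close>

lemma exists_nontrivial_character:
  fixes p m :: nat
  assumes p: "prime p" "odd p" and m: "m \<ge> 1" "CARD('k::{finite,field}) = p ^ m"
  shows "\<exists>\<psi> :: 'k \<Rightarrow> complex. (\<forall>x y. \<psi> (x + y) = \<psi> x * \<psi> y) \<and> (\<forall>x. norm (\<psi> x) = 1) \<and> (\<exists>x. \<psi> x \<noteq> 1)"
proof -
  have p3: "p \<ge> 3" using p prime_ge_2_nat[OF p(1)] by (cases "p = 2") auto
  note FF = range_to_ac_Fix[OF p(1) p3 power_one_right[symmetric] order_refl m(1,2)]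
  interpret frobenius_field p "TYPE('k alg_closure)" by (rule FF(1))
  have char: "CHAR('k alg_closure) = p"
    using finite_field_card_facts(1)[OF p(1) m(2)] by simp
  have in_Fix: "of_nat r \<in> Fix 1" for r by (induction r) (auto intro: Fix_add)
  have inj: "inj_on (of_nat :: nat \<Rightarrow> 'k alg_closure) {..<p}"
  proof (rule linorder_inj_onI)
    fix r s assume rs: "r < s" "r \<in> {..<p}" "s \<in> {..<p}"
    show "(of_nat r :: 'k alg_closure) \<noteq> of_nat s"
    proof
      assume "(of_nat r :: 'k alg_closure) = of_nat s"
      then have "(of_nat (s - r) :: 'k alg_closure) = 0" using rs by (simp add: of_nat_diff)
      then have "p dvd s - r" using of_nat_eq_0_iff_char_dvd char by metis
      then show False using rs by (auto dest: dvd_imp_le)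
    qed
  qed auto
  have surj: "of_nat ` {..<p} = Fix 1"
    by (rule card_subset_eq) (use in_Fix card_Fix[of 1] inj in \<open>auto simp: card_image\<close>)
  define T :: "'k \<Rightarrow> 'k alg_closure" where "T = (\<lambda>x. tr m (to_ac x))"
  have T1: "T x \<in> Fix 1" for x unfolding T_def by (rule tr_Fix) (use FF(2) in auto)
  have "\<exists>r. T x = of_nat r" for x using T1[of x] surj by auto
  \<comment> \<open>\<open>r\<close> picks an arbitrary natural number representing the trace;
    \<open>e_cong\<close> makes the choice harmless.\<close>
  then obtain r where r: "\<And>x. T x = of_nat (r x)" by metis
  define e :: "nat \<Rightarrow> complex" where "e = (\<lambda>k. cis (2 * pi * real k / real p))"
  have e_add: "e (k + l) = e k * e l" for k l
    by (simp add: e_def cis_mult add_divide_distrib distrib_left)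
  have e_p: "e (k * p) = 1" for k
  proof -
    have *: "2 * pi * real (k * p) / real p = 2 * pi * real k" using p3 by simp
    show ?thesis unfolding e_def * by (rule cis_multiple_2pi) simp
  qed
  have e_cong: "e k = e l" if "(of_nat k :: 'k alg_closure) = of_nat l" "k \<le> l" for k l
  proof -
    have "(of_nat (l - k) :: 'k alg_closure) = 0" using that by (simp add: of_nat_diff)
    then have "p dvd l - k" using of_nat_eq_0_iff_char_dvd[where ?'a = "'k alg_closure"] char by simp
    then obtain t where "l - k = t * p" by (metis dvd_div_mult_self)
    then have "l = k + t * p" using that by simp
    then show ?thesis by (simp add: e_add e_p)
  qed
  then have e_cong: "e k = e l" if "(of_nat k :: 'k alg_closure) = of_nat l" for k l
    using that by (metis nat_le_linear)
  define \<psi> where "\<psi> = (\<lambda>x. e (r x))"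
  have "\<psi> (x + y) = \<psi> x * \<psi> y" for x y
  proof -
    have "(of_nat (r (x + y)) :: 'k alg_closure) = of_nat (r x + r y)"
    proof -
      have "(of_nat (r (x + y)) :: 'k alg_closure) = T (x + y)" by (simp only: r)
      also have "\<dots> = T x + T y" by (simp add: T_def tr_add)
      finally show ?thesis by (simp add: r)
    qed
    then show ?thesis unfolding \<psi>_def e_add[symmetric] by (rule e_cong)
  qed
  moreover have "norm (\<psi> x) = 1" for x by (simp add: \<psi>_def e_def)
  moreover have "\<exists>x. \<psi> x \<noteq> 1"
  proof -
    have "\<exists>x. T x \<noteq> 0"
    proof (rule ccontr)
      assume "\<not> (\<exists>x. T x \<noteq> 0)"
      then have T0: "\<And>x. T x = 0" by blast
      define P :: "'k alg_closure poly" where "P = (\<Sum>i<m. monom 1 (p ^ i))"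
      have "coeff P (p ^ (m - 1)) = (\<Sum>i<m. if i = m - 1 then 1 else 0)"
        unfolding P_def using p3 by (auto simp: coeff_sum intro!: sum.cong)
      then have "P \<noteq> 0" using m(1) by auto
      have sub: "Fix m \<subseteq> {x. poly P x = 0}"
        using T0 FF(2) by (auto simp: T_def tr_def P_def poly_sum poly_monom)
      have "card (Fix m) \<le> card {x. poly P x = 0}"
        by (rule card_mono[OF poly_roots_finite[OF \<open>P \<noteq> 0\<close>] sub])
      then have "p ^ m \<le> card {x. poly P x = 0}" using card_Fix(2)[of m] m(1) by simp
      also have "\<dots> \<le> degree P" by (rule card_poly_roots_bound[OF \<open>P \<noteq> 0\<close>])
      also have "\<dots> \<le> p ^ (m - 1)" unfolding P_def
        by (intro degree_sum_le order.trans[OF degree_monom_le] power_increasing) (use p3 in auto)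
      also have "\<dots> < p ^ m" using p3 m(1) by (intro power_strict_increasing) auto
      finally show False by simp
    qed
    then obtain x where "T x \<noteq> 0" by blast
    obtain k where k: "k < p" "T x = of_nat k" using T1[of x] surj by auto
    then have k0: "k > 0" using \<open>T x \<noteq> 0\<close> by (cases k) auto
    have "\<psi> x = e k" unfolding \<psi>_def by (rule e_cong) (use r[of x] k in simp)
    moreover have "e k \<noteq> 1"
    proof
      assume "e k = 1"
      then have "e k = e 0" by (simp add: e_def)
      moreover have "inj_on e {..<p}"
        using bij_betw_roots_unity[of p] p3 by (simp add: e_def bij_betw_def)
      ultimately show False using k k0 by (auto dest: inj_onD)
    qed
    ultimately show ?thesis by metis
  qed
  ultimately show ?thesis by blast
qed

theorem weil_kloosterman:
  fixes p m :: nat and \<psi> :: "'k::{finite,field} \<Rightarrow> complex"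
  assumes p: "prime p" "odd p" and m: "m \<ge> 1" "CARD('k) = p ^ m"
    and add: "\<And>x y. \<psi> (x + y) = \<psi> x * \<psi> y" and nrm: "\<And>x. norm (\<psi> x) = 1" and nt: "\<exists>x. \<psi> x \<noteq> 1"
    and ab: "a \<noteq> 0" "b \<noteq> 0"
  shows "norm (\<Sum>x\<in>UNIV - {0}. \<psi> (a * x + b / x)) \<le> 2 * sqrt (real CARD('k))"
proof -
  have p3: "p \<ge> 3" using p prime_ge_2_nat[OF p(1)] by (cases "p = 2") auto
  note FF = range_to_ac_Fix[OF p(1) p3 m(2) m(1) order_refl power_one_right[symmetric]]
  interpret frobenius_field "CARD('k)" "TYPE('k alg_closure)" by (rule FF(1))
  interpret kloosterman_closure "CARD('k)" "TYPE('k alg_closure)" "\<lambda>x. \<psi> (of_ac x)" "to_ac a" "to_ac b"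
  proof
    fix x y :: "'k alg_closure" assume "x \<in> Fix 1" "y \<in> Fix 1"
    then obtain x' y' where "x = to_ac x'" "y = to_ac y'" using FF(2) by auto
    then show "\<psi> (of_ac (x + y)) = \<psi> (of_ac x) * \<psi> (of_ac y)"
      by (simp add: add flip: to_ac_add)
  next
    obtain x where "\<psi> x \<noteq> 1" using nt by blast
    then show "\<exists>x\<in>Fix 1. \<psi> (of_ac x) \<noteq> 1" using FF(2) by (intro bexI[of _ "to_ac x"]) auto
  qed (use FF(2) nrm ab in auto)
  have "kl 1 = (\<Sum>x\<in>UNIV - {0}. \<psi> (a * x + b / x))"
    unfolding kl_def
  proof (rule sum.reindex_bij_witness[of _ to_ac of_ac])
    fix x assume "x \<in> Fix 1 - {0 :: 'k alg_closure}"
    then obtain x' where x: "x = to_ac x'" "x' \<noteq> 0" using FF(2) by auto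
    then show "to_ac (of_ac x) = x" "of_ac x \<in> UNIV - {0}" by auto
    have "tr 1 (to_ac a * x + to_ac b / x) = to_ac (a * x' + b / x')" by (simp add: tr_def x)
    then show "\<psi> (a * of_ac x + b / of_ac x) = \<psi> (of_ac (tr 1 (to_ac a * x + to_ac b / x)))"
      using x by (metis of_ac_to_ac)
  qed (use FF(2) in auto)
  then show ?thesis using weil_kloosterman_closure by simp
qed

section \<open>Gauss sums and the Fourier transform of a sphere\<close>

lemma norm_sum_square_le_card:
  fixes f :: "'i \<Rightarrow> complex"
  shows "(norm (\<Sum>i\<in>A. f i))\<^sup>2 \<le> real (card A) * (\<Sum>i\<in>A. (norm (f i))\<^sup>2)"
proof -
  have "(norm (\<Sum>i\<in>A. f i))\<^sup>2 \<le> (\<Sum>i\<in>A. norm (f i))\<^sup>2"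
    by (intro power_mono norm_sum) auto
  also have "\<dots> \<le> (\<Sum>i\<in>A. (norm (f i))\<^sup>2) * card A"
    by (rule sum_squared_le_sum_of_squares)
  finally show ?thesis by (simp add: mult.commute)
qed

lemma norm_square_sum_expand:
  fixes f :: "'i \<Rightarrow> complex"
  shows "of_real ((norm (\<Sum>i\<in>I. f i))\<^sup>2) = (\<Sum>i\<in>I. \<Sum>i'\<in>I. f i * cnj (f i'))"
  by (simp only: complex_norm_square cnj_sum sum_product)

lemma sum_swap3:
  "(\<Sum>x\<in>A. \<Sum>y\<in>B. \<Sum>z\<in>C. f x y z) = (\<Sum>y\<in>B. \<Sum>z\<in>C. \<Sum>x\<in>A. f x y z)"
proof -
  have "(\<Sum>x\<in>A. \<Sum>y\<in>B. \<Sum>z\<in>C. f x y z) = (\<Sum>y\<in>B. \<Sum>x\<in>A. \<Sum>z\<in>C. f x y z)"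
    by (rule sum.swap)
  also have "\<dots> = (\<Sum>y\<in>B. \<Sum>z\<in>C. \<Sum>x\<in>A. f x y z)"
    by (intro sum.cong refl sum.swap)
  finally show ?thesis .
qed

lemma sum_vec_prod:
  fixes f :: "'n::finite \<Rightarrow> 'k::finite \<Rightarrow> 'c::comm_semiring_1"
  shows "(\<Sum>x\<in>(UNIV :: ('k ^ 'n) set). \<Prod>i\<in>UNIV. f i (x $ i)) = (\<Prod>i\<in>UNIV. \<Sum>t\<in>UNIV. f i t)"
proof -
  have "(\<Prod>i\<in>UNIV. \<Sum>t\<in>UNIV. f i t) = (\<Sum>g\<in>PiE UNIV (\<lambda>_. UNIV). \<Prod>i\<in>UNIV. f i (g i))"
    by (rule prod_sum_PiE) auto
  also have "\<dots> = (\<Sum>x\<in>(UNIV :: ('k ^ 'n) set). \<Prod>i\<in>UNIV. f i (x $ i))"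
    by (rule sum.reindex_bij_witness[of _ vec_nth vec_lambda]) auto
  finally show ?thesis ..
qed

definition dotp :: "'k::comm_ring_1 ^ 'n::finite \<Rightarrow> 'k ^ 'n \<Rightarrow> 'k" where
  "dotp v w = (\<Sum>i\<in>UNIV. v $ i * w $ i)"

definition qf :: "'k::comm_ring_1 ^ 'n::finite \<Rightarrow> 'k" where
  "qf v = dotp v v"

lemma dotp_diff_left: "dotp (u - v) w = dotp u w - dotp v w"
  and dotp_diff_right: "dotp u (v - w) = dotp u v - dotp u w"
  and dotp_smult_left: "dotp (c *s u) w = c * dotp u w"
  and dotp_smult_right: "dotp u (c *s w) = c * dotp u w"
  and dotp_commute: "dotp u w = dotp w u"
  by (simp_all add: dotp_def algebra_simps sum.distrib sum_subtractf sum_distrib_left)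

lemma qf_smult: "qf (c *s v) = c\<^sup>2 * qf v"
  by (simp add: qf_def dotp_smult_left dotp_smult_right power2_eq_square mult.assoc)

lemma qf_diff: "qf (u - v) = qf u - 2 * dotp u v + qf v"
  by (simp add: qf_def dotp_diff_left dotp_diff_right dotp_commute[of v u])

text \<open>A nonzero constant term keeps the polynomial nonzero even when \<open>a\<close> or
  \<open>b\<close> vanishes; such degenerate quadratics do occur below.\<close>

lemma card_nonzero_roots_le_2:
  fixes a b c :: "'k::field"
  assumes "c \<noteq> 0"
  shows "card {x \<in> V. a * x\<^sup>2 + b * x + c = 0} \<le> 2"
proof -
  have nz: "[:c, b, a:] \<noteq> 0" using assms by simp
  have "card {x \<in> V. a * x\<^sup>2 + b * x + c = 0} \<le> card {x. poly [:c, b, a:] x = 0}"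
    by (intro card_mono poly_roots_finite[OF nz]) (auto simp: power2_eq_square algebra_simps)
  also have "\<dots> \<le> degree [:c, b, a:]" by (rule card_poly_roots_bound[OF nz])
  also have "\<dots> \<le> 2" by simp
  finally show ?thesis .
qed

section \<open>Additive characters and Fourier analysis\<close>

locale additive_character =
  fixes \<psi> :: "'k::{finite,field} \<Rightarrow> complex" and q :: nat
  assumes q_card: "q = CARD('k)" and chi_add: "\<psi> (x + y) = \<psi> x * \<psi> y"
    and chi_norm: "norm (\<psi> x) = 1"
    and chi_nontriv: "\<exists>x. \<psi> x \<noteq> 1"
    and two_nz: "(2 :: 'k) \<noteq> 0"
begin

lemma q_pos [simp]: "q > 0" "q \<noteq> 0"
  unfolding q_card using finite_UNIV_card_ge_0[where ?'a = 'k, OF finite] by simp_all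

lemma card_UNIV_q [simp]: "card (UNIV :: 'k set) = q" by (simp add: q_card)

lemma q_ge_1: "real q \<ge> 1" using q_pos(1) by linarith

lemma four_nz: "(4 :: 'k) \<noteq> 0"
proof -
  have "(4 :: 'k) = 2 * 2" by simp
  then show ?thesis using two_nz by (metis mult_eq_0_iff)
qed

lemma chi_0 [simp]: "\<psi> 0 = 1"
  using chi_add[of 0 0] chi_norm[of 0] by auto

lemma chi_minus: "\<psi> (- x) = cnj (\<psi> x)"
proof -
  have "\<psi> x * \<psi> (- x) = 1" by (simp flip: chi_add)
  moreover have "\<psi> x * cnj (\<psi> x) = 1" using chi_norm[of x] by (simp flip: complex_norm_square)
  moreover have "\<psi> x \<noteq> 0" using chi_norm[of x] by auto
  ultimately show ?thesis by (metis mult_left_cancel)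
qed

lemma chi_diff: "\<psi> (x - y) = \<psi> x * cnj (\<psi> y)"
  using chi_add[of x "- y"] by (simp add: chi_minus)

lemma chi_sum: "\<psi> (\<Sum>i\<in>A. f i) = (\<Prod>i\<in>A. \<psi> (f i))"
  by (induction A rule: infinite_finite_induct) (auto simp: chi_add)

lemma chi_lin_sum: "(\<Sum>x\<in>UNIV. \<psi> (c * x)) = (if c = 0 then of_nat q else 0)"
proof (cases "c = 0")
  case False
  obtain t where t: "\<psi> t \<noteq> 1" using chi_nontriv by blast
  have "(\<Sum>x\<in>UNIV. \<psi> (c * x)) = (\<Sum>x\<in>UNIV. \<psi> (c * (x + t / c)))"
    by (rule sum.reindex_bij_witness[of _ "\<lambda>x. x + t / c" "\<lambda>x. x - t / c"]) auto
  also have "\<dots> = \<psi> t * (\<Sum>x\<in>UNIV. \<psi> (c * x))"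
    using False by (simp add: distrib_left chi_add sum_distrib_left mult.commute)
  finally show ?thesis using t False by simp
qed simp

lemma chi_lin_sum_nz: "(\<Sum>x\<in>UNIV - {0}. \<psi> (c * x)) = (if c = 0 then of_nat q else 0) - 1"
  using chi_lin_sum[of c] by (simp add: sum_diff1)

lemma chi_dotp_sum:
  "(\<Sum>x\<in>(UNIV :: ('k ^ 'n::finite) set). \<psi> (dotp v x)) = (if v = 0 then of_nat q ^ CARD('n) else 0)"
proof -
  have "(\<Sum>x\<in>(UNIV :: ('k ^ 'n) set). \<psi> (dotp v x)) = (\<Prod>i\<in>UNIV. \<Sum>t\<in>UNIV. \<psi> (v $ i * t))"
    unfolding dotp_def chi_sum by (rule sum_vec_prod)
  also have "\<dots> = (\<Prod>i\<in>UNIV. if v $ i = 0 then of_nat q else 0)" by (simp only: chi_lin_sum)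
  also have "\<dots> = (if v = 0 then of_nat q ^ CARD('n) else 0)"
  proof (cases "v = 0")
    case False
    then obtain i where "v $ i \<noteq> 0" by (auto simp: vec_eq_iff)
    then have "(\<Prod>i\<in>UNIV. if v $ i = 0 then of_nat q else 0 :: complex) = 0"
      by (intro prod_zero) auto
    then show ?thesis using False by simp
  qed simp
  finally show ?thesis .
qed

lemma parseval: "(\<Sum>\<xi>\<in>UNIV. (norm (\<Sum>u\<in>UNIV. c u * \<psi> (\<xi> * u)))\<^sup>2) = real q * (\<Sum>u\<in>UNIV. (norm (c u))\<^sup>2)"
proof -
  have "complex_of_real (\<Sum>\<xi>\<in>UNIV. (norm (\<Sum>u\<in>UNIV. c u * \<psi> (\<xi> * u)))\<^sup>2)
      = (\<Sum>\<xi>\<in>UNIV. \<Sum>u\<in>UNIV. \<Sum>u'\<in>UNIV. c u * cnj (c u') * \<psi> ((u - u') * \<xi>))"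
    unfolding of_real_sum norm_square_sum_expand
    by (intro sum.cong refl) (simp add: left_diff_distrib right_diff_distrib chi_diff mult_ac)
  also have "\<dots> = (\<Sum>u\<in>UNIV. \<Sum>u'\<in>UNIV. c u * cnj (c u') * (\<Sum>\<xi>\<in>UNIV. \<psi> ((u - u') * \<xi>)))"
    unfolding sum_distrib_left by (rule sum_swap3)
  also have "\<dots> = (\<Sum>u\<in>UNIV. \<Sum>u'\<in>UNIV. if u' = u then c u * cnj (c u) * of_nat q else 0)"
    by (intro sum.cong refl) (auto simp: chi_lin_sum)
  also have "\<dots> = complex_of_real (real q * (\<Sum>u\<in>UNIV. (norm (c u))\<^sup>2))"
    by (simp add: complex_norm_square sum_distrib_left mult.commute del: of_real_power)
  finally show ?thesis by (simp only: of_real_eq_iff)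
qed

text \<open>Fourier inversion diagonalises a kernel depending on \<open>u' - u\<close>:
  \<open>q\<close> times the form is the sum of \<open>kh\<close> weighted by the squares of
  \<open>ch\<close>, and \<open>parseval\<close> evaluates the sum of these squares.\<close>

lemma toeplitz_bound:
  fixes k0 :: "'k \<Rightarrow> complex"
  assumes "\<And>\<xi>. norm (\<Sum>w\<in>UNIV. \<psi> (\<xi> * w) * k0 w) \<le> \<kappa>"
  shows "norm (\<Sum>u\<in>UNIV. \<Sum>u'\<in>UNIV. c u * cnj (c u') * k0 (u' - u)) \<le> \<kappa> * (\<Sum>u\<in>UNIV. (norm (c u))\<^sup>2)"
proof -
  define kh where "kh = (\<lambda>\<xi>. \<Sum>w\<in>UNIV. \<psi> (\<xi> * w) * k0 w)"
  define ch where "ch = (\<lambda>\<xi>. \<Sum>u\<in>UNIV. c u * \<psi> (\<xi> * u))"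
  have inv: "of_nat q * k0 w = (\<Sum>\<xi>\<in>UNIV. kh \<xi> * \<psi> (- (\<xi> * w)))" for w
  proof -
    have "(\<Sum>\<xi>\<in>UNIV. kh \<xi> * \<psi> (- (\<xi> * w))) = (\<Sum>w'\<in>UNIV. k0 w' * (\<Sum>\<xi>\<in>UNIV. \<psi> ((w' - w) * \<xi>)))"
      unfolding kh_def sum_distrib_left sum_distrib_right
      by (subst sum.swap) (intro sum.cong refl, simp add: left_diff_distrib right_diff_distrib chi_diff chi_minus mult_ac)
    also have "\<dots> = (\<Sum>w'\<in>UNIV. if w' = w then k0 w * of_nat q else 0)"
      by (intro sum.cong refl) (auto simp: chi_lin_sum)
    finally show ?thesis by (simp add: mult.commute)
  qed
  have "of_nat q * (\<Sum>u\<in>UNIV. \<Sum>u'\<in>UNIV. c u * cnj (c u') * k0 (u' - u))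
      = (\<Sum>u\<in>UNIV. \<Sum>u'\<in>UNIV. c u * cnj (c u') * (of_nat q * k0 (u' - u)))"
    by (simp add: sum_distrib_left mult_ac)
  also have "\<dots> = (\<Sum>u\<in>UNIV. \<Sum>u'\<in>UNIV. \<Sum>\<xi>\<in>UNIV. kh \<xi> * ((c u * \<psi> (\<xi> * u)) * cnj (c u' * \<psi> (\<xi> * u'))))"
    unfolding inv sum_distrib_left
    by (intro sum.cong refl) (simp add: right_diff_distrib chi_diff mult_ac)
  also have "\<dots> = (\<Sum>\<xi>\<in>UNIV. \<Sum>u\<in>UNIV. \<Sum>u'\<in>UNIV. kh \<xi> * ((c u * \<psi> (\<xi> * u)) * cnj (c u' * \<psi> (\<xi> * u'))))"
    by (rule sum_swap3[symmetric])
  also have "\<dots> = (\<Sum>\<xi>\<in>UNIV. kh \<xi> * of_real ((norm (ch \<xi>))\<^sup>2))"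
    unfolding ch_def norm_square_sum_expand by (simp add: sum_distrib_left)
  finally have eq: "of_nat q * (\<Sum>u\<in>UNIV. \<Sum>u'\<in>UNIV. c u * cnj (c u') * k0 (u' - u))
      = (\<Sum>\<xi>\<in>UNIV. kh \<xi> * of_real ((norm (ch \<xi>))\<^sup>2))" .
  have "norm (\<Sum>\<xi>\<in>UNIV. kh \<xi> * of_real ((norm (ch \<xi>))\<^sup>2)) \<le> (\<Sum>\<xi>\<in>UNIV. \<kappa> * (norm (ch \<xi>))\<^sup>2)"
    by (rule sum_norm_le) (use assms in \<open>auto simp: norm_mult kh_def norm_power intro!: mult_right_mono\<close>)
  also have "\<dots> = \<kappa> * (real q * (\<Sum>u\<in>UNIV. (norm (c u))\<^sup>2))"
    unfolding ch_def by (simp add: parseval flip: sum_distrib_left)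
  finally have "real q * norm (\<Sum>u\<in>UNIV. \<Sum>u'\<in>UNIV. c u * cnj (c u') * k0 (u' - u))
     \<le> real q * (\<kappa> * (\<Sum>u\<in>UNIV. (norm (c u))\<^sup>2))"
    using arg_cong[OF eq, of norm] by (simp add: norm_mult mult_ac)
  then show ?thesis by simp
qed

section \<open>Gauss sums and quadratic exponential sums\<close>

definition gauss :: "'k \<Rightarrow> complex" where "gauss s = (\<Sum>t\<in>UNIV. \<psi> (s * t\<^sup>2))"

lemma norm_gauss:
  assumes "s \<noteq> 0"
  shows "(norm (gauss s))\<^sup>2 = real q"
proof -
  have "complex_of_real ((norm (gauss s))\<^sup>2) = (\<Sum>x\<in>UNIV. \<Sum>y\<in>UNIV. \<psi> (s * x\<^sup>2 - s * y\<^sup>2))"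
    unfolding gauss_def norm_square_sum_expand by (simp add: chi_diff)
  also have "\<dots> = (\<Sum>y\<in>UNIV. \<Sum>x\<in>UNIV. \<psi> (s * x\<^sup>2 - s * y\<^sup>2))" by (rule sum.swap)
  also have "\<dots> = (\<Sum>y\<in>UNIV. \<Sum>u\<in>UNIV. \<psi> (s * (u + y)\<^sup>2 - s * y\<^sup>2))"
  proof (rule sum.cong[OF refl])
    fix y
    show "(\<Sum>x\<in>UNIV. \<psi> (s * x\<^sup>2 - s * y\<^sup>2)) = (\<Sum>u\<in>UNIV. \<psi> (s * (u + y)\<^sup>2 - s * y\<^sup>2))"
      by (rule sum.reindex_bij_witness[of _ "\<lambda>u. u + y" "\<lambda>x. x - y"]) auto
  qed
  also have "\<dots> = (\<Sum>u\<in>UNIV. \<psi> (s * u\<^sup>2) * (\<Sum>y\<in>UNIV. \<psi> ((2 * s * u) * y)))"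
    unfolding sum_distrib_left
    by (subst sum.swap) (intro sum.cong refl, simp add: power2_eq_square algebra_simps flip: chi_add)
  also have "\<dots> = (\<Sum>u\<in>(UNIV :: 'k set). if u = 0 then of_nat q else 0)"
    using assms two_nz by (intro sum.cong refl) (auto simp: chi_lin_sum)
  finally have "complex_of_real ((norm (gauss s))\<^sup>2) = of_real (real q)" by simp
  then show ?thesis by (simp only: of_real_eq_iff)
qed

definition two_sq :: "'k \<Rightarrow> nat" where "two_sq c = card {z. (fst z)\<^sup>2 + (snd z)\<^sup>2 = (c :: 'k)}"

text \<open>Pigeonhole: more than half of the field consists of squares, so the squares meet their
  reflection \<open>c - x^2\<close>. Strictness comes from 0, which has a single square
  root.\<close>

lemma sum_two_squares: "\<exists>x y. x\<^sup>2 + y\<^sup>2 = (c :: 'k)"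
proof -
  have card: "2 * card (range (\<lambda>x::'k. x\<^sup>2)) > q"
  proof -
    have "(\<Union>s\<in>range (\<lambda>x::'k. x\<^sup>2). {x. x\<^sup>2 = s}) = UNIV" by auto
    then have "q = card (\<Union>s\<in>range (\<lambda>x::'k. x\<^sup>2). {x. x\<^sup>2 = s})" by simp
    also have "\<dots> = (\<Sum>s\<in>range (\<lambda>x::'k. x\<^sup>2). card {x. x\<^sup>2 = s})"
      by (rule card_UN_disjoint) auto
    also have "\<dots> < (\<Sum>s\<in>range (\<lambda>x::'k. x\<^sup>2). 2)"
    proof (rule sum_strict_mono_ex1)
      have "card {x. x\<^sup>2 = s} \<le> 2" for s :: 'k
      proof (cases "s = 0")
        case False
        then show ?thesis using card_nonzero_roots_le_2[of "- s" UNIV 1 0] by simp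
      qed simp
      then show "\<forall>s\<in>range (\<lambda>x::'k. x\<^sup>2). card {x. x\<^sup>2 = s} \<le> 2" by blast
      show "\<exists>s\<in>range (\<lambda>x::'k. x\<^sup>2). card {x. x\<^sup>2 = s} < 2"
        by (rule bexI[of _ 0]) (auto simp: image_iff intro!: exI[of _ 0])
    qed simp
    finally show ?thesis by simp
  qed
  have "range (\<lambda>x::'k. x\<^sup>2) \<inter> range (\<lambda>x. c - x\<^sup>2) \<noteq> {}"
  proof
    assume "range (\<lambda>x::'k. x\<^sup>2) \<inter> range (\<lambda>x. c - x\<^sup>2) = {}"
    then have "card (range (\<lambda>x::'k. x\<^sup>2) \<union> range (\<lambda>x. c - x\<^sup>2)) = card (range (\<lambda>x::'k. x\<^sup>2)) + card (range (\<lambda>x. c - x\<^sup>2))"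
      by (intro card_Un_disjoint) auto
    also have "range (\<lambda>x. c - x\<^sup>2) = (\<lambda>s. c - s) ` range (\<lambda>x::'k. x\<^sup>2)" by auto
    also have "card \<dots> = card (range (\<lambda>x::'k. x\<^sup>2))" by (intro card_image) (auto simp: inj_on_def)
    finally have "card (range (\<lambda>x::'k. x\<^sup>2) \<union> (\<lambda>s. c - s) ` range (\<lambda>x::'k. x\<^sup>2)) > q" using card by simp
    moreover have "card (range (\<lambda>x::'k. x\<^sup>2) \<union> (\<lambda>s. c - s) ` range (\<lambda>x::'k. x\<^sup>2)) \<le> q"
      unfolding q_card by (intro card_mono) auto
    ultimately show False by simp
  qed
  then obtain x y where "x\<^sup>2 = c - y\<^sup>2" by auto
  then show ?thesis by (metis diff_add_cancel)
qed

text \<open>Multiplication by \<open>e + f i\<close> with \<open>e\<^sup>2 + f\<^sup>2 = c\<close> permutes the pairs and scales the form by \<open>c\<close>.\<close>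
lemma two_sq_const:
  assumes "c \<noteq> 0"
  shows "two_sq c = two_sq 1"
proof -
  obtain e f where ef: "e\<^sup>2 + f\<^sup>2 = c" using sum_two_squares by blast
  have bij: "bij_betw (\<lambda>(x, y). (e * x - f * y, e * y + f * x))
     {z. (fst z)\<^sup>2 + (snd z)\<^sup>2 = (1 :: 'k)} {z. (fst z)\<^sup>2 + (snd z)\<^sup>2 = c}"
  proof (rule bij_betw_byWitness[where f' = "\<lambda>(x, y). ((e * x + f * y) / c, (e * y - f * x) / c)"], goal_cases)
    case 1
    have "e * (e * x - f * y) + f * (e * y + f * x) = c * x" "e * (e * y + f * x) - f * (e * x - f * y) = c * y" for x y
      unfolding ef[symmetric] by (simp_all add: power2_eq_square algebra_simps)
    then show ?case using assms by auto
  next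
    case 2
    have "e * (e * x + f * y) - f * (e * y - f * x) = c * x" "e * (e * y - f * x) + f * (e * x + f * y) = c * y" for x y
      unfolding ef[symmetric] by (simp_all add: power2_eq_square algebra_simps)
    then show ?case using assms
      by (auto simp: diff_divide_distrib[symmetric] add_divide_distrib[symmetric])
  next
    case 3
    have "(e * x - f * y)\<^sup>2 + (e * y + f * x)\<^sup>2 = c * (x\<^sup>2 + y\<^sup>2)" for x y
      unfolding ef[symmetric] by (simp add: power2_eq_square algebra_simps)
    then show ?case by auto
  next
    case 4
    have "(e * x + f * y)\<^sup>2 + (e * y - f * x)\<^sup>2 = c * (x\<^sup>2 + y\<^sup>2)" for x y
      unfolding ef[symmetric] by (simp add: power2_eq_square algebra_simps)
    then have "((e * x + f * y) / c)\<^sup>2 + ((e * y - f * x) / c)\<^sup>2 = (x\<^sup>2 + y\<^sup>2) / c" for x y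
      using assms by (simp add: power_divide power2_eq_square[of c] flip: add_divide_distrib)
    then show ?case using assms by auto
  qed
  show ?thesis unfolding two_sq_def by (rule bij_betw_same_card[OF bij, symmetric])
qed

definition gsq :: complex where "gsq = (gauss 1)\<^sup>2"

text \<open>\<open>(gauss s)^2\<close> is a sum over the values of \<open>x^2 + y^2\<close>, and all
  nonzero values are taken equally often, so \<open>s\<close> drops out. This keeps quadratic
  characters away in even dimension.\<close>

lemma gauss_square:
  assumes "s \<noteq> 0"
  shows "(gauss s)\<^sup>2 = gsq"
proof -
  have *: "(gauss s)\<^sup>2 = of_nat (two_sq 0) - of_nat (two_sq 1)" if "s \<noteq> 0" for s
  proof -
    have "(gauss s)\<^sup>2 = (\<Sum>x\<in>UNIV. \<Sum>y\<in>UNIV. \<psi> (s * (x\<^sup>2 + y\<^sup>2)))"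
      by (simp add: gauss_def power2_eq_square[of "sum _ _"] sum_product distrib_left chi_add)
    also have "\<dots> = (\<Sum>z\<in>UNIV. \<psi> (s * ((fst z)\<^sup>2 + (snd z)\<^sup>2)))"
      by (simp add: sum.cartesian_product case_prod_unfold UNIV_Times_UNIV)
    also have "\<dots> = (\<Sum>c\<in>UNIV. \<Sum>z\<in>{z \<in> UNIV. (fst z)\<^sup>2 + (snd z)\<^sup>2 = c}. \<psi> (s * ((fst z)\<^sup>2 + (snd z)\<^sup>2)))"
      by (rule sum.group[symmetric]) auto
    also have "\<dots> = (\<Sum>c\<in>UNIV. of_nat (two_sq c) * \<psi> (s * c))"
      unfolding two_sq_def by (intro sum.cong refl) simp
    also have "\<dots> = of_nat (two_sq 0) + (\<Sum>c\<in>UNIV - {0}. of_nat (two_sq c) * \<psi> (s * c))"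
      by (subst sum.remove[of _ 0]) auto
    also have "(\<Sum>c\<in>UNIV - {0}. of_nat (two_sq c) * \<psi> (s * c)) = of_nat (two_sq 1) * (\<Sum>c\<in>UNIV - {0}. \<psi> (s * c))"
      unfolding sum_distrib_left
    proof (intro sum.cong refl)
      fix c :: 'k assume "c \<in> UNIV - {0}"
      then show "of_nat (two_sq c) * \<psi> (s * c) = of_nat (two_sq 1) * \<psi> (s * c)"
        using two_sq_const[of c] by simp
    qed
    finally show ?thesis using that by (simp add: chi_lin_sum_nz)
  qed
  show ?thesis using *[OF assms] *[of 1] by (simp add: gsq_def)
qed

lemma norm_gsq: "norm gsq = real q"
  using norm_gauss[of 1] by (simp add: gsq_def norm_power)

text \<open>The square is completed in each coordinate. The number of coordinates being even, the
  Gauss sums pair up into powers of the constant \<open>gsq\<close>.\<close>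

lemma chi_quadratic_sum:
  assumes s: "s \<noteq> 0" and n: "CARD('n::finite) = 2 * h"
  shows "(\<Sum>x\<in>(UNIV :: ('k ^ 'n) set). \<psi> (s * qf x + dotp v x)) = gsq ^ h * \<psi> (- qf v / (4 * s))"
proof -
  have one: "(\<Sum>t\<in>UNIV. \<psi> (s * t\<^sup>2 + w * t)) = gauss s * \<psi> (- w\<^sup>2 / (4 * s))" for w
  proof -
    define c where "c = w / (2 * s)"
    have w: "w = 2 * s * c" using s two_nz by (simp add: c_def)
    have "w\<^sup>2 / (4 * s) = (4 * s) * (s * c\<^sup>2) / (4 * s)" by (simp add: w power2_eq_square)
    also have "\<dots> = s * c\<^sup>2" using s four_nz by simp
    finally have e: "s * (t - c)\<^sup>2 + w * (t - c) = s * t\<^sup>2 + - w\<^sup>2 / (4 * s)" for t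
      by (simp add: w power2_eq_square algebra_simps)
    have "(\<Sum>t\<in>UNIV. \<psi> (s * t\<^sup>2 + w * t)) = (\<Sum>t\<in>UNIV. \<psi> (s * (t - c)\<^sup>2 + w * (t - c)))"
      by (rule sum.reindex_bij_witness[of _ "\<lambda>t. t - c" "\<lambda>t. t + c"]) auto
    also have "\<dots> = (\<Sum>t\<in>UNIV. \<psi> (s * t\<^sup>2) * \<psi> (- w\<^sup>2 / (4 * s)))" unfolding e by (simp only: chi_add)
    finally show ?thesis by (simp only: gauss_def sum_distrib_right)
  qed
  have "(\<Sum>x\<in>(UNIV :: ('k ^ 'n) set). \<psi> (s * qf x + dotp v x))
      = (\<Sum>x\<in>(UNIV :: ('k ^ 'n) set). \<Prod>i\<in>UNIV. \<psi> (s * (x $ i)\<^sup>2 + v $ i * x $ i))"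
    unfolding qf_def dotp_def chi_sum[symmetric]
    by (simp add: sum.distrib sum_distrib_left power2_eq_square)
  also have "\<dots> = (\<Prod>i\<in>UNIV. gauss s * \<psi> (- (v $ i)\<^sup>2 / (4 * s)))"
    unfolding sum_vec_prod[of "\<lambda>i t. \<psi> (s * t\<^sup>2 + v $ i * t)"] one ..
  also have "\<dots> = gauss s ^ (2 * h) * \<psi> (- qf v / (4 * s))"
    unfolding prod.distrib chi_sum[symmetric]
    by (simp add: n qf_def dotp_def power2_eq_square sum_negf flip: sum_divide_distrib)
  also have "gauss s ^ (2 * h) = gsq ^ h" by (simp add: power_mult gauss_square[OF s])
  finally show ?thesis .
qed

text \<open>The condition \<open>qf a = j\<close> is detected by a character sum over
  \<open>r\<close>; \<open>r = 0\<close> yields the term at \<open>v = 0\<close>, every other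
  \<open>r\<close> a quadratic sum.\<close>

lemma sphere_fourier:
  assumes n: "CARD('n::finite) = 2 * h"
  shows "of_nat q * (\<Sum>a | qf a = j. \<psi> (dotp v a))
     = (if v = 0 then of_nat q ^ CARD('n) else 0)
       + gsq ^ h * (\<Sum>r\<in>UNIV - {0}. \<psi> (- r * j - qf (v :: 'k ^ 'n) / (4 * r)))"
proof -
  have "of_nat q * (\<Sum>a | qf a = j. \<psi> (dotp v a)) = (\<Sum>a\<in>UNIV. \<Sum>r\<in>UNIV. \<psi> ((qf a - j) * r) * \<psi> (dotp v a))"
    unfolding sum_distrib_right[symmetric] chi_lin_sum
    by (simp add: sum_distrib_left if_distrib[of "\<lambda>x. x * _"] sum.If_cases cong: if_cong)
  also have "\<dots> = (\<Sum>r\<in>UNIV. \<Sum>a\<in>UNIV. \<psi> (- r * j) * \<psi> (r * qf a + dotp v a))"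
    by (subst sum.swap) (intro sum.cong refl, simp add: algebra_simps flip: chi_add)
  also have "\<dots> = (\<Sum>a\<in>UNIV. \<psi> (dotp v a)) + (\<Sum>r\<in>UNIV - {0}. \<Sum>a\<in>UNIV. \<psi> (- r * j) * \<psi> (r * qf a + dotp v a))"
    by (subst sum.remove[of _ 0]) auto
  also have "(\<Sum>r\<in>UNIV - {0}. \<Sum>a\<in>UNIV. \<psi> (- r * j) * \<psi> (r * qf a + dotp v a))
      = gsq ^ h * (\<Sum>r\<in>UNIV - {0}. \<psi> (- r * j - qf v / (4 * r)))"
    unfolding sum_distrib_left
    by (intro sum.cong refl)
      (simp add: chi_quadratic_sum[OF _ n] chi_diff chi_minus flip: sum_distrib_left)
  finally show ?thesis by (simp add: chi_dotp_sum)
qed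

text \<open>Different indices may share a frequency, so the diagonal is governed by
  \<open>v i = v i'\<close>. It serves once with \<open>I\<close> equal to \<open>B\<close> and once
  with pairs of a point of \<open>A\<close> and a nonzero scalar.\<close>

lemma sphere_second_moment:
  fixes v :: "'i \<Rightarrow> 'k ^ 'n::finite"
  assumes n: "CARD('n) = 2 * h" and I: "finite I"
  shows "of_real (real q * (\<Sum>a | qf a = j. (norm (\<Sum>i\<in>I. \<psi> (\<theta> i + dotp (v i) a)))\<^sup>2))
     = (\<Sum>i\<in>I. \<Sum>i'\<in>I. \<psi> (\<theta> i - \<theta> i') * (if v i = v i' then of_nat q ^ CARD('n) else 0))
       + gsq ^ h * (\<Sum>i\<in>I. \<Sum>i'\<in>I. \<Sum>r\<in>UNIV - {0}. \<psi> (\<theta> i - \<theta> i' - r * j - qf (v i - v i') / (4 * r)))"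
proof -
  have "of_real (real q * (\<Sum>a | qf a = j. (norm (\<Sum>i\<in>I. \<psi> (\<theta> i + dotp (v i) a)))\<^sup>2))
     = of_nat q * (\<Sum>a | qf a = j. \<Sum>i\<in>I. \<Sum>i'\<in>I. \<psi> (\<theta> i - \<theta> i') * \<psi> (dotp (v i - v i') a))"
    unfolding of_real_mult of_real_sum norm_square_sum_expand of_real_of_nat_eq
    by (intro arg_cong[of _ _ "(*) (of_nat q)"] sum.cong refl) (simp add: chi_add chi_diff dotp_diff_left mult_ac)
  also have "\<dots> = (\<Sum>i\<in>I. \<Sum>i'\<in>I. \<psi> (\<theta> i - \<theta> i') * (of_nat q * (\<Sum>a | qf a = j. \<psi> (dotp (v i - v i') a))))"
    unfolding sum_distrib_left
    by (subst sum_swap3) (simp add: mult_ac)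
  also have "\<dots> = (\<Sum>i\<in>I. \<Sum>i'\<in>I. \<psi> (\<theta> i - \<theta> i') * (if v i = v i' then of_nat q ^ CARD('n) else 0)
        + gsq ^ h * (\<Sum>r\<in>UNIV - {0}. \<psi> (\<theta> i - \<theta> i' - r * j - qf (v i - v i') / (4 * r))))"
    unfolding sphere_fourier[OF n] 
    by (intro sum.cong refl)
      (simp add: distrib_left sum_distrib_left mult.left_commute algebra_simps flip: chi_add)
  finally show ?thesis by (simp add: sum.distrib sum_distrib_left)
qed

end

section \<open>Large and small sets on a sphere\<close>

context additive_character
begin

definition energy :: "('k ^ 'n::finite) set \<Rightarrow> ('k ^ 'n) set \<Rightarrow> real" where
  "energy A B = (\<Sum>s\<in>UNIV - {0}. (norm (\<Sum>a\<in>A. \<Sum>b\<in>B. \<psi> (s * (qf b - 2 * dotp a b))))\<^sup>2)"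

section \<open>Exponential sums counting roots of quadratics and points of conics\<close>

lemma card_nonzero: "card (UNIV - {0 :: 'k}) = q - 1"
  by (simp add: card_Diff_singleton)

lemma chi_sum_delta:
  assumes "finite V"
  shows "(\<Sum>u\<in>V. \<Sum>r\<in>UNIV - {0}. \<psi> (f u * r)) = of_nat q * of_nat (card {u \<in> V. f u = 0}) - of_nat (card V)"
proof -
  have "(\<Sum>u\<in>V. \<Sum>r\<in>UNIV - {0}. \<psi> (f u * r)) = (\<Sum>u\<in>V. (if f u = 0 then of_nat q else 0)) - of_nat (card V)"
    by (simp add: chi_lin_sum_nz sum_subtractf)
  also have "(\<Sum>u\<in>V. (if f u = 0 then of_nat q else 0)) = (of_nat q * of_nat (card {u \<in> V. f u = 0}) :: complex)"
    using assms by (simp add: sum.If_cases Int_def mult.commute)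
  finally show ?thesis .
qed

text \<open>After \<open>s = r * u\<close> the exponent is \<open>r\<close> times a quadratic in
  \<open>u\<close>, so the sum over \<open>r\<close> counts its nonzero roots; the constant term
  \<open>- j\<close> leaves at most two.\<close>

lemma double_sum_bound:
  assumes j: "j \<noteq> 0"
  shows "norm (\<Sum>s\<in>UNIV - {0}. \<Sum>r\<in>UNIV - {0}. \<psi> (s * \<alpha> - r * j - s\<^sup>2 * \<beta> / r)) \<le> 2 * real q"
proof -
  have "(\<Sum>s\<in>UNIV - {0}. \<Sum>r\<in>UNIV - {0}. \<psi> (s * \<alpha> - r * j - s\<^sup>2 * \<beta> / r))
      = (\<Sum>r\<in>UNIV - {0}. \<Sum>s\<in>UNIV - {0}. \<psi> (s * \<alpha> - r * j - s\<^sup>2 * \<beta> / r))" by (rule sum.swap)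
  also have "\<dots> = (\<Sum>r\<in>UNIV - {0}. \<Sum>u\<in>UNIV - {0}. \<psi> (((- \<beta>) * u\<^sup>2 + \<alpha> * u + (- j)) * r))"
  proof (rule sum.cong[OF refl])
    fix r :: 'k assume r: "r \<in> UNIV - {0}"
    show "(\<Sum>s\<in>UNIV - {0}. \<psi> (s * \<alpha> - r * j - s\<^sup>2 * \<beta> / r))
      = (\<Sum>u\<in>UNIV - {0}. \<psi> (((- \<beta>) * u\<^sup>2 + \<alpha> * u + (- j)) * r))"
    proof (rule sum.reindex_bij_witness[of _ "\<lambda>u. r * u" "\<lambda>s. s / r"])
      fix s assume "s \<in> UNIV - {0 :: 'k}"
      have "((- \<beta>) * (s / r)\<^sup>2 + \<alpha> * (s / r) + (- j)) * r = s * \<alpha> - r * j - s\<^sup>2 * \<beta> / r"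
        using r by (simp add: field_simps power2_eq_square)
      then show "\<psi> (((- \<beta>) * (s / r)\<^sup>2 + \<alpha> * (s / r) + (- j)) * r) = \<psi> (s * \<alpha> - r * j - s\<^sup>2 * \<beta> / r)" by simp
    qed (use r in auto)
  qed
  also have "\<dots> = (\<Sum>u\<in>UNIV - {0}. \<Sum>r\<in>UNIV - {0}. \<psi> (((- \<beta>) * u\<^sup>2 + \<alpha> * u + (- j)) * r))" by (rule sum.swap)
  also have "\<dots> = of_real (real q * real (card {u \<in> UNIV - {0}. (- \<beta>) * u\<^sup>2 + \<alpha> * u + (- j) = 0}) - real (q - 1))"
    unfolding chi_sum_delta[OF finite] card_nonzero by simp
  also have "norm \<dots> \<le> 2 * real q"
  proof -
    have "card {u \<in> UNIV - {0}. (- \<beta>) * u\<^sup>2 + \<alpha> * u + (- j) = 0} \<le> 2"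
      using j by (intro card_nonzero_roots_le_2) simp
    then have "real q * real (card {u \<in> UNIV - {0}. (- \<beta>) * u\<^sup>2 + \<alpha> * u + (- j) = 0}) \<le> real q * 2"
      by (intro mult_left_mono) auto
    moreover have "real q * real (card {u \<in> UNIV - {0}. (- \<beta>) * u\<^sup>2 + \<alpha> * u + (- j) = 0}) \<ge> 0" by simp
    moreover have "real (q - 1) \<le> real q" "real (q - 1) \<ge> 0" by auto
    ultimately show ?thesis unfolding norm_of_real by linarith
  qed
  finally show ?thesis .
qed

text \<open>The points \<open>(\<alpha>, \<beta>)\<close> of the conic are parametrised by \<open>\<sigma> = (1 - \<alpha> + \<beta>) / \<alpha>\<close>.\<close>
lemma card_conic:
  assumes j: "j \<noteq> 0" and t: "t \<noteq> 0"
  shows "card {z \<in> (UNIV - {0}) \<times> (UNIV - {0}). j * (1 - fst z + snd z)\<^sup>2 + fst z * snd z * t = (0 :: 'k)}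
    = q - 1 - card {\<sigma> \<in> UNIV - {0}. (j / t) * \<sigma>\<^sup>2 + 1 * \<sigma> + 1 = 0}" (is "card ?Z = _")
proof -
  \<comment> \<open>With \<open>1 - \<alpha> + \<beta> = \<sigma> * \<alpha>\<close> the conic gives
    \<open>\<beta> = - (j / t) * \<sigma>^2 * \<alpha>\<close>, and then
    \<open>p \<sigma> * \<alpha> = 1\<close>. So \<open>\<sigma> = 0\<close>, which makes
    \<open>\<beta>\<close> zero, and the zeros of \<open>p\<close> are left out.\<close>
  define S where "S = {\<sigma> \<in> UNIV - {0}. (j / t) * \<sigma>\<^sup>2 + 1 * \<sigma> + 1 \<noteq> 0}"
  define p where "p = (\<lambda>\<sigma>. (j / t) * \<sigma>\<^sup>2 + \<sigma> + 1)"
  have bij: "bij_betw (\<lambda>\<sigma>. (1 / p \<sigma>, - (j / t) * \<sigma>\<^sup>2 / p \<sigma>)) S ?Z"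
  proof (rule bij_betw_byWitness[where f' = "\<lambda>(\<alpha>, \<beta>). (1 - \<alpha> + \<beta>) / \<alpha>"], goal_cases)
    case 1
    show ?case
    proof
      fix \<sigma> assume "\<sigma> \<in> S"
      then have p: "p \<sigma> \<noteq> 0" by (simp add: S_def p_def)
      have "p \<sigma> * (1 - 1 / p \<sigma> + - (j / t) * \<sigma>\<^sup>2 / p \<sigma>) = \<sigma>"
        using p by (simp add: distrib_left right_diff_distrib) (simp add: p_def)
      then show "(case (1 / p \<sigma>, - (j / t) * \<sigma>\<^sup>2 / p \<sigma>) of (\<alpha>, \<beta>) \<Rightarrow> (1 - \<alpha> + \<beta>) / \<alpha>) = \<sigma>"
        by (simp add: mult.commute)
    qed
  next
    case 2
    show ?case
    proof
      fix z assume z: "z \<in> ?Z"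
      obtain \<alpha> \<beta> where ab: "z = (\<alpha>, \<beta>)" by (cases z)
      have nz: "\<alpha> \<noteq> 0" "\<beta> \<noteq> 0" and e: "j * (1 - \<alpha> + \<beta>)\<^sup>2 + \<alpha> * \<beta> * t = 0" using z ab by auto
      define \<sigma> where "\<sigma> = (1 - \<alpha> + \<beta>) / \<alpha>"
      have s: "1 - \<alpha> + \<beta> = \<sigma> * \<alpha>" using nz by (simp add: \<sigma>_def)
      have "\<alpha> * (j * \<sigma>\<^sup>2 * \<alpha> + \<beta> * t) = 0" using e unfolding s by (simp add: power2_eq_square algebra_simps)
      then have "j * \<sigma>\<^sup>2 * \<alpha> + \<beta> * t = 0" using nz by simp
      then have "- (j * \<sigma>\<^sup>2 * \<alpha>) = \<beta> * t" by (simp add: neg_eq_iff_add_eq_0)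
      then have "- (j * \<sigma>\<^sup>2 * \<alpha>) / t = \<beta>" using t by simp
      then have b: "- (j / t) * \<sigma>\<^sup>2 * \<alpha> = \<beta>" by simp
      have "p \<sigma> * \<alpha> = \<sigma> * \<alpha> + \<alpha> - (- (j / t) * \<sigma>\<^sup>2 * \<alpha>)" by (simp add: p_def algebra_simps)
      also have "\<dots> = 1" unfolding b s[symmetric] by simp
      finally have pa: "p \<sigma> * \<alpha> = 1" .
      then have "p \<sigma> \<noteq> 0" by auto
      then have inv: "1 / p \<sigma> = \<alpha>" using pa by (simp add: divide_eq_eq mult.commute)
      have "- (j / t) * \<sigma>\<^sup>2 / p \<sigma> = - (j / t) * \<sigma>\<^sup>2 * (1 / p \<sigma>)" by simp
      also have "\<dots> = \<beta>" unfolding inv by (rule b)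
      finally show "(1 / p (case z of (\<alpha>, \<beta>) \<Rightarrow> (1 - \<alpha> + \<beta>) / \<alpha>),
          - (j / t) * (case z of (\<alpha>, \<beta>) \<Rightarrow> (1 - \<alpha> + \<beta>) / \<alpha>)\<^sup>2 / p (case z of (\<alpha>, \<beta>) \<Rightarrow> (1 - \<alpha> + \<beta>) / \<alpha>)) = z"
        using inv by (simp add: ab \<sigma>_def)
    qed
  next
    case 3
    show ?case
    proof safe
      fix \<sigma> assume "\<sigma> \<in> S"
      then have p: "p \<sigma> \<noteq> 0" "\<sigma> \<noteq> 0" by (simp_all add: S_def p_def)
      have "p \<sigma> * (1 - 1 / p \<sigma> + - (j / t) * \<sigma>\<^sup>2 / p \<sigma>) = \<sigma>"
        using p by (simp add: distrib_left right_diff_distrib) (simp add: p_def)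
      then have s: "1 - 1 / p \<sigma> + - (j / t) * \<sigma>\<^sup>2 / p \<sigma> = \<sigma> / p \<sigma>" using p by (simp add: eq_divide_eq mult.commute)
      show "j * (1 - fst (1 / p \<sigma>, - (j / t) * \<sigma>\<^sup>2 / p \<sigma>) + snd (1 / p \<sigma>, - (j / t) * \<sigma>\<^sup>2 / p \<sigma>))\<^sup>2
          + fst (1 / p \<sigma>, - (j / t) * \<sigma>\<^sup>2 / p \<sigma>) * snd (1 / p \<sigma>, - (j / t) * \<sigma>\<^sup>2 / p \<sigma>) * t = 0"
        unfolding fst_conv snd_conv s using p t by (simp add: power_divide power2_eq_square)
    qed (use j t in \<open>auto simp: S_def p_def\<close>)
  next
    case 4
    show ?case
    proof
      fix \<tau> assume "\<tau> \<in> (\<lambda>(\<alpha>, \<beta>). (1 - \<alpha> + \<beta>) / \<alpha>) ` ?Z"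
      then obtain z where z: "z \<in> ?Z" "\<tau> = (\<lambda>(\<alpha>, \<beta>). (1 - \<alpha> + \<beta>) / \<alpha>) z" by blast
      obtain \<alpha> \<beta> where ab: "z = (\<alpha>, \<beta>)" by (cases z)
      have nz: "\<alpha> \<noteq> 0" "\<beta> \<noteq> 0" and e: "j * (1 - \<alpha> + \<beta>)\<^sup>2 + \<alpha> * \<beta> * t = 0"
        and \<tau>: "\<tau> = (1 - \<alpha> + \<beta>) / \<alpha>" using z by (auto simp: ab)
      define \<sigma> where "\<sigma> = (1 - \<alpha> + \<beta>) / \<alpha>"
      have s: "1 - \<alpha> + \<beta> = \<sigma> * \<alpha>" using nz by (simp add: \<sigma>_def)
      have "\<alpha> * (j * \<sigma>\<^sup>2 * \<alpha> + \<beta> * t) = 0" using e unfolding s by (simp add: power2_eq_square algebra_simps)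
      then have e2: "j * \<sigma>\<^sup>2 * \<alpha> + \<beta> * t = 0" using nz by simp
      then have "- (j * \<sigma>\<^sup>2 * \<alpha>) = \<beta> * t" by (simp add: neg_eq_iff_add_eq_0)
      then have "- (j * \<sigma>\<^sup>2 * \<alpha>) / t = \<beta>" using t by simp
      then have b: "- (j / t) * \<sigma>\<^sup>2 * \<alpha> = \<beta>" by simp
      have "p \<sigma> * \<alpha> = \<sigma> * \<alpha> + \<alpha> - (- (j / t) * \<sigma>\<^sup>2 * \<alpha>)" by (simp add: p_def algebra_simps)
      also have "\<dots> = 1" unfolding b s[symmetric] by simp
      finally have "p \<sigma> \<noteq> 0" by auto
      moreover have "\<sigma> \<noteq> 0" using e2 nz t by auto
      ultimately show "\<tau> \<in> S" unfolding S_def p_def \<tau> \<sigma>_def[symmetric] by simp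
    qed
  qed
  have "card ?Z = card S" by (rule bij_betw_same_card[OF bij, symmetric])
  also have "S = (UNIV - {0}) - {\<sigma> \<in> UNIV - {0}. (j / t) * \<sigma>\<^sup>2 + 1 * \<sigma> + 1 = 0}" by (auto simp: S_def)
  also have "card \<dots> = q - 1 - card {\<sigma> \<in> UNIV - {0}. (j / t) * \<sigma>\<^sup>2 + 1 * \<sigma> + 1 = 0}"
    by (subst card_Diff_subset) (auto simp: card_nonzero)
  finally show ?thesis .
qed

text \<open>Scaling \<open>w\<close> and \<open>w'\<close> by \<open>r\<close> makes the exponent
  linear in \<open>r\<close>, and the sum becomes \<open>q * card Z - (q - 1)^2\<close>. The conic
  \<open>Z\<close> has between \<open>q - 3\<close> and \<open>q - 1\<close> points, so the terms of
  order \<open>q^2\<close> cancel.\<close>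

lemma triple_sum_bound:
  assumes j: "j \<noteq> 0"
  shows "norm (\<Sum>w\<in>UNIV - {0}. \<Sum>w'\<in>UNIV - {0}. \<Sum>r\<in>UNIV - {0}.
      \<psi> (2 * j * w - 2 * j * w' - r * j - (j * (w - w')\<^sup>2 + w * w' * t) / r)) \<le> 2 * real q"
proof -
  define Z where "Z = {z \<in> (UNIV - {0}) \<times> (UNIV - {0}). j * (1 - fst z + snd z)\<^sup>2 + fst z * snd z * t = (0 :: 'k)}"
  have "(\<Sum>w\<in>UNIV - {0}. \<Sum>w'\<in>UNIV - {0}. \<Sum>r\<in>UNIV - {0}.
      \<psi> (2 * j * w - 2 * j * w' - r * j - (j * (w - w')\<^sup>2 + w * w' * t) / r))
    = (\<Sum>r\<in>UNIV - {0}. \<Sum>w\<in>UNIV - {0}. \<Sum>w'\<in>UNIV - {0}.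
      \<psi> (2 * j * w - 2 * j * w' - r * j - (j * (w - w')\<^sup>2 + w * w' * t) / r))"
    by (rule sum_swap3[symmetric])
  also have "\<dots> = (\<Sum>r\<in>UNIV - {0}. \<Sum>z\<in>(UNIV - {0}) \<times> (UNIV - {0}).
      \<psi> (2 * j * fst z - 2 * j * snd z - r * j - (j * (fst z - snd z)\<^sup>2 + fst z * snd z * t) / r))"
    by (simp add: sum.cartesian_product case_prod_unfold)
  also have "\<dots> = (\<Sum>r\<in>UNIV - {0}. \<Sum>z\<in>(UNIV - {0}) \<times> (UNIV - {0}).
      \<psi> ((- (j * (1 - fst z + snd z)\<^sup>2 + fst z * snd z * t)) * r))"
  proof (rule sum.cong[OF refl])
    fix r :: 'k assume r: "r \<in> UNIV - {0}"
    show "(\<Sum>z\<in>(UNIV - {0}) \<times> (UNIV - {0}).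
      \<psi> (2 * j * fst z - 2 * j * snd z - r * j - (j * (fst z - snd z)\<^sup>2 + fst z * snd z * t) / r))
      = (\<Sum>z\<in>(UNIV - {0}) \<times> (UNIV - {0}). \<psi> ((- (j * (1 - fst z + snd z)\<^sup>2 + fst z * snd z * t)) * r))"
    proof (rule sum.reindex_bij_witness[of _ "\<lambda>z. (r * fst z, r * snd z)" "\<lambda>z. (fst z / r, snd z / r)"])
      fix z :: "'k \<times> 'k" assume "z \<in> (UNIV - {0}) \<times> (UNIV - {0})"
      obtain x y where z: "z = (r * x, r * y)" using r
        by (metis (no_types, lifting) DiffE insertI1 nonzero_mult_div_cancel_left surj_pair times_divide_eq_right)
      have "(j * (r * x - r * y)\<^sup>2 + r * x * (r * y) * t) / r = r * (j * (x - y)\<^sup>2 + x * y * t)"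
        using r by (simp add: power2_eq_square field_simps)
      then have "2 * j * (r * x) - 2 * j * (r * y) - r * j - (j * (r * x - r * y)\<^sup>2 + r * x * (r * y) * t) / r
        = - (j * (1 - x + y)\<^sup>2 + x * y * t) * r"
        by (simp add: power2_eq_square algebra_simps)
      then show "\<psi> (- (j * (1 - fst (fst z / r, snd z / r) + snd (fst z / r, snd z / r))\<^sup>2
            + fst (fst z / r, snd z / r) * snd (fst z / r, snd z / r) * t) * r)
          = \<psi> (2 * j * fst z - 2 * j * snd z - r * j - (j * (fst z - snd z)\<^sup>2 + fst z * snd z * t) / r)"
        using r by (simp add: z)
    qed (use r in auto)
  qed
  also have "\<dots> = (\<Sum>z\<in>(UNIV - {0}) \<times> (UNIV - {0}). \<Sum>r\<in>UNIV - {0}.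
      \<psi> ((- (j * (1 - fst z + snd z)\<^sup>2 + fst z * snd z * t)) * r))" by (rule sum.swap)
  also have "\<dots> = of_real (real q * real (card Z) - real ((q - 1) * (q - 1)))"
  proof -
    have "{z \<in> (UNIV - {0}) \<times> (UNIV - {0}). - (j * (1 - fst z + snd z)\<^sup>2 + fst z * snd z * t) = 0} = Z"
      unfolding Z_def by (simp only: neg_equal_0_iff_equal)
    then show ?thesis unfolding chi_sum_delta[OF finite] card_cartesian_product card_nonzero by simp
  qed
  also have "norm \<dots> \<le> 2 * real q"
  proof -
    have Z: "card Z + 3 \<ge> q" "card Z + 1 \<le> q"
    proof -
      show "card Z + 3 \<ge> q"
      \<comment> \<open>For \<open>t = 0\<close> the conic degenerates to the line
        \<open>fst z = 1 + snd z\<close>, outside the scope of \<open>card_conic\<close>.\<close>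
      proof (cases "t = 0")
        case True
        have "(\<lambda>\<beta>. (1 + \<beta>, \<beta>)) ` (UNIV - {0, - 1}) \<subseteq> Z"
          using True by (auto simp: Z_def add_eq_0_iff)
        then have "card ((\<lambda>\<beta>. (1 + \<beta>, \<beta>)) ` (UNIV - {0, - 1 :: 'k})) \<le> card Z"
          by (intro card_mono) auto
        moreover have "card ((\<lambda>\<beta>. (1 + \<beta>, \<beta>)) ` (UNIV - {0, - 1 :: 'k})) = card (UNIV - {0, - 1 :: 'k})"
          by (rule card_image) (auto simp: inj_on_def)
        moreover have "card (UNIV - {0, - 1 :: 'k}) \<ge> q - 2"
          by (rule order.trans[OF _ diff_card_le_card_Diff]) (auto simp: card_insert_if)
        ultimately show ?thesis by linarith
      next
        case False
        have "card {\<sigma> \<in> UNIV - {0}. (j / t) * \<sigma>\<^sup>2 + 1 * \<sigma> + 1 = 0} \<le> 2" by (rule card_nonzero_roots_le_2) simp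
        then show ?thesis using card_conic[OF j False] unfolding Z_def by linarith
      qed
      show "card Z + 1 \<le> q"
      proof (cases "t = 0")
        case True
        have eqv: "1 - x + y = 0 \<longleftrightarrow> x = 1 + y" for x y :: 'k
        proof -
          have e: "1 - x + y = (1 + y) - x" by simp
          show ?thesis unfolding e right_minus_eq by (rule eq_commute)
        qed
        have "inj_on snd Z" "snd ` Z \<subseteq> UNIV - {0}" using True j by (auto simp: Z_def inj_on_def eqv)
        then have "card Z \<le> card (UNIV - {0 :: 'k})" by (intro card_inj_on_le[of snd]) auto
        then show ?thesis unfolding card_nonzero using q_pos(1) by linarith
      next
        case False
        then show ?thesis using card_conic[OF j False] q_pos(1) unfolding Z_def by linarith
      qed
    qed
    have "real (card Z) \<ge> real q - 3" "real (card Z) \<le> real q - 1" using Z by linarith+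
    then have "real q * (real q - 3) \<le> real q * real (card Z)" "real q * real (card Z) \<le> real q * (real q - 1)"
      by (intro mult_left_mono; simp)+
    moreover have "real ((q - 1) * (q - 1)) = (real q - 1) * (real q - 1)"
      using q_pos(1) by (simp add: of_nat_diff Suc_leI)
    ultimately show ?thesis unfolding norm_of_real using q_ge_1 by (simp add: algebra_simps abs_le_iff)
  qed
  finally show ?thesis .
qed

section \<open>The energy of a large set\<close>

lemma norm_sum_sum_le:
  fixes f :: "'i \<Rightarrow> 'i' \<Rightarrow> complex"
  assumes "\<And>x y. x \<in> A \<Longrightarrow> y \<in> B \<Longrightarrow> norm (f x y) \<le> c"
  shows "norm (\<Sum>x\<in>A. \<Sum>y\<in>B. f x y) \<le> real (card A) * real (card B) * c"
proof -
  have "norm (\<Sum>x\<in>A. \<Sum>y\<in>B. f x y) \<le> (\<Sum>x\<in>A. \<Sum>y\<in>B. c)"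
    by (intro sum_norm_le order.trans[OF norm_sum] sum_mono assms)
  then show ?thesis by simp
qed

text \<open>On the sphere \<open>2 * dotp a a'\<close> equals \<open>2 * j - qf (a - a')\<close>,
  which removes the scalar product.\<close>

lemma qf_comb:
  assumes "qf a = j" "qf a' = j"
  shows "qf (s *s a - s' *s a') = j * (s - s')\<^sup>2 + s * s' * qf (a - a')"
  unfolding qf_diff qf_smult dotp_smult_left dotp_smult_right assms
  by (simp add: power2_eq_square algebra_simps)

lemma qf_minus_two: "qf ((-2) *s x - (-2) *s y) / (4 * r) = qf (x - y) / (r :: 'k)"
proof -
  have "qf ((-2) *s x - (-2) *s y) = 4 * qf (x - y)"
    unfolding qf_diff qf_smult dotp_smult_left dotp_smult_right by (simp add: power2_eq_square algebra_simps)
  then show ?thesis using four_nz by simp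
qed

lemma minus_two_inj: "(-2) *s x = (-2) *s y \<longleftrightarrow> x = (y :: 'k ^ 'n::finite)"
  using two_nz by (auto simp: vec_eq_iff)

lemma smult_inj: "s \<noteq> 0 \<Longrightarrow> s *s x = s *s y \<longleftrightarrow> x = (y :: 'k ^ 'n::finite)"
  by (auto simp: vec_eq_iff)

text \<open>The second moment over the sphere gives a diagonal term
  \<open>q ^ (2 * h) * card B\<close> and, for each pair in \<open>B\<close>, the sum of
  \<open>double_sum_bound\<close>. The first is later absorbed by the lower bound on
  \<open>card A * card B\<close>, the second by \<open>q ^ h \<le> card A\<close>.\<close>

lemma energy_le_large:
  fixes A B :: "('k ^ 'n::finite) set"
  assumes n: "CARD('n) = 2 * h" and j: "j \<noteq> 0" and A: "A \<subseteq> {a. qf a = j}"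
  shows "energy A B \<le> real (card A) * (real q ^ (2 * h) * real (card B) + 2 * real q ^ h * (real (card B))\<^sup>2)"
proof -
  define T where "T = (\<lambda>s. \<Sum>a | qf a = j. (norm (\<Sum>b\<in>B. \<psi> (s * qf b + dotp ((-2) *s (s *s b)) a)))\<^sup>2)"
  have "energy A B \<le> (\<Sum>s\<in>UNIV - {0}. real (card A) * T s)"
    unfolding energy_def
  proof (rule sum_mono)
    fix s :: 'k assume "s \<in> UNIV - {0}"
    have eq: "s * (qf b - 2 * dotp a b) = s * qf b + dotp ((-2) *s (s *s b)) a" for a b :: "'k ^ 'n"
      unfolding dotp_smult_left dotp_commute[of b a] by (simp add: algebra_simps)
    have "(norm (\<Sum>a\<in>A. \<Sum>b\<in>B. \<psi> (s * (qf b - 2 * dotp a b))))\<^sup>2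
       \<le> real (card A) * (\<Sum>a\<in>A. (norm (\<Sum>b\<in>B. \<psi> (s * (qf b - 2 * dotp a b))))\<^sup>2)"
      by (rule norm_sum_square_le_card)
    also have "\<dots> \<le> real (card A) * T s"
      unfolding T_def eq using A by (intro mult_left_mono sum_mono2) auto
    finally show "(norm (\<Sum>a\<in>A. \<Sum>b\<in>B. \<psi> (s * (qf b - 2 * dotp a b))))\<^sup>2 \<le> real (card A) * T s" .
  qed
  also have "\<dots> = real (card A) * (\<Sum>s\<in>UNIV - {0}. T s)" by (simp add: sum_distrib_left)
  also have "\<dots> \<le> real (card A) * (real q ^ (2 * h) * real (card B) + 2 * real q ^ h * (real (card B))\<^sup>2)"
  proof (rule mult_left_mono)
    define R where "R = (\<lambda>s. \<Sum>b\<in>B. \<Sum>b'\<in>B. \<Sum>r\<in>UNIV - {0}. \<psi> (s * (qf b - qf b') - r * j - s\<^sup>2 * qf (b - b') / r))"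
    have T: "of_real (real q * T s) = of_real (real q ^ (2 * h) * real (card B)) + gsq ^ h * R s" if s: "s \<noteq> 0" for s
    proof -
      have 1: "(\<Sum>b\<in>B. \<Sum>b'\<in>B. \<psi> (s * qf b - s * qf b') * (if (-2) *s (s *s b) = (-2) *s (s *s b') then of_nat q ^ CARD('n) else 0))
         = of_real (real q ^ (2 * h) * real (card B))"
      proof -
        have "(\<Sum>b\<in>B. \<Sum>b'\<in>B. \<psi> (s * qf b - s * qf b') * (if (-2) *s (s *s b) = (-2) *s (s *s b') then of_nat q ^ CARD('n) else 0))
          = (\<Sum>b\<in>B. \<Sum>b'\<in>B. if b' = b then of_nat q ^ CARD('n) else 0)"
          unfolding minus_two_inj smult_inj[OF s] by (intro sum.cong refl) auto
        then show ?thesis by (simp add: n)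
      qed
      have 2: "(\<Sum>b\<in>B. \<Sum>b'\<in>B. \<Sum>r\<in>UNIV - {0}. \<psi> (s * qf b - s * qf b' - r * j - qf ((-2) *s (s *s b) - (-2) *s (s *s b')) / (4 * r))) = R s"
        unfolding R_def qf_minus_two 
        by (intro sum.cong refl) (simp add: right_diff_distrib qf_smult flip: vector_ssub_ldistrib)
      show ?thesis
        unfolding T_def sphere_second_moment[OF n finite] 1 2 ..
    qed
    have "of_real (real q * (\<Sum>s\<in>UNIV - {0}. T s)) = (\<Sum>s\<in>UNIV - {0}. of_real (real q ^ (2 * h) * real (card B)) + gsq ^ h * R s)"
      unfolding sum_distrib_left of_real_sum using T by (intro sum.cong refl) auto
    also have "\<dots> = of_real (real (q - 1) * (real q ^ (2 * h) * real (card B))) + gsq ^ h * (\<Sum>s\<in>UNIV - {0}. R s)"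
      by (simp add: sum.distrib card_nonzero sum_distrib_left)
    finally have eq: "of_real (real q * (\<Sum>s\<in>UNIV - {0}. T s)) = complex_of_real (real (q - 1) * (real q ^ (2 * h) * real (card B))) + gsq ^ h * (\<Sum>s\<in>UNIV - {0}. R s)" .
    have "(\<Sum>s\<in>UNIV - {0}. R s) = (\<Sum>b\<in>B. \<Sum>b'\<in>B. \<Sum>s\<in>UNIV - {0}. \<Sum>r\<in>UNIV - {0}. \<psi> (s * (qf b - qf b') - r * j - s\<^sup>2 * qf (b - b') / r))"
      unfolding R_def by (rule sum_swap3)
    also have "norm \<dots> \<le> real (card B) * real (card B) * (2 * real q)"
      by (rule norm_sum_sum_le) (rule double_sum_bound[OF j])
    finally have R: "norm (\<Sum>s\<in>UNIV - {0}. R s) \<le> real (card B) * real (card B) * (2 * real q)" .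
    have "real q * (\<Sum>s\<in>UNIV - {0}. T s) \<le> norm (complex_of_real (real q * (\<Sum>s\<in>UNIV - {0}. T s)))"
      unfolding norm_of_real by (rule abs_ge_self)
    also have "\<dots> \<le> real (q - 1) * (real q ^ (2 * h) * real (card B)) + real q ^ h * norm (\<Sum>s\<in>UNIV - {0}. R s)"
      unfolding eq by (rule order.trans[OF norm_triangle_ineq]) (simp add: norm_mult norm_power norm_gsq)
    also have "\<dots> \<le> real q * (real q ^ (2 * h) * real (card B)) + real q ^ h * (real (card B) * real (card B) * (2 * real q))"
      by (intro add_mono mult_right_mono mult_left_mono R) auto
    also have "\<dots> = real q * (real q ^ (2 * h) * real (card B) + 2 * real q ^ h * (real (card B))\<^sup>2)"
      by (simp add: power2_eq_square algebra_simps)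
    finally show "(\<Sum>s\<in>UNIV - {0}. T s) \<le> real q ^ (2 * h) * real (card B) + 2 * real q ^ h * (real (card B))\<^sup>2"
      by (simp add: mult_le_cancel_left_pos)
  qed simp
  finally show ?thesis .
qed

end

section \<open>The energy of a small set\<close>

locale kloosterman_character = additive_character \<psi> q
  for \<psi> :: "'k::{finite,field} \<Rightarrow> complex" and q +
  assumes weil: "a \<noteq> 0 \<Longrightarrow> b \<noteq> 0 \<Longrightarrow> norm (\<Sum>x\<in>UNIV - {0}. \<psi> (a * x + b / x)) \<le> 2 * sqrt (real q)"
begin

text \<open>The off-diagonal part of the Gram matrix in the variable \<open>1 / s\<close>, up to
  phases and \<open>gsq ^ h\<close>; the value 0 at \<open>w = 0\<close> leaves the diagonal to be
  counted separately.\<close>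

definition pair_kernel :: "('k ^ 'n::finite) set \<Rightarrow> 'k \<Rightarrow> complex" where
  "pair_kernel A w = (if w = 0 then 0 else \<Sum>a\<in>A. \<Sum>a'\<in>A. \<psi> (- qf (a - a') / w))"

lemma pair_kernel_fourier:
  "(\<Sum>w\<in>UNIV. \<psi> (\<xi> * w) * pair_kernel A w) = (\<Sum>a\<in>A. \<Sum>a'\<in>A. \<Sum>w\<in>UNIV - {0}. \<psi> (\<xi> * w + - qf (a - a') / w))"
proof -
  have "(\<Sum>w\<in>UNIV. \<psi> (\<xi> * w) * pair_kernel A w) = (\<Sum>w\<in>UNIV - {0}. \<psi> (\<xi> * w) * pair_kernel A w)"
    by (rule sum.mono_neutral_right) (auto simp: pair_kernel_def)
  also have "\<dots> = (\<Sum>w\<in>UNIV - {0}. \<Sum>a\<in>A. \<Sum>a'\<in>A. \<psi> (\<xi> * w + - qf (a - a') / w))"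
    unfolding chi_add by (intro sum.cong refl) (simp add: pair_kernel_def sum_distrib_left)
  also have "\<dots> = (\<Sum>a\<in>A. \<Sum>a'\<in>A. \<Sum>w\<in>UNIV - {0}. \<psi> (\<xi> * w + - qf (a - a') / w))"
    by (rule sum_swap3)
  finally show ?thesis .
qed

text \<open>Once \<open>w\<close> is replaced by \<open>- 1 / w\<close>, the exponent
  \<open>w * qf (a - a')\<close> is affine in \<open>a\<close>, as both points lie on the sphere. So
  Cauchy-Schwarz over \<open>a\<close> and the second moment over the whole sphere apply, with
  \<open>A\<close> times the nonzero scalars as index set.\<close>

lemma pair_kernel_fourier_zero:
  fixes A :: "('k ^ 'n::finite) set"
  assumes n: "CARD('n) = 2 * h" and j: "j \<noteq> 0" and A: "A \<subseteq> {a. qf a = j}"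
    and small: "real (card A) \<le> real q ^ h"
  shows "norm (\<Sum>w\<in>UNIV. \<psi> (0 * w) * pair_kernel A w) \<le> 2 * real (card A) * real q ^ h"
proof -
  define I where "I = A \<times> (UNIV - {0 :: 'k})"
  define \<theta> where "\<theta> = (\<lambda>i :: ('k ^ 'n) \<times> 'k. 2 * j * snd i)"
  define v where "v = (\<lambda>i :: ('k ^ 'n) \<times> 'k. (-2) *s (snd i *s fst i))"
  define T where "T = (\<Sum>a | qf a = j. (norm (\<Sum>i\<in>I. \<psi> (\<theta> i + dotp (v i) a)))\<^sup>2)"
  define V where "V = (\<Sum>w\<in>UNIV. \<psi> (0 * w) * pair_kernel A w)"
  have qfA: "qf a = j" if "a \<in> A" for a using A that by auto
  have "V = (\<Sum>a\<in>A. \<Sum>i\<in>I. \<psi> (\<theta> i + dotp (v i) a))"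
    unfolding V_def pair_kernel_fourier I_def sum.cartesian_product'
  proof (rule sum.cong[OF refl], rule sum.cong[OF refl])
    fix a a' assume a: "a \<in> A" "a' \<in> A"
    have "(\<Sum>w\<in>UNIV - {0}. \<psi> (0 * w + - qf (a - a') / w)) = (\<Sum>w\<in>UNIV - {0}. \<psi> (w * qf (a - a')))"
      by (rule sum.reindex_bij_witness[of _ "\<lambda>w. - 1 / w" "\<lambda>w. - 1 / w"]) auto
    also have "\<dots> = (\<Sum>w\<in>UNIV - {0}. \<psi> (\<theta> (a', w) + dotp (v (a', w)) a))"
      unfolding \<theta>_def v_def fst_conv snd_conv dotp_smult_left qf_diff qfA[OF a(1)] qfA[OF a(2)] dotp_commute[of a' a]
      by (intro sum.cong refl) (simp add: algebra_simps)
    finally show "(\<Sum>w\<in>UNIV - {0}. \<psi> (0 * w + - qf (a - a') / w)) = (\<Sum>w\<in>UNIV - {0}. \<psi> (\<theta> (a', w) + dotp (v (a', w)) a))" .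
  qed
  then have "(norm V)\<^sup>2 \<le> real (card A) * (\<Sum>a\<in>A. (norm (\<Sum>i\<in>I. \<psi> (\<theta> i + dotp (v i) a)))\<^sup>2)"
    by (simp only: norm_sum_square_le_card)
  also have "\<dots> \<le> real (card A) * T"
    unfolding T_def using A by (intro mult_left_mono sum_mono2) auto
  finally have V: "(norm V)\<^sup>2 \<le> real (card A) * T" .
  define D where "D = (\<Sum>i\<in>I. \<Sum>i'\<in>I. \<psi> (\<theta> i - \<theta> i') * (if v i = v i' then of_nat q ^ CARD('n) else 0))"
  define R where "R = (\<Sum>i\<in>I. \<Sum>i'\<in>I. \<Sum>r\<in>UNIV - {0}. \<psi> (\<theta> i - \<theta> i' - r * j - qf (v i - v i') / (4 * r)))"
  have eq: "of_real (real q * T) = D + gsq ^ h * R"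
    unfolding T_def D_def R_def by (rule sphere_second_moment[OF n finite])
  have D: "norm D \<le> 2 * real q * real (card A) * real q ^ (2 * h)"
  proof -
    have row: "norm (\<Sum>i'\<in>I. \<psi> (\<theta> i - \<theta> i') * (if v i = v i' then of_nat q ^ CARD('n) else 0)) \<le> 2 * real q ^ (2 * h)"
      if i: "i \<in> I" for i
    proof -
      obtain a w where aw: "i = (a, w)" "a \<in> A" "w \<noteq> 0" using i by (auto simp: I_def)
      \<comment> \<open>Applying \<open>qf\<close> to \<open>w *s a = w' *s a'\<close> gives
        \<open>w^2 = w'^2\<close>, hence at most two indices share a frequency.\<close>
      have sub: "{i' \<in> I. v i = v i'} \<subseteq> {(a, w), (- a, - w)}"
      proof
        fix i' assume i': "i' \<in> {i' \<in> I. v i = v i'}"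
        obtain a' w' where i'_eq: "i' = (a', w')" by (cases i')
        have w': "w' \<noteq> 0" "a' \<in> A" using i' by (auto simp: I_def i'_eq)
        have e: "w *s a = w' *s a'" using i' two_nz unfolding v_def aw i'_eq by (simp add: minus_two_inj)
        then have "qf (w *s a) = qf (w' *s a')" by simp
        then have "w\<^sup>2 * j = w'\<^sup>2 * j" by (simp add: qf_smult qfA aw w')
        then have "w\<^sup>2 = w'\<^sup>2" using j by simp
        then consider "w' = w" | "w' = - w" by (metis power2_eq_iff)
        then show "i' \<in> {(a, w), (- a, - w)}"
        proof cases
          case 1
          then show ?thesis using e w' by (simp add: smult_inj i'_eq)
        next
          case 2
          then have "w' *s a' = w' *s (- a)" using e by (simp add: vec_eq_iff)
          then show ?thesis using 2 w' by (simp add: smult_inj i'_eq)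
        qed
      qed
      have "norm (\<Sum>i'\<in>I. \<psi> (\<theta> i - \<theta> i') * (if v i = v i' then of_nat q ^ CARD('n) else 0))
        \<le> (\<Sum>i'\<in>I. if v i = v i' then real q ^ (2 * h) else 0)"
        by (rule sum_norm_le) (simp add: norm_mult chi_norm norm_power n)
      also have "\<dots> = real (card {i' \<in> I. v i = v i'}) * real q ^ (2 * h)"
        by (simp add: sum.If_cases Int_def)
      also have "card {i' \<in> I. v i = v i'} \<le> card {(a, w), (- a, - w)}"
        by (intro card_mono sub) auto
      then have "real (card {i' \<in> I. v i = v i'}) * real q ^ (2 * h) \<le> 2 * real q ^ (2 * h)"
        using card_insert_le_m1[of 2 "{(- a, - w)}" "(a, w)"] by (intro mult_right_mono) auto
      finally show ?thesis .
    qed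
    have "norm D \<le> (\<Sum>i\<in>I. 2 * real q ^ (2 * h))" unfolding D_def by (intro sum_norm_le row)
    also have "\<dots> = real (card A) * real (q - 1) * (2 * real q ^ (2 * h))"
      by (simp add: I_def card_cartesian_product card_nonzero)
    also have "\<dots> \<le> real (card A) * real q * (2 * real q ^ (2 * h))"
      by (intro mult_right_mono mult_left_mono) auto
    finally show ?thesis by (simp add: mult_ac)
  qed
  have R: "norm R \<le> real (card A) * real (card A) * (2 * real q)"
  proof -
    have "R = (\<Sum>a\<in>A. \<Sum>w\<in>UNIV - {0}. \<Sum>a'\<in>A. \<Sum>w'\<in>UNIV - {0}. \<Sum>r\<in>UNIV - {0}.
        \<psi> (2 * j * w - 2 * j * w' - r * j - (j * (w - w')\<^sup>2 + w * w' * qf (a - a')) / r))"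
      unfolding R_def I_def sum.cartesian_product' \<theta>_def v_def fst_conv snd_conv qf_minus_two
      by (intro sum.cong refl) (simp add: qf_comb qfA)
    also have "\<dots> = (\<Sum>a\<in>A. \<Sum>a'\<in>A. \<Sum>w\<in>UNIV - {0}. \<Sum>w'\<in>UNIV - {0}. \<Sum>r\<in>UNIV - {0}.
        \<psi> (2 * j * w - 2 * j * w' - r * j - (j * (w - w')\<^sup>2 + w * w' * qf (a - a')) / r))"
      by (intro sum.cong refl sum.swap)
    also have "norm \<dots> \<le> real (card A) * real (card A) * (2 * real q)"
      by (intro norm_sum_sum_le triple_sum_bound j)
    finally show ?thesis .
  qed
  have "real q * T \<le> norm (complex_of_real (real q * T))" unfolding norm_of_real by (rule abs_ge_self)
  also have "\<dots> \<le> norm D + real q ^ h * norm R"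
    unfolding eq by (rule order.trans[OF norm_triangle_ineq]) (simp add: norm_mult norm_power norm_gsq)
  also have "\<dots> \<le> 2 * real q * real (card A) * real q ^ (2 * h) + real q ^ h * (real (card A) * real (card A) * (2 * real q))"
    by (intro add_mono mult_left_mono R D) auto
  also have "\<dots> = real q * (2 * real (card A) * real q ^ h * (real q ^ h + real (card A)))"
  proof -
    have q2: "real q ^ (2 * h) = real q ^ h * real q ^ h" by (simp add: mult_2 power_add)
    show ?thesis unfolding q2 by (simp add: algebra_simps)
  qed
  finally have "T \<le> 2 * real (card A) * real q ^ h * (real q ^ h + real (card A))"
    by (simp add: mult_le_cancel_left_pos)
  also have "\<dots> \<le> 2 * real (card A) * real q ^ h * (real q ^ h + real q ^ h)"
    using small by (intro mult_left_mono add_left_mono) auto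
  finally have T: "T \<le> 2 * real (card A) * real q ^ h * (real q ^ h + real q ^ h)" .
  have "(norm V)\<^sup>2 \<le> real (card A) * (2 * real (card A) * real q ^ h * (real q ^ h + real q ^ h))"
    by (rule order.trans[OF V]) (intro mult_left_mono T, simp)
  also have "\<dots> = (2 * real (card A) * real q ^ h)\<^sup>2" by (simp add: power2_eq_square algebra_simps)
  finally show ?thesis unfolding V_def by (rule power2_le_imp_le) simp
qed

text \<open>For nonzero \<open>\<xi>\<close> each pair costs at most \<open>2 * sqrt q\<close>: by
  Weil, or because the sum is \<open>- 1\<close> when \<open>qf (a - a') = 0\<close>. The size
  assumption brings the total down to the bound known at frequency zero.\<close>

lemma pair_kernel_fourier_bound:
  fixes A :: "('k ^ 'n::finite) set"
  assumes n: "CARD('n) = 2 * h" and j: "j \<noteq> 0" and A: "A \<subseteq> {a. qf a = j}"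
    and small: "real (card A) * sqrt (real q) \<le> real q ^ h"
  shows "norm (\<Sum>w\<in>UNIV. \<psi> (\<xi> * w) * pair_kernel A w) \<le> 2 * real (card A) * real q ^ h"
proof (cases "\<xi> = 0")
  case True
  have "1 \<le> sqrt (real q)" using q_ge_1 by simp
  then have "real (card A) * 1 \<le> real (card A) * sqrt (real q)" by (intro mult_left_mono) auto
  then have "real (card A) \<le> real q ^ h" using small by linarith
  then show ?thesis unfolding True by (rule pair_kernel_fourier_zero[OF n j A])
next
  case False
  have "norm (\<Sum>w\<in>UNIV. \<psi> (\<xi> * w) * pair_kernel A w) \<le> real (card A) * real (card A) * (2 * sqrt (real q))"
    unfolding pair_kernel_fourier
  proof (rule norm_sum_sum_le)
    fix a a'
    show "norm (\<Sum>w\<in>UNIV - {0}. \<psi> (\<xi> * w + - qf (a - a') / w)) \<le> 2 * sqrt (real q)"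
    proof (cases "qf (a - a') = 0")
      case True
      have "1 \<le> sqrt (real q)" using q_ge_1 by simp
      moreover have "norm (\<Sum>w\<in>UNIV - {0}. \<psi> (\<xi> * w + - qf (a - a') / w)) = 1"
        using True False by (simp add: chi_lin_sum_nz)
      ultimately show ?thesis by linarith
    next
      case nz: False
      then show ?thesis using False by (intro weil) auto
    qed
  qed
  also have "\<dots> = 2 * real (card A) * (real (card A) * sqrt (real q))" by simp
  also have "\<dots> \<le> 2 * real (card A) * real q ^ h" by (intro mult_left_mono small) auto
  finally show ?thesis .
qed

lemma gram_sum:
  fixes A :: "('k ^ 'n::finite) set"
  assumes n: "CARD('n) = 2 * h" and A: "A \<subseteq> {a. qf a = j}" and s: "s \<noteq> 0" "s' \<noteq> 0"
  shows "(\<Sum>b\<in>UNIV. (\<Sum>a\<in>A. \<psi> (s * (qf b - 2 * dotp a b))) * cnj (\<Sum>a\<in>A. \<psi> (s' * (qf b - 2 * dotp a b))))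
    = (if s = s' then of_nat q ^ (2 * h) * of_nat (card A) else 0)
      + gsq ^ h * (\<psi> (- j * s) * cnj (\<psi> (- j * s')) * pair_kernel A (1 / s' - 1 / s))"
proof -
  have qfA: "qf a = j" if "a \<in> A" for a using A that by auto
  have arg: "s * (qf b - 2 * dotp a b) - s' * (qf b - 2 * dotp a' b)
      = (s - s') * qf b + dotp ((-2) *s (s *s a - s' *s a')) b" for a a' b :: "'k ^ 'n"
    unfolding dotp_smult_left dotp_diff_left by (simp add: algebra_simps)
  have "(\<Sum>b\<in>UNIV. (\<Sum>a\<in>A. \<psi> (s * (qf b - 2 * dotp a b))) * cnj (\<Sum>a\<in>A. \<psi> (s' * (qf b - 2 * dotp a b))))
      = (\<Sum>b\<in>UNIV. \<Sum>a\<in>A. \<Sum>a'\<in>A. \<psi> ((s - s') * qf b + dotp ((-2) *s (s *s a - s' *s a')) b))"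
    unfolding arg[symmetric] chi_diff by (simp add: sum_product)
  also have "\<dots> = (\<Sum>a\<in>A. \<Sum>a'\<in>A. \<Sum>b\<in>UNIV. \<psi> ((s - s') * qf b + dotp ((-2) *s (s *s a - s' *s a')) b))"
    by (rule sum_swap3)
  also have "\<dots> = (if s = s' then of_nat q ^ (2 * h) * of_nat (card A) else 0)
      + gsq ^ h * (\<psi> (- j * s) * cnj (\<psi> (- j * s')) * pair_kernel A (1 / s' - 1 / s))"
  proof (cases "s = s'")
    case True
    have "(-2) *s (s' *s a - s' *s a') = 0 \<longleftrightarrow> a' = a" for a a' :: "'k ^ 'n"
      using two_nz s(2) by (auto simp: vec_eq_iff)
    then have "(\<Sum>a\<in>A. \<Sum>a'\<in>A. \<Sum>b\<in>UNIV. \<psi> ((s - s') * qf b + dotp ((-2) *s (s *s a - s' *s a')) b))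
       = (\<Sum>a\<in>A. \<Sum>a'\<in>A. if a' = a then of_nat q ^ (2 * h) else 0)"
      unfolding True by (intro sum.cong refl) (simp add: chi_dotp_sum n)
    then show ?thesis using True by (simp add: pair_kernel_def)
  next
    case False
    have w: "1 / s' - 1 / s \<noteq> 0" using False s by (simp add: field_simps)
    have inner: "(\<Sum>b\<in>UNIV. \<psi> ((s - s') * qf b + dotp ((-2) *s (s *s a - s' *s a')) b))
       = gsq ^ h * (\<psi> (- j * s) * cnj (\<psi> (- j * s')) * \<psi> (- qf (a - a') / (1 / s' - 1 / s)))" if a: "a \<in> A" "a' \<in> A" for a a'
    proof -
      have "- qf ((-2) *s (s *s a - s' *s a')) / (4 * (s - s')) = - (j * (s - s')\<^sup>2 + s * s' * qf (a - a')) / (s - s')"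
      proof -
        have "qf ((-2) *s (s *s a - s' *s a')) = 4 * (j * (s - s')\<^sup>2 + s * s' * qf (a - a'))"
          unfolding qf_smult qf_comb[OF qfA[OF a(1)] qfA[OF a(2)]] by simp
        moreover have "- (4 * x) / (4 * y) = - x / y" for x y :: 'k
          using mult_divide_mult_cancel_left[OF four_nz, of "- x" y] by simp
        ultimately show ?thesis by (simp only:)
      qed
      also have "\<dots> = - j * s - (- j * s') + - qf (a - a') / (1 / s' - 1 / s)"
      proof -
        \<comment> \<open>The term with \<open>j\<close> loses one factor \<open>s - s'\<close> and
          splits into two phases; \<open>s * s' / (s - s')\<close> is the reciprocal of
          \<open>1 / s' - 1 / s\<close>.\<close>
        have "- (j * (s - s')\<^sup>2 + s * s' * t) / (s - s') = - j * s - (- j * s') + - t / (1 / s' - 1 / s)" for t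
        proof -
          have "1 / s' - 1 / s = (s - s') / (s * s')" using s by (simp add: field_simps)
          then have "- t / (1 / s' - 1 / s) = - (s * s' * t) / (s - s')" by simp
          moreover have "- (j * (s - s')\<^sup>2 + s * s' * t) / (s - s') = - (j * (s - s')) + - (s * s' * t) / (s - s')"
            using False by (simp add: power2_eq_square add_divide_distrib diff_divide_distrib)
          ultimately show ?thesis by (simp add: algebra_simps)
        qed
        then show ?thesis .
      qed
      finally have e: "- qf ((-2) *s (s *s a - s' *s a')) / (4 * (s - s')) = - j * s - (- j * s') + - qf (a - a') / (1 / s' - 1 / s)" .
      have "s - s' \<noteq> 0" using False by simp
      show ?thesis unfolding chi_quadratic_sum[OF \<open>s - s' \<noteq> 0\<close> n] e
        by (simp only: chi_add chi_diff)
    qed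
    show ?thesis using False w by (simp add: inner pair_kernel_def sum_distrib_left mult.assoc)
  qed
  finally show ?thesis .
qed

text \<open>Duality: \<open>E\<close> is the sum over \<open>B\<close> of \<open>g\<close>, the
  combination of the functions \<open>f s\<close> with weights \<open>c s\<close>. Cauchy-Schwarz,
  extended to all \<open>b\<close>, bounds \<open>E^2\<close> by \<open>card B\<close> times the
  Gram form, which is at most \<open>3 * card A * q ^ (2 * h) * E\<close>; one factor
  \<open>E\<close> cancels. The 3 is 1 from the diagonal plus 2 from
  \<open>toeplitz_bound\<close>.\<close>

lemma energy_le_small:
  fixes A B :: "('k ^ 'n::finite) set"
  assumes n: "CARD('n) = 2 * h" and j: "j \<noteq> 0" and A: "A \<subseteq> {a. qf a = j}"
    and small: "real (card A) * sqrt (real q) \<le> real q ^ h"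
  shows "energy A B \<le> 3 * real (card A) * real (card B) * real q ^ (2 * h)"
proof -
  define f where "f = (\<lambda>s b. \<Sum>a\<in>A. \<psi> (s * (qf b - 2 * dotp a b)))"
  define c where "c = (\<lambda>s. cnj (\<Sum>b\<in>B. f s b))"
  define g where "g = (\<lambda>b. \<Sum>s\<in>UNIV - {0}. c s * f s b)"
  define E where "E = energy A B"
  have E: "E = (\<Sum>s\<in>UNIV - {0}. (norm (c s))\<^sup>2)"
    unfolding E_def energy_def c_def f_def complex_mod_cnj by (subst sum.swap) (rule refl)
  have E0: "E \<ge> 0" unfolding E by (intro sum_nonneg) auto
  have "complex_of_real E = (\<Sum>s\<in>UNIV - {0}. c s * (\<Sum>b\<in>B. f s b))"
    unfolding E of_real_sum complex_norm_square by (simp add: c_def)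
  also have "\<dots> = (\<Sum>b\<in>B. g b)"
    unfolding g_def sum_distrib_left by (rule sum.swap)
  finally have "complex_of_real E = (\<Sum>b\<in>B. g b)" .
  then have "E\<^sup>2 = (norm (\<Sum>b\<in>B. g b))\<^sup>2" by (metis norm_of_real power2_abs)
  also have "\<dots> \<le> real (card B) * (\<Sum>b\<in>B. (norm (g b))\<^sup>2)" by (rule norm_sum_square_le_card)
  also have "\<dots> \<le> real (card B) * (\<Sum>b\<in>UNIV. (norm (g b))\<^sup>2)"
    by (intro mult_left_mono sum_mono2) auto
  finally have E2: "E\<^sup>2 \<le> real (card B) * (\<Sum>b\<in>UNIV. (norm (g b))\<^sup>2)" .
  \<comment> \<open>The weights in the variable \<open>u = 1 / s\<close>, with the phase of
    \<open>gram_sum\<close> absorbed and the value 0 at the missing point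
    \<open>u = 0\<close>.\<close>
  define d where "d = (\<lambda>u. if u = 0 then 0 else c (1 / u) * \<psi> (- j * (1 / u)))"
  have gsum: "complex_of_real (\<Sum>b\<in>UNIV. (norm (g b))\<^sup>2)
      = of_real (real q ^ (2 * h) * real (card A) * E)
        + gsq ^ h * (\<Sum>u\<in>UNIV. \<Sum>u'\<in>UNIV. d u * cnj (d u') * pair_kernel A (u' - u))"
  proof -
    have "complex_of_real (\<Sum>b\<in>UNIV. (norm (g b))\<^sup>2)
       = (\<Sum>b\<in>UNIV. \<Sum>s\<in>UNIV - {0}. \<Sum>s'\<in>UNIV - {0}. c s * cnj (c s') * (f s b * cnj (f s' b)))"
      unfolding g_def of_real_sum norm_square_sum_expand by (simp add: mult_ac)
    also have "\<dots> = (\<Sum>s\<in>UNIV - {0}. \<Sum>s'\<in>UNIV - {0}. c s * cnj (c s') * (\<Sum>b\<in>UNIV. f s b * cnj (f s' b)))"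
      unfolding sum_distrib_left by (rule sum_swap3)
    also have "\<dots> = (\<Sum>s\<in>UNIV - {0}. \<Sum>s'\<in>UNIV - {0}. (if s' = s then c s * cnj (c s) * (of_nat q ^ (2 * h) * of_nat (card A)) else 0)
        + gsq ^ h * ((c s * \<psi> (- j * s)) * cnj (c s' * \<psi> (- j * s')) * pair_kernel A (1 / s' - 1 / s)))"
      unfolding f_def by (intro sum.cong refl) (subst gram_sum[OF n A], auto simp: algebra_simps)
    also have "\<dots> = (\<Sum>s\<in>UNIV - {0}. c s * cnj (c s) * (of_nat q ^ (2 * h) * of_nat (card A)))
        + gsq ^ h * (\<Sum>s\<in>UNIV - {0}. \<Sum>s'\<in>UNIV - {0}. (c s * \<psi> (- j * s)) * cnj (c s' * \<psi> (- j * s')) * pair_kernel A (1 / s' - 1 / s))"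
      by (simp add: sum.distrib sum_distrib_left)
    also have "(\<Sum>s\<in>UNIV - {0}. c s * cnj (c s) * (of_nat q ^ (2 * h) * of_nat (card A))) = of_real (real q ^ (2 * h) * real (card A) * E)"
    proof -
      have "complex_of_real E = (\<Sum>s\<in>UNIV - {0}. c s * cnj (c s))"
        unfolding E of_real_sum complex_norm_square ..
      then show ?thesis unfolding sum_distrib_right[symmetric] by (simp add: mult_ac)
    qed
    also have "(\<Sum>s\<in>UNIV - {0}. \<Sum>s'\<in>UNIV - {0}. (c s * \<psi> (- j * s)) * cnj (c s' * \<psi> (- j * s')) * pair_kernel A (1 / s' - 1 / s))
        = (\<Sum>u\<in>UNIV - {0}. \<Sum>u'\<in>UNIV - {0}. d u * cnj (d u') * pair_kernel A (u' - u))"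
    proof (rule sum.reindex_bij_witness[of _ "\<lambda>u. 1 / u" "\<lambda>s. 1 / s"])
      fix s :: 'k assume s: "s \<in> UNIV - {0}"
      show "(\<Sum>u'\<in>UNIV - {0}. d (1 / s) * cnj (d u') * pair_kernel A (u' - 1 / s))
        = (\<Sum>s'\<in>UNIV - {0}. (c s * \<psi> (- j * s)) * cnj (c s' * \<psi> (- j * s')) * pair_kernel A (1 / s' - 1 / s))"
        by (rule sum.reindex_bij_witness[of _ "\<lambda>u. 1 / u" "\<lambda>s. 1 / s"]) (use s in \<open>auto simp: d_def\<close>)
    qed auto
    also have "\<dots> = (\<Sum>u\<in>UNIV. \<Sum>u'\<in>UNIV. d u * cnj (d u') * pair_kernel A (u' - u))"
    proof -
      have "(\<Sum>u'\<in>UNIV - {0}. d u * cnj (d u') * pair_kernel A (u' - u)) = (\<Sum>u'\<in>UNIV. d u * cnj (d u') * pair_kernel A (u' - u))" for u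
        by (rule sum.mono_neutral_left) (auto simp: d_def)
      then have "(\<Sum>u\<in>UNIV - {0}. \<Sum>u'\<in>UNIV - {0}. d u * cnj (d u') * pair_kernel A (u' - u))
         = (\<Sum>u\<in>UNIV - {0}. \<Sum>u'\<in>UNIV. d u * cnj (d u') * pair_kernel A (u' - u))" by simp
      also have "\<dots> = (\<Sum>u\<in>UNIV. \<Sum>u'\<in>UNIV. d u * cnj (d u') * pair_kernel A (u' - u))"
        by (rule sum.mono_neutral_left) (auto simp: d_def)
      finally show ?thesis .
    qed
    finally show ?thesis .
  qed
  have dE: "(\<Sum>u\<in>UNIV. (norm (d u))\<^sup>2) = E"
  proof -
    have "(\<Sum>u\<in>UNIV. (norm (d u))\<^sup>2) = (\<Sum>u\<in>UNIV - {0}. (norm (d u))\<^sup>2)"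
      by (rule sum.mono_neutral_right) (auto simp: d_def)
    also have "\<dots> = E" unfolding E
      by (rule sum.reindex_bij_witness[of _ "\<lambda>u. 1 / u" "\<lambda>s. 1 / s"]) (auto simp: d_def norm_mult chi_norm)
    finally show ?thesis .
  qed
  have top: "norm (\<Sum>u\<in>UNIV. \<Sum>u'\<in>UNIV. d u * cnj (d u') * pair_kernel A (u' - u)) \<le> 2 * real (card A) * real q ^ h * E"
    using toeplitz_bound[of "pair_kernel A" "2 * real (card A) * real q ^ h" d] pair_kernel_fourier_bound[OF n j A small]
    unfolding dE by blast
  have "(\<Sum>b\<in>UNIV. (norm (g b))\<^sup>2) \<le> norm (complex_of_real (\<Sum>b\<in>UNIV. (norm (g b))\<^sup>2))"
    unfolding norm_of_real by (rule abs_ge_self)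
  also have "\<dots> \<le> real q ^ (2 * h) * real (card A) * E
      + real q ^ h * norm (\<Sum>u\<in>UNIV. \<Sum>u'\<in>UNIV. d u * cnj (d u') * pair_kernel A (u' - u))"
    unfolding gsum using E0 by (intro order.trans[OF norm_triangle_ineq]) (simp add: norm_mult norm_power norm_gsq)
  also have "\<dots> \<le> real q ^ (2 * h) * real (card A) * E + real q ^ h * (2 * real (card A) * real q ^ h * E)"
    by (intro add_left_mono mult_left_mono top) auto
  also have "\<dots> = 3 * real (card A) * real q ^ (2 * h) * E"
  proof -
    have "real q ^ (2 * h) = real q ^ h * real q ^ h" by (simp add: mult_2 power_add)
    then show ?thesis by simp
  qed
  finally have "E\<^sup>2 \<le> real (card B) * (3 * real (card A) * real q ^ (2 * h) * E)"
    by (intro order.trans[OF E2] mult_left_mono) auto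
  then have EE: "E * E \<le> (3 * real (card A) * real (card B) * real q ^ (2 * h)) * E"
    by (simp add: power2_eq_square mult_ac)
  have "E \<le> 3 * real (card A) * real (card B) * real q ^ (2 * h)"
  proof (cases "E = 0")
    case False
    then have "E > 0" using E0 by simp
    then show ?thesis by (rule mult_right_le_imp_le[OF EE])
  qed simp
  then show ?thesis by (simp add: E_def)
qed

end

section \<open>From energy to the number of distances\<close>

lemma (in additive_character) distance_energy:
  fixes A B :: "('k ^ 'n::finite) set"
  assumes A: "A \<subseteq> {a. qf a = j}"
  shows "real q * (real (card A) * real (card B))\<^sup>2
    \<le> real (card (dist_set A B)) * ((real (card A) * real (card B))\<^sup>2 + energy A B)"
proof -
  define d where "d = (\<lambda>z :: ('k ^ 'n) \<times> ('k ^ 'n). sqdist (fst z) (snd z))"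
  define \<nu> where "\<nu> = (\<lambda>t. card {z \<in> A \<times> B. d z = t})"
  have im: "d ` (A \<times> B) = dist_set A B" by (force simp: d_def dist_set_def)
  have qfd: "sqdist a b = j + (qf b - 2 * dotp a b)" if "a \<in> A" for a b
  proof -
    have "sqdist a b = qf (a - b)" by (simp add: sqdist_def qf_def dotp_def power2_eq_square)
    moreover have "qf a = j" using A that by auto
    ultimately show ?thesis by (simp add: qf_diff)
  qed
  have fin: "finite (A \<times> B)" "finite (dist_set A B)" by auto
  have "card A * card B = card (A \<times> B)" by (simp add: card_cartesian_product)
  also have "\<dots> = (\<Sum>t\<in>dist_set A B. \<nu> t)"
    using sum.group[OF fin(1,2), of d "\<lambda>_. 1::nat"] im by (simp add: \<nu>_def)
  finally have "real (card A) * real (card B) = (\<Sum>t\<in>dist_set A B. real (\<nu> t))"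
    by (metis of_nat_mult of_nat_sum)
  then have "(real (card A) * real (card B))\<^sup>2 \<le> (\<Sum>t\<in>dist_set A B. (real (\<nu> t))\<^sup>2) * card (dist_set A B)"
    by (simp only: sum_squared_le_sum_of_squares)
  also have "\<dots> \<le> (\<Sum>t\<in>UNIV. (real (\<nu> t))\<^sup>2) * card (dist_set A B)"
    by (intro mult_right_mono sum_mono2) auto
  finally have 1: "real q * (real (card A) * real (card B))\<^sup>2
      \<le> real (card (dist_set A B)) * (real q * (\<Sum>t\<in>UNIV. (real (\<nu> t))\<^sup>2))"
    using mult_left_mono[of _ _ "real q"] by (simp add: mult_ac)
  \<comment> \<open>The common factor \<open>\<psi> (s * j)\<close> has modulus one, which is why
    \<open>energy\<close> can omit it.\<close>
  have tr: "(\<Sum>t\<in>UNIV. of_nat (\<nu> t) * \<psi> (s * t)) = \<psi> (s * j) * (\<Sum>a\<in>A. \<Sum>b\<in>B. \<psi> (s * (qf b - 2 * dotp a b)))" for s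
  proof -
    have "(\<Sum>t\<in>UNIV. of_nat (\<nu> t) * \<psi> (s * t)) = (\<Sum>t\<in>UNIV. \<Sum>z\<in>{z \<in> A \<times> B. d z = t}. \<psi> (s * d z))"
      unfolding \<nu>_def by (intro sum.cong refl) simp
    also have "\<dots> = (\<Sum>z\<in>A \<times> B. \<psi> (s * d z))" by (rule sum.group) auto
    also have "\<dots> = (\<Sum>a\<in>A. \<Sum>b\<in>B. \<psi> (s * j) * \<psi> (s * (qf b - 2 * dotp a b)))"
      unfolding sum.cartesian_product' d_def fst_conv snd_conv
      by (intro sum.cong refl) (simp add: qfd distrib_left chi_add)
    finally show ?thesis by (simp add: sum_distrib_left)
  qed
  \<comment> \<open>By Parseval the second moment of \<open>\<nu>\<close> splits into frequency 0,
    the squared number of pairs, and the remaining frequencies, which make up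
    \<open>energy\<close>.\<close>
  have "real q * (\<Sum>t\<in>UNIV. (real (\<nu> t))\<^sup>2) = (\<Sum>s\<in>UNIV. (norm (\<Sum>t\<in>UNIV. of_nat (\<nu> t) * \<psi> (s * t)))\<^sup>2)"
    using parseval[of "\<lambda>t. of_nat (\<nu> t)"] by simp
  also have "\<dots> = (\<Sum>s\<in>UNIV. (norm (\<Sum>a\<in>A. \<Sum>b\<in>B. \<psi> (s * (qf b - 2 * dotp a b))))\<^sup>2)"
    unfolding tr by (simp add: norm_mult chi_norm)
  also have "\<dots> = (real (card A) * real (card B))\<^sup>2 + energy A B"
    unfolding energy_def by (subst sum.remove[of _ 0]) (auto simp: norm_mult)
  finally show ?thesis using 1 by simp
qed

text \<open>In both alternatives \<open>q ^ (2 * h) \<le> N\<close> brings the energy below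
  \<open>3 * N^2\<close>; with the term \<open>N^2\<close> of frequency zero this makes the constant
  4.\<close>

lemma (in kloosterman_character) card_dist_set_ge:
  fixes A B :: "('k ^ 'n::finite) set"
  assumes n: "CARD('n) = 2 * h" and j: "j \<noteq> 0" and A: "A \<subseteq> {a. qf a = j}"
    and size: "16 * real q ^ (2 * h) \<le> real (card A) * real (card B)"
    and alt: "real (card A) * sqrt (real q) \<le> real q ^ h \<or> real q ^ h \<le> real (card A)"
  shows "real q \<le> 4 * real (card (dist_set A B))"
proof -
  define N where "N = real (card A) * real (card B)"
  have q0: "real q ^ (2 * h) > 0" by simp
  then have N: "N > 0" using size unfolding N_def by linarith
  have "energy A B \<le> 3 * N\<^sup>2"
    using alt
  proof
    assume "real (card A) * sqrt (real q) \<le> real q ^ h"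
    then have "energy A B \<le> 3 * N * real q ^ (2 * h)"
      using energy_le_small[OF n j A] by (simp add: N_def mult.assoc)
    also have "\<dots> \<le> 3 * N * N"
      using size q0 N unfolding N_def[symmetric] by (intro mult_left_mono) auto
    finally show ?thesis by (simp add: power2_eq_square)
  next
    assume big: "real q ^ h \<le> real (card A)"
    have "energy A B \<le> real (card A) * (real q ^ (2 * h) * real (card B) + 2 * real q ^ h * (real (card B))\<^sup>2)"
      by (rule energy_le_large[OF n j A])
    also have "\<dots> = N * real q ^ (2 * h) + 2 * (N * real (card B)) * real q ^ h"
      by (simp add: N_def power2_eq_square algebra_simps)
    also have "\<dots> \<le> N * N + 2 * (N * real (card B)) * real (card A)"
      using size q0 N big unfolding N_def[symmetric] by (intro add_mono mult_left_mono) auto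
    also have "\<dots> = 3 * N\<^sup>2" by (simp add: N_def power2_eq_square)
    finally show ?thesis .
  qed
  then have "real (card (dist_set A B)) * (N\<^sup>2 + energy A B) \<le> real (card (dist_set A B)) * (4 * N\<^sup>2)"
    by (intro mult_left_mono) auto
  then have "real q * N\<^sup>2 \<le> (4 * real (card (dist_set A B))) * N\<^sup>2"
    using distance_energy[OF A, of B] by (simp add: N_def)
  then show ?thesis using N by (simp add: mult_le_cancel_right)
qed

theorem theorem1p20:
  fixes j :: "'k::{finite,field}"
    and A B :: "('k ^ 'n::finite) set"
  assumes q_pow: "\<exists>p m. prime p \<and> odd p \<and> m \<ge> 1 \<and> CARD('k) = p ^ m"
    and d_even: "even CARD('n)" and d_ge: "CARD('n) \<ge> 4"
    and j_nz: "j \<noteq> 0"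
    and A_sub: "A \<subseteq> sphere_j j"
    and size: "card A * card B \<ge> 16 * CARD('k) ^ CARD('n)"
    and alt: "real (card A) \<le> real CARD('k) powr ((real CARD('n) - 1) / 2)
              \<or> real (card A) \<ge> real CARD('k) powr (real CARD('n) / 2)"
  shows "real (card (dist_set A B)) \<ge> real CARD('k) / 144"
proof -
  obtain p m where p: "prime p" "odd p" "m \<ge> 1" "CARD('k) = p ^ m" using q_pow by blast
  obtain \<psi> :: "'k \<Rightarrow> complex" where \<psi>: "\<And>x y. \<psi> (x + y) = \<psi> x * \<psi> y" "\<And>x. norm (\<psi> x) = 1" "\<exists>x. \<psi> x \<noteq> 1"
    using exists_nontrivial_character[OF p] by metis
  have two: "(2 :: 'k) \<noteq> 0"
  proof
    assume "(2 :: 'k) = 0"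
    then have "(of_nat 2 :: 'k) = 0" by simp
    then have "CHAR('k) dvd 2" using of_nat_eq_0_iff_char_dvd by blast
    then have "p dvd 2" using finite_field_card_facts(1)[OF p(1,4)] by simp
    then have "p = 2" by (rule primes_dvd_imp_eq[OF p(1) two_is_prime_nat])
    then show False using p(2) by simp
  qed
  define q where "q = CARD('k)"
  interpret kloosterman_character \<psi> q
    by unfold_locales (use \<psi> two weil_kloosterman[OF p \<psi>] in \<open>simp_all add: q_def\<close>)
  obtain h where h: "CARD('n) = 2 * h" using d_even by blast
  have A: "A \<subseteq> {a. qf a = j}"
    using A_sub by (auto simp: sphere_j_def qf_def dotp_def power2_eq_square)
  have q: "real q > 0" using q_pos(1) by linarith
  have "real (16 * q ^ (2 * h)) \<le> real (card A * card B)"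
    using size unfolding q_def[symmetric] h by (simp only: of_nat_le_iff)
  then have "16 * real q ^ (2 * h) \<le> real (card A) * real (card B)" by simp
  moreover have "real (card A) * sqrt (real q) \<le> real q ^ h \<or> real q ^ h \<le> real (card A)"
    using alt unfolding q_def[symmetric] h
  proof
    assume "real (card A) \<le> real q powr ((real (2 * h) - 1) / 2)"
    then have "real (card A) * sqrt (real q) \<le> real q powr ((real (2 * h) - 1) / 2) * real q powr (1 / 2)"
      using q by (simp add: powr_half_sqrt mult_right_mono)
    also have "\<dots> = real q powr real h"
      by (simp flip: powr_add add_divide_distrib)
    finally show ?thesis using q by (simp add: powr_realpow)
  next
    assume "real (card A) \<ge> real q powr (real (2 * h) / 2)"
    then show ?thesis using q by (simp add: powr_realpow)
  qed
  ultimately have "real q \<le> 4 * real (card (dist_set A B))"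
    by (rule card_dist_set_ge[OF h j_nz A])
  \<comment> \<open>The bound \<open>q / 4\<close> implies the stated
    \<open>q / 144\<close>.\<close>
  then show ?thesis unfolding q_def by linarith
qed

end
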